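(* The relaxed rank problem for $\mathcal{C}(n)$ is NP-hard (under polynomial-time many-one, i.e. Karp, reductions): given a rational number $\rho>0$ and a symmetric $n\times n$ rational matrix $\Gamma$ that is promised to belong to $\mathcal{C}(n)$, decide whether there exists $p\in\mathbb{R}^{2^n}$ with $p\ge 0$ such that $\sum_{0\le k\le P_n}p_kX^k=\Gamma$ and $\sum_{0\le k\le P_n}p_k\le\rho$.
   Context: For an integer $n\ge 1$ let $P_n=2^n-1$, and for $0\le k\le P_n$ let $x_k\in\{0,1\}^n$ be the vector giving the base-2 representation of $k$ (so $x_0,\dots,x_{P_n}$ enumerate $\{0,1\}^n$), and $X^k=x_kx_k^{\top}$. The correlation cone is $\mathcal{C}(n)=\{\sum_{0\le k\le P_n}p_kX^k : p\ge 0\}$. The promise that $\Gamma\in\mathcal{C}(n)$ means that every instance satisfies $\Gamma\in\mathcal{C}(n)$, but the weights of a decomposition are not part of the input; a promise problem is NP-hard if every language in NP has a polynomial-time many-one reduction to it whose outputs always satisfy the promise. *)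

theory Defs
  imports Complex_Main "HOL-Computational_Algebra.Polynomial" "Jordan_Normal_Form.Matrix"
begin

section \<open>Deterministic multitape Turing machines\<close>

datatype dir = Go_Left | Stay | Go_Right

text \<open>A tape is two-way infinite, given by its contents and the head position.\<close>

type_synonym tape = "(int \<Rightarrow> nat) \<times> int"

text \<open>The states are \<open>0, \<dots>, tm_states M\<close>, where \<open>0\<close> is initial and \<open>tm_states M\<close> is the
  halting state.  The symbols are \<open>0, \<dots>, tm_symbols M - 1\<close>, where \<open>0\<close> is the blank and
  \<open>1\<close>, \<open>2\<close> stand for the bits.  Tape \<open>0\<close> is the input tape, tape \<open>1\<close> the output tape.
  In \<open>tm_trans M q ss\<close> the list \<open>ss\<close> holds the scanned symbols, one for each tape.\<close>

record tm =
  tm_tapes :: nat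
  tm_symbols :: nat
  tm_states :: nat
  tm_trans :: "nat \<Rightarrow> nat list \<Rightarrow> nat \<times> (nat \<times> dir) list"

definition wf_tm :: "tm \<Rightarrow> bool" where
  "wf_tm M \<longleftrightarrow> 2 \<le> tm_tapes M \<and> 3 \<le> tm_symbols M \<and> 1 \<le> tm_states M \<and>
     (\<forall>q < tm_states M. \<forall>ss. length ss = tm_tapes M \<and> (\<forall>s \<in> set ss. s < tm_symbols M) \<longrightarrow>
        (case tm_trans M q ss of (q', as) \<Rightarrow>
           q' \<le> tm_states M \<and> length as = tm_tapes M \<and> (\<forall>(s, d) \<in> set as. s < tm_symbols M)))"

fun scan :: "tape \<Rightarrow> nat" where
  "scan (c, h) = c h"

fun dir_offset :: "dir \<Rightarrow> int" where
  "dir_offset Go_Left = -1"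
| "dir_offset Stay = 0"
| "dir_offset Go_Right = 1"

fun act :: "nat \<times> dir \<Rightarrow> tape \<Rightarrow> tape" where
  "act (s, d) (c, h) = (c(h := s), h + dir_offset d)"

fun tm_step :: "tm \<Rightarrow> nat \<times> tape list \<Rightarrow> nat \<times> tape list" where
  "tm_step M (q, ts) =
     (if q = tm_states M then (q, ts)
      else (case tm_trans M q (map scan ts) of (q', as) \<Rightarrow> (q', map2 act as ts)))"

definition bit_symbol :: "bool \<Rightarrow> nat" where
  "bit_symbol b = (if b then 2 else 1)"

definition input_tape :: "bool list \<Rightarrow> tape" where
  "input_tape x =
     ((\<lambda>i. if 0 \<le> i \<and> i < int (length x) then bit_symbol (x ! nat i) else 0), 0)"

definition tm_init :: "tm \<Rightarrow> bool list \<Rightarrow> nat \<times> tape list" where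
  "tm_init M x = (0, input_tape x # replicate (tm_tapes M - 1) (\<lambda>_. 0, 0))"

text \<open>The output is the string that starts in cell \<open>0\<close> and ends before the first blank.\<close>

definition tape_output :: "tape \<Rightarrow> bool list \<Rightarrow> bool" where
  "tape_output t y \<longleftrightarrow>
     (\<forall>i < length y. fst t (int i) = bit_symbol (y ! i)) \<and> fst t (int (length y)) = 0"

text \<open>Halting configurations are fixed points of \<^const>\<open>tm_step\<close>, so \<open>t\<close> is an upper bound on
  the running time.\<close>

definition tm_computes_within :: "tm \<Rightarrow> nat \<Rightarrow> bool list \<Rightarrow> bool list \<Rightarrow> bool" where
  "tm_computes_within M t x y \<longleftrightarrow>
     (\<exists>ts. (tm_step M ^^ t) (tm_init M x) = (tm_states M, ts) \<and> tape_output (ts ! 1) y)"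

definition polytime_computable :: "(bool list \<Rightarrow> bool list) \<Rightarrow> bool" where
  "polytime_computable f \<longleftrightarrow>
     (\<exists>M (T :: nat poly). wf_tm M \<and> (\<forall>x. tm_computes_within M (poly T (length x)) x (f x)))"


section \<open>NP and NP-hardness of promise problems\<close>

text \<open>Self-delimiting code: each bit is announced by \<open>True\<close>, the end by \<open>False\<close>.\<close>

definition enc_bits :: "bool list \<Rightarrow> bool list" where
  "enc_bits bs = concat (map (\<lambda>b. [True, b]) bs) @ [False]"

definition enc_pair :: "bool list \<Rightarrow> bool list \<Rightarrow> bool list" where
  "enc_pair x y = enc_bits x @ y"

definition NP :: "bool list set set" where
  "NP = {L. \<exists>V (q :: nat poly). polytime_computable V \<and>
     (\<forall>x. x \<in> L \<longleftrightarrow> (\<exists>y. length y \<le> poly q (length x) \<and> V (enc_pair x y) = [True]))}"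

text \<open>\<open>Promise\<close> is the set of admissible instances, \<open>Yes\<close> the set of those with answer yes.\<close>

definition promise_NP_hard :: "bool list set \<Rightarrow> bool list set \<Rightarrow> bool" where
  "promise_NP_hard Promise Yes \<longleftrightarrow>
     (\<forall>L \<in> NP. \<exists>f. polytime_computable f \<and> (\<forall>x. f x \<in> Promise) \<and> (\<forall>x. x \<in> L \<longleftrightarrow> f x \<in> Yes))"


section \<open>The correlation cone\<close>

definition P_idx :: "nat \<Rightarrow> nat" where
  "P_idx n = 2 ^ n - 1"

text \<open>Most significant digit first.\<close>

definition xvec :: "nat \<Rightarrow> nat \<Rightarrow> real vec" where
  "xvec n k = vec n (\<lambda>i. of_bool (bit k (n - Suc i)))"

definition Xmat :: "nat \<Rightarrow> nat \<Rightarrow> real mat" where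
  "Xmat n k = mat_of_cols n [xvec n k] * transpose_mat (mat_of_cols n [xvec n k])"

definition Xcomb :: "nat \<Rightarrow> real vec \<Rightarrow> real mat" where
  "Xcomb n p = mat n n (\<lambda>(i, j). \<Sum>k\<le>P_idx n. p $ k * Xmat n k $$ (i, j))"

definition correlation_cone :: "nat \<Rightarrow> real mat set" where
  "correlation_cone n = {Xcomb n p | p. p \<in> carrier_vec (2 ^ n) \<and> 0\<^sub>v (2 ^ n) \<le> p}"


section \<open>The relaxed rank problem\<close>

text \<open>Binary digits, least significant first, without leading zeros.\<close>

fun nat_bits :: "nat \<Rightarrow> bool list" where
  "nat_bits m = (if m = 0 then [] else odd m # nat_bits (m div 2))"

declare nat_bits.simps [simp del]

definition enc_nat :: "nat \<Rightarrow> bool list" where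
  "enc_nat m = enc_bits (nat_bits m)"

definition enc_int :: "int \<Rightarrow> bool list" where
  "enc_int a = (a < 0) # enc_nat (nat \<bar>a\<bar>)"

definition enc_rat :: "rat \<Rightarrow> bool list" where
  "enc_rat r = (case quotient_of r of (a, b) \<Rightarrow> enc_int a @ enc_int b)"

definition enc_instance :: "nat \<Rightarrow> rat \<Rightarrow> rat mat \<Rightarrow> bool list" where
  "enc_instance n \<rho> \<Gamma> = enc_nat n @ enc_rat \<rho> @
     concat (map (\<lambda>i. concat (map (\<lambda>j. enc_rat (\<Gamma> $$ (i, j))) [0..<n])) [0..<n])"

definition promised_instance :: "nat \<Rightarrow> rat \<Rightarrow> rat mat \<Rightarrow> bool" where
  "promised_instance n \<rho> \<Gamma> \<longleftrightarrow> 1 \<le> n \<and> \<rho> > 0 \<and> \<Gamma> \<in> carrier_mat n n \<and> transpose_mat \<Gamma> = \<Gamma> \<and>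
     map_mat real_of_rat \<Gamma> \<in> correlation_cone n"

definition relaxed_rank_le :: "nat \<Rightarrow> rat \<Rightarrow> rat mat \<Rightarrow> bool" where
  "relaxed_rank_le n \<rho> \<Gamma> \<longleftrightarrow>
     (\<exists>p \<in> carrier_vec (2 ^ n). 0\<^sub>v (2 ^ n) \<le> p \<and> Xcomb n p = map_mat real_of_rat \<Gamma> \<and>
        (\<Sum>k\<le>P_idx n. p $ k) \<le> real_of_rat \<rho>)"

definition relaxed_rank_promise :: "bool list set" where
  "relaxed_rank_promise = {enc_instance n \<rho> \<Gamma> | n \<rho> \<Gamma>. promised_instance n \<rho> \<Gamma>}"

definition relaxed_rank_yes :: "bool list set" where
  "relaxed_rank_yes =
     {enc_instance n \<rho> \<Gamma> | n \<rho> \<Gamma>. promised_instance n \<rho> \<Gamma> \<and> relaxed_rank_le n \<rho> \<Gamma>}"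

text \<open>The encoding is injective, so an encoded instance belongs to \<^const>\<open>relaxed_rank_yes\<close>
  exactly if its answer is yes.\<close>

lemma enc_bits_append_inj: "enc_bits xs @ u = enc_bits ys @ v \<Longrightarrow> xs = ys \<and> u = v"
proof (induction xs arbitrary: ys)
  case Nil
  then show ?case by (cases ys) (auto simp: enc_bits_def)
next
  case (Cons x xs)
  then show ?case by (cases ys) (auto simp: enc_bits_def)
qed

lemma nat_bits_inj: "nat_bits m = nat_bits k \<Longrightarrow> m = k"
proof (induction m arbitrary: k rule: less_induct)
  case (less m)
  show ?case
  proof (cases "m = 0 \<or> k = 0")
    case True
    then show ?thesis
      using less.prems by (auto simp: nat_bits.simps[of m] nat_bits.simps[of k] split: if_splits)
  next
    case False
    then have eq: "odd m = odd k" "nat_bits (m div 2) = nat_bits (k div 2)"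
      using less.prems by (simp_all add: nat_bits.simps[of m] nat_bits.simps[of k])
    then have "m div 2 = k div 2"
      using less.IH[of "m div 2"] False by simp
    with eq(1) show ?thesis
      by presburger
  qed
qed

lemma enc_nat_append_inj: "enc_nat m @ u = enc_nat k @ v \<Longrightarrow> m = k \<and> u = v"
  unfolding enc_nat_def using enc_bits_append_inj nat_bits_inj by blast

lemma enc_int_append_inj:
  assumes "enc_int a @ u = enc_int b @ v"
  shows "a = b \<and> u = v"
proof -
  have "(a < 0) = (b < 0)" "enc_nat (nat \<bar>a\<bar>) @ u = enc_nat (nat \<bar>b\<bar>) @ v"
    using assms by (simp_all add: enc_int_def)
  then have "(a < 0) = (b < 0)" "nat \<bar>a\<bar> = nat \<bar>b\<bar>" "u = v"
    using enc_nat_append_inj by blast+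
  then show ?thesis by linarith
qed

lemma enc_rat_append_inj:
  assumes "enc_rat r @ u = enc_rat s @ v"
  shows "r = s \<and> u = v"
proof -
  obtain a b c d where q: "quotient_of r = (a, b)" "quotient_of s = (c, d)"
    by fastforce
  then have "enc_int a @ (enc_int b @ u) = enc_int c @ (enc_int d @ v)"
    using assms by (simp add: enc_rat_def)
  then have "a = c" "b = d" "u = v"
    using enc_int_append_inj by blast+
  then show ?thesis
    using q quotient_of_inject by metis
qed

lemma concat_enc_append_inj:
  assumes "\<And>i u v. i \<in> set is \<Longrightarrow> F i @ u = G i @ v \<Longrightarrow> R i \<and> u = v"
    and "concat (map F is) @ u = concat (map G is) @ v"
  shows "(\<forall>i \<in> set is. R i) \<and> u = v"
  using assms
proof (induction "is" arbitrary: u v)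
  case Nil
  then show ?case by simp
next
  case (Cons i "is")
  from Cons.prems(2) have "F i @ (concat (map F is) @ u) = G i @ (concat (map G is) @ v)"
    by simp
  then have "R i" "concat (map F is) @ u = concat (map G is) @ v"
    using Cons.prems(1)[of i] by auto
  moreover have "(\<forall>i \<in> set is. R i) \<and> u = v"
    by (rule Cons.IH) (use Cons.prems(1) calculation(2) in auto)
  ultimately show ?case by simp
qed

lemma enc_instance_inj:
  assumes eq: "enc_instance n \<rho> \<Gamma> = enc_instance m \<sigma> \<Delta>"
    and carr: "\<Gamma> \<in> carrier_mat n n" "\<Delta> \<in> carrier_mat m m"
  shows "n = m \<and> \<rho> = \<sigma> \<and> \<Gamma> = \<Delta>"
proof -
  define E where "E N A = concat (map (\<lambda>i. concat (map (\<lambda>j. enc_rat (A $$ (i, j))) [0..<N])) [0..<N])"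
    for N :: nat and A :: "rat mat"
  have "enc_nat n @ (enc_rat \<rho> @ E n \<Gamma>) = enc_nat m @ (enc_rat \<sigma> @ E m \<Delta>)"
    using eq by (simp add: enc_instance_def E_def)
  then have nm: "n = m" and "\<rho> = \<sigma>" and EE: "E n \<Gamma> = E m \<Delta>"
    using enc_nat_append_inj enc_rat_append_inj by blast+
  have row: "(\<forall>j \<in> set [0..<n]. \<Gamma> $$ (i, j) = \<Delta> $$ (i, j)) \<and> u = v"
    if "concat (map (\<lambda>j. enc_rat (\<Gamma> $$ (i, j))) [0..<n]) @ u =
        concat (map (\<lambda>j. enc_rat (\<Delta> $$ (i, j))) [0..<n]) @ v" for i u v
    by (rule concat_enc_append_inj[OF _ that]) (rule enc_rat_append_inj)
  have "(\<forall>i \<in> set [0..<n]. \<forall>j \<in> set [0..<n]. \<Gamma> $$ (i, j) = \<Delta> $$ (i, j)) \<and> ([]::bool list) = []"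
  proof (rule concat_enc_append_inj)
    show "concat (map (\<lambda>i. concat (map (\<lambda>j. enc_rat (\<Gamma> $$ (i, j))) [0..<n])) [0..<n]) @ [] =
        concat (map (\<lambda>i. concat (map (\<lambda>j. enc_rat (\<Delta> $$ (i, j))) [0..<n])) [0..<n]) @ []"
      using EE unfolding nm E_def by (simp only:)
  qed (rule row)
  then have "\<Gamma> = \<Delta>"
    using carr nm by (intro eq_matI) auto
  with nm \<open>\<rho> = \<sigma>\<close> show ?thesis by simp
qed

lemma enc_instance_yes_iff:
  assumes "promised_instance n \<rho> \<Gamma>"
  shows "enc_instance n \<rho> \<Gamma> \<in> relaxed_rank_yes \<longleftrightarrow> relaxed_rank_le n \<rho> \<Gamma>"
  using assms enc_instance_inj
  unfolding relaxed_rank_yes_def promised_instance_def by blast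

end

theory Submission
  imports Defs "HOL-Number_Theory.Cong" "HOL-Library.Nat_Bijection"
begin

text \<open>An NP machine is turned into a tableau of tiles, and the tableau into a constraint satisfaction
  problem with binary constraints.  A distribution over the 0/1-vectors \<open>x\<close> of total weight \<open>l\<close> is studied through
  the complements \<open>y = 1 - x\<close>, whose pairwise moments are determined by \<open>\<Gamma>\<close> and \<open>l\<close>.  Prescribing
  \<open>E[y\<^sub>i y\<^sub>j] = 0\<close> forbids conflicting values, and for a flag coordinate \<open>0\<close> the moments \<open>E[y\<^sub>0] = k\<close> and
  \<open>E[y\<^sub>0 y\<^sub>i] = 1\<close> force every flagged \<open>y\<close> to be a complete consistent assignment; the other moments can be corrected
  by unflagged \<open>y\<close> of size at most \<open>2\<close>.  The moments with the flag must not depend on the unknown solution: all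
  constraints are made invariant under the shifts of \<open>\<int>/k\<close>, so that the \<open>k\<close> shifts of one solution use every value of every
  variable exactly once.  Without the bound on the total weight, \<open>\<Gamma>\<close> has an explicit decomposition, in which the moments
  of \<open>y\<close> have no meaning; this gives the promise.\<close>

section \<open>Correlation cones\<close>

text \<open>The total weight of a decomposition is no entry of \<open>\<Gamma>\<close>, yet an upper
  bound \<open>l\<close> on it is as good as its exact value, because the zero vector can be added
  for free; its complement is the all-one vector. From then on all moments of \<open>y\<close> up to
  order two are known. Two obstacles shape the encoding. A constraint that is invariant under shifts
  sees only differences of colours. Tiles are therefore powers of two, whose differences are
  distinct, read relative to an extra palette variable; a difference 0 reveals nothing, so the
  neighbour relations must be irreflexive, which the parity of the cells and an odd row length
  provide. Moreover a Turing machine has to write the matrix. The number of tiles depends on the NP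
  machine only, so all tables on colours are constants; \<open>D\<close> and \<open>l\<close> are
  sparse binary numbers, so that entries are written digit by digit without arithmetic; and
  neighbours are recognised by a tape indexed by offsets.\<close>

definition support :: "nat \<Rightarrow> nat \<Rightarrow> nat set" where
  "support n k = {i. i < n \<and> bit k (n - Suc i)}"

lemma le_P_idx_iff: "k \<le> P_idx n \<longleftrightarrow> k < 2 ^ n"
proof -
  have "0 < (2::nat) ^ n" by simp
  then show ?thesis unfolding P_idx_def by linarith
qed

lemma bij_betw_support: "bij_betw (support n) {..P_idx n} (Pow {..<n})"
proof -
  have eq: "{..P_idx n} = {..<2 ^ n}" by (auto simp: le_P_idx_iff)
  have inj: "inj_on (support n) {..<2 ^ n}"
  proof (rule inj_onI)
    fix k l :: nat assume kl: "k \<in> {..<2 ^ n}" "l \<in> {..<2 ^ n}" "support n k = support n l"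
    have "take_bit n k = take_bit n l"
    proof (rule bit_eqI)
      fix i
      show "bit (take_bit n k) i = bit (take_bit n l) i"
      proof (cases "i < n")
        case True
        then have "n - Suc i \<in> support n k \<longleftrightarrow> n - Suc i \<in> support n l" using kl(3) by simp
        with True show ?thesis by (simp add: support_def bit_take_bit_iff Suc_diff_Suc)
      qed (simp add: bit_take_bit_iff)
    qed
    with kl show "k = l" by (simp add: take_bit_nat_eq_self)
  qed
  have "support n ` {..<2 ^ n} \<subseteq> Pow {..<n}" by (auto simp: support_def)
  then have "support n ` {..<2 ^ n} = Pow {..<n}"
    by (rule card_subset_eq[rotated]) (simp_all add: card_image[OF inj] card_Pow)
  with inj show ?thesis unfolding eq bij_betw_def by blast
qed

lemma Xcomb_entry:
  assumes "i < n" "j < n"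
  shows "Xcomb n p $$ (i, j) = (\<Sum>k\<le>P_idx n. p $ k * (of_bool (i \<in> support n k) * of_bool (j \<in> support n k)))"
  using assms by (simp add: Xcomb_def Xmat_def xvec_def mat_of_cols_def scalar_prod_def support_def)

text \<open>Decompositions of \<open>g\<close> of total weight \<open>t\<close>, with the 0/1-vectors replaced by their supports.\<close>

definition corr_rep :: "nat \<Rightarrow> real \<Rightarrow> (nat \<Rightarrow> nat \<Rightarrow> real) \<Rightarrow> bool" where
  "corr_rep n t g \<longleftrightarrow> (\<exists>q. (\<forall>S. 0 \<le> q S) \<and> t = (\<Sum>S\<in>Pow {..<n}. q S) \<and>
     (\<forall>i<n. \<forall>j<n. g i j = (\<Sum>S\<in>Pow {..<n}. q S * (of_bool (i \<in> S) * of_bool (j \<in> S)))))"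

text \<open>Reindexing along the bijection of numbers with subsets. The weight \<open>t\<close> is
  kept as an exact value: the promise is then \<open>corr_rep\<close> for some \<open>t\<close>, and
  the question is \<open>corr_rep\<close> for some \<open>t\<close> below the bound.\<close>

lemma Xcomb_iff_corr_rep:
  "(\<exists>p \<in> carrier_vec (2 ^ n). 0\<^sub>v (2 ^ n) \<le> p \<and> Xcomb n p = mat n n (\<lambda>(i, j). g i j) \<and>
      (\<Sum>k\<le>P_idx n. p $ k) = t) \<longleftrightarrow> corr_rep n t g"
proof
  assume "\<exists>p \<in> carrier_vec (2 ^ n). 0\<^sub>v (2 ^ n) \<le> p \<and> Xcomb n p = mat n n (\<lambda>(i, j). g i j) \<and>
      (\<Sum>k\<le>P_idx n. p $ k) = t"
  then obtain p where p: "p \<in> carrier_vec (2 ^ n)" "0\<^sub>v (2 ^ n) \<le> p"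
    "Xcomb n p = mat n n (\<lambda>(i, j). g i j)" "(\<Sum>k\<le>P_idx n. p $ k) = t" by blast
  define f where "f = the_inv_into {..P_idx n} (support n)"
  have bij: "bij_betw f (Pow {..<n}) {..P_idx n}"
    unfolding f_def by (rule bij_betw_the_inv_into[OF bij_betw_support])
  have f: "support n (f S) = S" if "S \<in> Pow {..<n}" for S
    unfolding f_def using f_the_inv_into_f_bij_betw[OF bij_betw_support] that by blast
  define q where "q S = (if S \<in> Pow {..<n} then p $ f S else 0)" for S
  have "0 \<le> p $ k" if "k \<le> P_idx n" for k
    using p(1,2) that by (auto simp: less_eq_vec_def le_P_idx_iff)
  then have "0 \<le> q S" for S using bij by (auto simp: q_def bij_betw_def)
  moreover have "t = (\<Sum>S\<in>Pow {..<n}. q S)"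
    using sum.reindex_bij_betw[OF bij, of "($) p"] p(4) by (simp add: q_def)
  moreover have "g i j = (\<Sum>S\<in>Pow {..<n}. q S * (of_bool (i \<in> S) * of_bool (j \<in> S)))" if "i < n" "j < n" for i j
  proof -
    have "g i j = (\<Sum>k\<le>P_idx n. p $ k * (of_bool (i \<in> support n k) * of_bool (j \<in> support n k)))"
      using that p(3) Xcomb_entry[OF that, of p] by simp
    also have "\<dots> = (\<Sum>S\<in>Pow {..<n}. p $ f S * (of_bool (i \<in> support n (f S)) * of_bool (j \<in> support n (f S))))"
      by (rule sum.reindex_bij_betw[OF bij, symmetric])
    also have "\<dots> = (\<Sum>S\<in>Pow {..<n}. q S * (of_bool (i \<in> S) * of_bool (j \<in> S)))"
      by (rule sum.cong) (auto simp: q_def f)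
    finally show ?thesis .
  qed
  ultimately show "corr_rep n t g" unfolding corr_rep_def by blast
next
  assume "corr_rep n t g"
  then obtain q where q: "\<And>S. 0 \<le> q S" "t = (\<Sum>S\<in>Pow {..<n}. q S)"
    "\<And>i j. i < n \<Longrightarrow> j < n \<Longrightarrow> g i j = (\<Sum>S\<in>Pow {..<n}. q S * (of_bool (i \<in> S) * of_bool (j \<in> S)))"
    unfolding corr_rep_def by auto
  define p where "p = vec (2 ^ n) (\<lambda>k. q (support n k))"
  have p: "p $ k = q (support n k)" if "k \<le> P_idx n" for k
    using that by (simp add: p_def le_P_idx_iff)
  have "Xcomb n p = mat n n (\<lambda>(i, j). g i j)"
  proof (rule eq_matI)
    fix i j assume "i < dim_row (mat n n (\<lambda>(i, j). g i j))" "j < dim_col (mat n n (\<lambda>(i, j). g i j))"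
    then have ij: "i < n" "j < n" by auto
    have "Xcomb n p $$ (i, j) = (\<Sum>k\<le>P_idx n. q (support n k) * (of_bool (i \<in> support n k) * of_bool (j \<in> support n k)))"
      unfolding Xcomb_entry[OF ij] by (rule sum.cong) (auto simp: p)
    also have "\<dots> = g i j"
      using q(3)[OF ij] sum.reindex_bij_betw[OF bij_betw_support, of "\<lambda>S. q S * (of_bool (i \<in> S) * of_bool (j \<in> S))"]
      by simp
    finally show "Xcomb n p $$ (i, j) = mat n n (\<lambda>(i, j). g i j) $$ (i, j)" using ij by simp
  qed (auto simp: Xcomb_def)
  moreover have "(\<Sum>k\<le>P_idx n. p $ k) = t"
    using q(2) sum.reindex_bij_betw[OF bij_betw_support, of q] by (simp add: p)
  moreover have "0\<^sub>v (2 ^ n) \<le> p" using q(1) by (auto simp: less_eq_vec_def p_def)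
  ultimately show "\<exists>p \<in> carrier_vec (2 ^ n). 0\<^sub>v (2 ^ n) \<le> p \<and> Xcomb n p = mat n n (\<lambda>(i, j). g i j) \<and>
      (\<Sum>k\<le>P_idx n. p $ k) = t"
    by (intro bexI[of _ p]) (auto simp: p_def)
qed

section \<open>Sums and complements of decompositions\<close>

lemma corr_rep_single:
  assumes "0 \<le> c" "S \<subseteq> {..<n}"
  shows "corr_rep n c (\<lambda>i j. c * (of_bool (i \<in> S) * of_bool (j \<in> S)))"
  unfolding corr_rep_def using assms
  by (intro exI[of _ "\<lambda>T. if T = S then c else 0"]) (auto simp: if_distrib[where f = "\<lambda>x. x * _"] sum.delta cong: if_cong)

lemma corr_rep_add:
  assumes "corr_rep n t g" "corr_rep n t' g'"
  shows "corr_rep n (t + t') (\<lambda>i j. g i j + g' i j)"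
proof -
  from assms obtain q q' where "\<forall>S. 0 \<le> q S" "t = (\<Sum>S\<in>Pow {..<n}. q S)"
     "\<forall>i<n. \<forall>j<n. g i j = (\<Sum>S\<in>Pow {..<n}. q S * (of_bool (i \<in> S) * of_bool (j \<in> S)))"
    "\<forall>S. 0 \<le> q' S" "t' = (\<Sum>S\<in>Pow {..<n}. q' S)"
     "\<forall>i<n. \<forall>j<n. g' i j = (\<Sum>S\<in>Pow {..<n}. q' S * (of_bool (i \<in> S) * of_bool (j \<in> S)))"
    unfolding corr_rep_def by auto
  then show ?thesis unfolding corr_rep_def
    by (intro exI[of _ "\<lambda>S. q S + q' S"]) (auto simp: sum.distrib algebra_simps)
qed

lemma corr_rep_sum:
  assumes "finite A" "\<And>a. a \<in> A \<Longrightarrow> corr_rep n (t a) (g a)"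
  shows "corr_rep n (\<Sum>a\<in>A. t a) (\<lambda>i j. \<Sum>a\<in>A. g a i j)"
  using assms
proof (induction A)
  case empty
  show ?case using corr_rep_single[of 0 "{}" n] by simp
next
  case (insert x F)
  then show ?case using corr_rep_add[of n "t x" "g x"] by simp
qed

lemma corr_rep_cong:
  assumes "corr_rep n t g" "t = t'" "\<And>i j. i < n \<Longrightarrow> j < n \<Longrightarrow> g i j = g' i j"
  shows "corr_rep n t' g'"
  using assms unfolding corr_rep_def by auto

text \<open>Replacing each \<open>S\<close> by its complement turns
  \<open>of_bool (i \<in> S)\<close> into \<open>1 - of_bool (i \<in> S)\<close>, and expanding the
  product gives the formula. The missing weight \<open>l - t\<close> goes to the zero vector, which
  is invisible in \<open>g\<close> and becomes the full set. For fixed \<open>l\<close> the map on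
  matrices is an involution, so the same lemma leads from moments to the instance and back.\<close>

lemma corr_rep_complement:
  assumes "corr_rep n t g" "t \<le> l"
  shows "corr_rep n l (\<lambda>i j. l - g i i - g j j + g i j)"
proof -
  obtain q where q: "\<And>S. 0 \<le> q S" "t = (\<Sum>S\<in>Pow {..<n}. q S)"
    "\<And>i j. i < n \<Longrightarrow> j < n \<Longrightarrow> g i j = (\<Sum>S\<in>Pow {..<n}. q S * (of_bool (i \<in> S) * of_bool (j \<in> S)))"
    using assms(1) unfolding corr_rep_def by auto
  define p where "p S = q ({..<n} - S) + (if S = {..<n} then l - t else 0)" for S
  have sum_p: "(\<Sum>S\<in>Pow {..<n}. p S * f S) = (\<Sum>S\<in>Pow {..<n}. q S * f ({..<n} - S)) + (l - t) * f {..<n}" for f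
  proof -
    have "(\<Sum>S\<in>Pow {..<n}. q ({..<n} - S) * f S) = (\<Sum>S\<in>Pow {..<n}. q S * f ({..<n} - S))"
      by (rule sum.reindex_bij_witness[of _ "\<lambda>S. {..<n} - S" "\<lambda>S. {..<n} - S"]) (auto simp: double_diff)
    moreover have "(\<Sum>S\<in>Pow {..<n}. (if S = {..<n} then l - t else 0) * f S) = (l - t) * f {..<n}"
      by (simp add: if_distrib[where f = "\<lambda>x. x * _"] cong: if_cong)
    ultimately show ?thesis by (simp add: p_def distrib_right sum.distrib)
  qed
  have "(\<Sum>S\<in>Pow {..<n}. p S * (of_bool (i \<in> S) * of_bool (j \<in> S))) = l - g i i - g j j + g i j" if ij: "i < n" "j < n" for i j
  proof -
    have "(\<Sum>S\<in>Pow {..<n}. q S * (of_bool (i \<in> {..<n} - S) * of_bool (j \<in> {..<n} - S))) =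
        (\<Sum>S\<in>Pow {..<n}. q S - q S * (of_bool (i \<in> S) * of_bool (i \<in> S)) - q S * (of_bool (j \<in> S) * of_bool (j \<in> S))
          + q S * (of_bool (i \<in> S) * of_bool (j \<in> S)))"
      using ij by (intro sum.cong) auto
    also have "\<dots> = t - g i i - g j j + g i j"
      unfolding sum.distrib sum_subtractf q(3)[OF ij] q(3)[OF ij(1,1)] q(3)[OF ij(2,2)] q(2) ..
    finally show ?thesis unfolding sum_p using ij by simp
  qed
  moreover have "(\<Sum>S\<in>Pow {..<n}. p S) = l" using sum_p[of "\<lambda>_. 1"] q(2) by simp
  ultimately show ?thesis unfolding corr_rep_def using q(1) assms(2)
    by (intro exI[of _ p]) (auto simp: p_def)
qed

text \<open>Two-element sets realise the off-diagonal entries. Each adds its weight to two diagonal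
  entries, which dominance pays for, and singletons fill up the diagonal. Every set used adds its
  weight to at least one diagonal entry, whence the bound on \<open>t\<close>.\<close>

lemma corr_rep_diagonally_dominant:
  fixes w :: "nat \<Rightarrow> nat \<Rightarrow> real"
  assumes sym: "\<And>i j. w i j = w j i" and nonneg: "\<And>i j. 0 \<le> w i j"
    and dom: "\<And>i. i < n \<Longrightarrow> (\<Sum>j\<in>{..<n} - {i}. w i j) \<le> w i i"
  shows "\<exists>t \<le> (\<Sum>i<n. w i i). corr_rep n t w"
proof -
  \<comment> \<open>The sums below run over ordered pairs, so each \<open>{a, b}\<close> occurs
    twice, with half of the entry each time.\<close>
  define v where "v i j = (if i = j then 0 else w i j / 2)" for i j
  define r where "r i = (\<Sum>j<n. 2 * v i j)" for i
  have r: "0 \<le> r i" "i < n \<Longrightarrow> r i \<le> w i i" for i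
  proof -
    have "(\<Sum>j<n. 2 * v i j) = (\<Sum>j\<in>{..<n} - {i}. w i j)"
      by (rule sum.mono_neutral_cong_right) (auto simp: v_def)
    then show "i < n \<Longrightarrow> r i \<le> w i i" using dom by (simp add: r_def)
  qed (auto simp: r_def v_def nonneg intro!: sum_nonneg)
  define t where "t = (\<Sum>a<n. \<Sum>b<n. v a b) + (\<Sum>a<n. w a a - r a)"
  have rep: "corr_rep n t (\<lambda>i j. (\<Sum>a<n. \<Sum>b<n. v a b * (of_bool (i \<in> {a, b}) * of_bool (j \<in> {a, b})))
       + (\<Sum>a<n. (w a a - r a) * (of_bool (i \<in> {a}) * of_bool (j \<in> {a}))))"
    unfolding t_def by (intro corr_rep_add corr_rep_sum corr_rep_single) (auto simp: v_def nonneg r)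
  have pt: "(\<Sum>a<n. \<Sum>b<n. v a b * (of_bool (a = i) * of_bool (b = j))) = v i j" if "i < n" "j < n" for i j
  proof -
    have "(\<Sum>a<n. \<Sum>b<n. v a b * (of_bool (a = i) * of_bool (b = j)))
        = (\<Sum>a<n. if a = i then \<Sum>b<n. if b = j then v a b else 0 else 0)"
      by (intro sum.cong) (auto intro!: sum.cong)
    then show ?thesis using that by simp
  qed
  have row: "(\<Sum>a<n. \<Sum>b<n. v a b * of_bool (a = i)) = r i / 2" "(\<Sum>a<n. \<Sum>b<n. v a b * of_bool (b = i)) = r i / 2"
    if "i < n" for i
  proof -
    have "(\<Sum>a<n. \<Sum>b<n. v a b * of_bool (a = i)) = (\<Sum>a<n. if a = i then \<Sum>b<n. v a b else 0)"
      by (rule sum.cong) auto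
    then show 1: "(\<Sum>a<n. \<Sum>b<n. v a b * of_bool (a = i)) = r i / 2"
      using that by (simp add: r_def sum_distrib_left[symmetric])
    have "v a b = v b a" for a b using sym[of a b] by (simp add: v_def)
    then show "(\<Sum>a<n. \<Sum>b<n. v a b * of_bool (b = i)) = r i / 2" using 1 by (subst sum.swap) simp
  qed
  have "corr_rep n t w"
  proof (rule corr_rep_cong[OF rep refl])
    fix i j assume ij: "i < n" "j < n"
    have "(\<Sum>a<n. (w a a - r a) * (of_bool (i \<in> {a}) * of_bool (j \<in> {a}))) =
        (\<Sum>a<n. if a = i then (w a a - r a) * of_bool (i = j) else 0)"
      by (rule sum.cong) auto
    then have s: "(\<Sum>a<n. (w a a - r a) * (of_bool (i \<in> {a}) * of_bool (j \<in> {a}))) = (w i i - r i) * of_bool (i = j)"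
      using ij by simp
    have "(\<Sum>a<n. \<Sum>b<n. v a b * (of_bool (i \<in> {a, b}) * of_bool (j \<in> {a, b}))) = (if i = j then r i else w i j)"
    proof (cases "i = j")
      case True
      have "(\<Sum>a<n. \<Sum>b<n. v a b * (of_bool (i \<in> {a, b}) * of_bool (j \<in> {a, b}))) =
          (\<Sum>a<n. \<Sum>b<n. v a b * of_bool (a = i) + v a b * of_bool (b = i))"
        using True by (intro sum.cong) (auto simp: v_def)
      then show ?thesis using True row[OF ij(1)] by (simp add: sum.distrib)
    next
      case False
      have "(\<Sum>a<n. \<Sum>b<n. v a b * (of_bool (i \<in> {a, b}) * of_bool (j \<in> {a, b}))) =
          (\<Sum>a<n. \<Sum>b<n. v a b * (of_bool (a = i) * of_bool (b = j)) + v a b * (of_bool (a = j) * of_bool (b = i)))"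
        using False by (intro sum.cong) auto
      then show ?thesis using False pt[OF ij] pt[OF ij(2,1)] sym[of i j] by (simp add: sum.distrib v_def)
    qed
    then show "(\<Sum>a<n. \<Sum>b<n. v a b * (of_bool (i \<in> {a, b}) * of_bool (j \<in> {a, b})))
       + (\<Sum>a<n. (w a a - r a) * (of_bool (i \<in> {a}) * of_bool (j \<in> {a}))) = w i j"
      unfolding s by simp
  qed
  moreover have "t \<le> (\<Sum>i<n. w i i)"
  proof -
    have "(\<Sum>a<n. \<Sum>b<n. v a b) \<le> (\<Sum>a<n. r a)"
      unfolding r_def by (intro sum_mono) (simp add: v_def nonneg)
    then show ?thesis by (simp add: t_def sum_subtractf)
  qed
  ultimately show ?thesis by blast
qed

text \<open>Index \<open>0\<close> is a flag; \<open>k\<close> vectors of weight \<open>1\<close> carry it.\<close>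

definition flag_moment :: "real \<Rightarrow> real \<Rightarrow> (nat \<Rightarrow> nat \<Rightarrow> bool) \<Rightarrow> nat \<Rightarrow> nat \<Rightarrow> real" where
  "flag_moment k D ok i j = (if i = 0 \<and> j = 0 then k else if i = 0 \<or> j = 0 then 1 else if i = j then D else of_bool (ok i j))"

text \<open>The instance matrix: the moments of \<open>x = 1 - y\<close> if those of
  \<open>y\<close> are \<open>flag_moment\<close> and the total weight is \<open>l\<close>.\<close>

definition flag_gram :: "real \<Rightarrow> real \<Rightarrow> real \<Rightarrow> (nat \<Rightarrow> nat \<Rightarrow> bool) \<Rightarrow> nat \<Rightarrow> nat \<Rightarrow> real" where
  "flag_gram l k D ok i j = l - flag_moment k D ok i i - flag_moment k D ok j j + flag_moment k D ok i j"

text \<open>Supplies the unflagged part of a distribution. A row has fewer than \<open>n\<close>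
  off-diagonal entries, each at most \<open>k\<close>, so \<open>n * k \<le> D\<close> gives
  dominance.\<close>

lemma corr_rep_off_flag:
  fixes v :: "nat \<Rightarrow> nat \<Rightarrow> real"
  assumes sym: "\<And>i j. v i j = v j i" and v: "\<And>i j. 0 \<le> v i j" "\<And>i j. v i j \<le> k" and D: "real n * k \<le> D"
  shows "\<exists>t \<le> real n * D. corr_rep n t (\<lambda>i j. if i = 0 \<or> j = 0 then 0 else if i = j then D else v i j)"
proof -
  have "0 \<le> k" using v[of 0 0] by linarith
  then have "0 \<le> D" using D by (meson mult_nonneg_nonneg of_nat_0_le_iff order_trans)
  define w where "w i j = (if i = 0 \<or> j = 0 then 0 else if i = j then D else v i j)" for i j
  have "\<exists>t \<le> (\<Sum>i<n. w i i). corr_rep n t w"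
  proof (rule corr_rep_diagonally_dominant)
    fix i assume "i < n"
    have "(\<Sum>j\<in>{..<n} - {i}. w i j) \<le> (\<Sum>j\<in>{..<n} - {i}. if i = 0 then 0 else k)"
      using v \<open>0 \<le> k\<close> by (intro sum_mono) (auto simp: w_def)
    also have "\<dots> \<le> w i i"
    proof (cases "i = 0")
      case False
      have "real (card ({..<n} - {i})) * k \<le> real n * k"
        using \<open>0 \<le> k\<close> card_mono[of "{..<n}" "{..<n} - {i}"] by (intro mult_right_mono) auto
      then show ?thesis using False D by (simp add: w_def)
    qed (simp add: w_def)
    finally show "(\<Sum>j\<in>{..<n} - {i}. w i j) \<le> w i i" .
  next
    fix i j
    show "w i j = w j i" using sym[of i j] by (auto simp: w_def)
    show "0 \<le> w i j" using v(1)[of i j] \<open>0 \<le> D\<close> by (simp add: w_def)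
  qed
  then obtain t where t: "t \<le> (\<Sum>i<n. w i i)" "corr_rep n t w" by blast
  have "(\<Sum>i<n. w i i) \<le> (\<Sum>i<n. D)" using \<open>0 \<le> D\<close> by (intro sum_mono) (simp add: w_def)
  then have "t \<le> real n * D" using t(1) by simp
  then show ?thesis using t(2) unfolding w_def[abs_def] by blast
qed

text \<open>The flagged part is replaced by \<open>k - 1\<close> copies of each unit vector, which exceeds the budget.\<close>

lemma corr_rep_flag_gram:
  assumes sym: "\<And>i j. ok i j = ok j i"
    and k: "2 \<le> k" and D: "1 + real n * k \<le> D" and l: "real n * D + k \<le> l"
  shows "\<exists>t. corr_rep n t (flag_gram l k D ok)"
proof -
  have rep: "corr_rep n (\<Sum>a\<in>{1..<n}. k - 1) (\<lambda>i j. \<Sum>a\<in>{1..<n}. (k - 1) * (of_bool (i \<in> {a}) * of_bool (j \<in> {a})))"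
    using k by (intro corr_rep_sum corr_rep_single) auto
  \<comment> \<open>The off-diagonal entries are fitted to a complement of weight
    \<open>l - k\<close> with diagonal \<open>D - 1\<close>: writing \<open>e\<close> for
    \<open>of_bool (ok i j)\<close>,
    \<open>(l - k) - 2 * (D - 1) + (k - 2 + e) = l - 2 * D + e\<close>. The condition
    \<open>2 \<le> k\<close> makes \<open>k - 2 + e\<close> nonnegative, and the unit vectors then
    correct the diagonal.\<close>
  have "\<exists>t \<le> real n * (D - 1). corr_rep n t (\<lambda>i j. if i = 0 \<or> j = 0 then 0 else if i = j then D - 1 else k - 2 + of_bool (ok i j))"
    by (rule corr_rep_off_flag[of _ k]) (use sym k D in \<open>auto simp: of_bool_def\<close>)
  then obtain t where t: "t \<le> real n * (D - 1)"
    "corr_rep n t (\<lambda>i j. if i = 0 \<or> j = 0 then 0 else if i = j then D - 1 else k - 2 + of_bool (ok i j))" by blast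
  have "t \<le> l - k" using t(1) l by (simp add: algebra_simps)
  from corr_rep_add[OF rep corr_rep_complement[OF t(2) this]]
  have "corr_rep n ((\<Sum>a\<in>{1..<n}. k - 1) + (l - k)) (flag_gram l k D ok)"
  proof (rule corr_rep_cong[OF _ refl])
    fix i j assume ij: "i < n" "j < n"
    have "(\<Sum>a\<in>{1..<n}. (k - 1) * (of_bool (i \<in> {a}) * of_bool (j \<in> {a}))) = (\<Sum>a\<in>{1..<n}. if a = i then (k - 1) * of_bool (i = j) else 0)"
      by (rule sum.cong) auto
    then show "(\<Sum>a\<in>{1..<n}. (k - 1) * (of_bool (i \<in> {a}) * of_bool (j \<in> {a}))) +
       (l - k - (if i = 0 \<or> i = 0 then 0 else if i = i then D - 1 else k - 2 + of_bool (ok i i))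
         - (if j = 0 \<or> j = 0 then 0 else if j = j then D - 1 else k - 2 + of_bool (ok j j))
         + (if i = 0 \<or> j = 0 then 0 else if i = j then D - 1 else k - 2 + of_bool (ok i j))) = flag_gram l k D ok i j"
      using ij by (auto simp: flag_gram_def flag_moment_def)
  qed
  then show ?thesis by blast
qed

text \<open>The \<open>k\<close> flagged vectors are the colour classes, each with the flag added.
  Every index lies in exactly one class, so its moment with the flag is 1 whatever the colouring is.
  Compatible pairs of different colours, and the rest of the diagonal, are left to unflagged
  vectors.\<close>

lemma corr_rep_flag_gram_colouring:
  assumes sym: "\<And>i j. ok i j = ok j i" and c: "\<And>i. c i < k"
    and ok: "\<And>i j. i \<in> {1..<n} \<Longrightarrow> j \<in> {1..<n} \<Longrightarrow> i \<noteq> j \<Longrightarrow> c i = c j \<Longrightarrow> ok i j"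
    and k: "2 \<le> k" and D: "1 + real n * real k \<le> D" and l: "real n * D + real k \<le> l"
  shows "corr_rep n l (flag_gram l (real k) D ok)"
proof -
  define P where "P a = {i. i < n \<and> (i = 0 \<or> c i = a)}" for a
  define v where "v i j = (if i \<in> {1..<n} \<and> j \<in> {1..<n} \<and> c i = c j then 0 else of_bool (ok i j) :: real)" for i j
  have rep: "corr_rep n (\<Sum>a<k. 1) (\<lambda>i j. \<Sum>a<k. 1 * (of_bool (i \<in> P a) * of_bool (j \<in> P a)))"
    by (intro corr_rep_sum corr_rep_single) (auto simp: P_def)
  have "\<exists>t \<le> real n * (D - 1). corr_rep n t (\<lambda>i j. if i = 0 \<or> j = 0 then 0 else if i = j then D - 1 else v i j)"
    by (rule corr_rep_off_flag[of _ "real k"]) (use sym k D in \<open>auto simp: v_def\<close>)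
  then obtain t where t: "t \<le> real n * (D - 1)"
    "corr_rep n t (\<lambda>i j. if i = 0 \<or> j = 0 then 0 else if i = j then D - 1 else v i j)" by blast
  have "corr_rep n ((\<Sum>a<k. 1) + t) (flag_moment (real k) D ok)"
  proof (rule corr_rep_cong[OF corr_rep_add[OF rep t(2)] refl])
    fix i j assume ij: "i < n" "j < n"
    \<comment> \<open>Unless both indices are the flag, \<open>x\<close> is the only class that can
      contain both. The flag lies in all classes, so for \<open>i = 0\<close> the colour of
      \<open>j\<close> counts.\<close>
    define x where "x = c (if i = 0 then j else i)"
    define e :: real where "e = of_bool (i = 0 \<or> j = 0 \<or> c i = c j)"
    have "1 * (of_bool (i \<in> P a) * of_bool (j \<in> P a)) = (if i = 0 \<and> j = 0 then 1 else if a = x then e else 0)" for a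
      using ij by (cases "i = 0"; cases "j = 0") (simp_all add: P_def x_def e_def)
    then have "(\<Sum>a<k. 1 * (of_bool (i \<in> P a) * of_bool (j \<in> P a))) = (\<Sum>a<k. if i = 0 \<and> j = 0 then 1 else if a = x then e else 0)"
      by (simp only:)
    also have "\<dots> = (if i = 0 \<and> j = 0 then real k else e)"
      using c[of "if i = 0 then j else i"] by (cases "i = 0 \<and> j = 0") (simp_all only: if_True if_False x_def[symmetric], simp_all)
    finally show "(\<Sum>a<k. 1 * (of_bool (i \<in> P a) * of_bool (j \<in> P a))) + (if i = 0 \<or> j = 0 then 0 else if i = j then D - 1 else v i j)
        = flag_moment (real k) D ok i j"
      using ok[of i j] ij by (auto simp: flag_moment_def v_def e_def)
  qed
  moreover have "(\<Sum>a<k. 1) + t \<le> l" using t(1) l by (simp add: algebra_simps)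
  ultimately show ?thesis unfolding flag_gram_def[abs_def] by (rule corr_rep_complement)
qed

text \<open>A set of positive weight contains at most one index of each of the \<open>M\<close>
  groups, so \<open>M\<close> minus the number of its indices is nonnegative. The expectation of
  this quantity over the flagged sets is \<open>M * k - (n - 1) = 0\<close>, hence it vanishes on
  each flagged set of positive weight. Such a set exists because the flag has moment
  \<open>k > 0\<close>.\<close>

lemma corr_rep_flag_gram_independent:
  assumes rep: "corr_rep n t (flag_gram l (real k) D ok)" and t: "t \<le> l" and k: "1 \<le> k"
    and n: "n = Suc (M * k)"
    and grp: "\<And>i j. i \<in> {1..<n} \<Longrightarrow> j \<in> {1..<n} \<Longrightarrow> (i - 1) div k = (j - 1) div k \<Longrightarrow> i \<noteq> j \<Longrightarrow> \<not> ok i j"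
  shows "\<exists>C \<subseteq> {1..<n}. card C = M \<and> (\<forall>i\<in>C. \<forall>j\<in>C. i \<noteq> j \<longrightarrow> ok i j)"
proof -
  have "corr_rep n l (flag_moment (real k) D ok)"
    using corr_rep_complement[OF rep t] by (rule corr_rep_cong) (auto simp: flag_gram_def)
  then obtain q where q: "\<forall>S. 0 \<le> q S"
    and m: "\<forall>i<n. \<forall>j<n. flag_moment (real k) D ok i j = (\<Sum>S\<in>Pow {..<n}. q S * (of_bool (i \<in> S) * of_bool (j \<in> S)))"
    unfolding corr_rep_def by blast
  define E where "E f = (\<Sum>S\<in>Pow {..<n}. q S * f S)" for f :: "nat set \<Rightarrow> real"
  define y where "y i S = (of_bool (i \<in> S) :: real)" for i and S :: "nat set"
  have E_yy: "E (\<lambda>S. y i S * y j S) = flag_moment (real k) D ok i j" if "i < n" "j < n" for i j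
    using m that unfolding E_def y_def by simp
  have zero: "q S * f S = 0" if "E f = 0" "\<And>S. S \<subseteq> {..<n} \<Longrightarrow> 0 \<le> q S * f S" "S \<subseteq> {..<n}" for f S
    using that sum_nonneg_eq_0_iff[of "Pow {..<n}" "\<lambda>S. q S * f S"] unfolding E_def by auto
  have ok: "ok i j" if S: "S \<subseteq> {..<n}" "0 < q S" and ij: "i \<in> S \<inter> {1..<n}" "j \<in> S \<inter> {1..<n}" "i \<noteq> j" for S i j
  proof (rule ccontr)
    assume "\<not> ok i j"
    then have "E (\<lambda>S. y i S * y j S) = 0" using ij by (simp add: E_yy flag_moment_def)
    then have "q S * (y i S * y j S) = 0" by (rule zero) (use q S in \<open>auto simp: y_def\<close>)
    with S ij show False by (auto simp: y_def)
  qed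
  have card_le: "card (S \<inter> {1..<n}) \<le> M" if S: "S \<subseteq> {..<n}" "0 < q S" for S
  proof -
    have "inj_on (\<lambda>i. (i - 1) div k) (S \<inter> {1..<n})"
      using ok[OF S] grp by (intro inj_onI) blast
    moreover have "(\<lambda>i. (i - 1) div k) ` (S \<inter> {1..<n}) \<subseteq> {..<M}"
      using n k by (auto simp: less_mult_imp_div_less)
    ultimately show ?thesis by (metis card_image card_lessThan card_mono finite_lessThan)
  qed
  define f where "f S = y 0 S * (real M - real (card (S \<inter> {1..<n})))" for S
  have card_y: "(\<Sum>i\<in>{1..<n}. y i S) = real (card (S \<inter> {1..<n}))" for S
    by (simp add: y_def sum_of_bool_eq Int_def conj_commute)
  have f: "f S = real M * (y 0 S * y 0 S) - (\<Sum>i\<in>{1..<n}. y 0 S * y i S)" for S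
    unfolding f_def sum_distrib_left[symmetric] card_y by (simp add: y_def)
  have "E f = real M * E (\<lambda>S. y 0 S * y 0 S) - (\<Sum>i\<in>{1..<n}. E (\<lambda>S. y 0 S * y i S))"
    unfolding f E_def by (subst sum.swap) (simp add: sum_subtractf right_diff_distrib sum_distrib_left algebra_simps)
  also have "\<dots> = real M * real k - (\<Sum>i\<in>{1..<n}. 1)"
    using n by (intro arg_cong2[of _ _ _ _ minus] sum.cong) (auto simp: E_yy flag_moment_def)
  also have "\<dots> = 0" using n by simp
  finally have Ef: "E f = 0" .
  have "E (\<lambda>S. y 0 S * y 0 S) = real k" using n by (simp add: E_yy flag_moment_def)
  then have "(\<Sum>S\<in>Pow {..<n}. q S * (y 0 S * y 0 S)) \<noteq> 0" using k by (simp add: E_def)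
  then obtain S where S: "S \<subseteq> {..<n}" "q S * (y 0 S * y 0 S) \<noteq> 0"
    by (rule sum.not_neutral_contains_not_neutral) blast
  then have qS: "0 < q S" and "0 \<in> S" using spec[OF q, of S] by (auto simp: y_def less_le)
  have "q S * f S = 0"
  proof (rule zero[OF Ef _ S(1)])
    fix S assume "S \<subseteq> {..<n}"
    then show "0 \<le> q S * f S"
      using spec[OF q, of S] card_le[of S] by (cases "q S = 0") (auto simp: f_def y_def less_le)
  qed
  then have "card (S \<inter> {1..<n}) = M" using qS \<open>0 \<in> S\<close> by (simp add: f_def y_def)
  then show ?thesis using ok[OF S(1) qS] by (intro exI[of _ "S \<inter> {1..<n}"]) auto
qed

section \<open>Tilings as correlation cones\<close>

text \<open>Offsets in a row-by-row numbering of cells: 1 is the cell itself, 2 and 3 are its right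
  and left neighbours, 4 and 5 the neighbours in the next and previous row. The codes double as tape
  symbols, with 0 the blank.\<close>

definition mark :: "nat \<Rightarrow> int \<Rightarrow> nat" where
  "mark W z = (if z = 0 then 1 else if z = 1 then 2 else if z = -1 then 3
     else if z = int W then 4 else if z = - int W then 5 else 0)"

text \<open>Tile \<open>a < d\<close> in a cell is encoded as the colour of the cell relative to the palette, \<open>2 ^ a\<close>
  modulo \<open>2 ^ (d + 1)\<close>.  For \<open>a \<noteq> b\<close> the difference \<open>2 ^ b - 2 ^ a\<close> determines \<open>a\<close> and \<open>b\<close>, so that
  constraints on pairs of neighbours are constraints on colour differences.\<close>

definition unary_ok :: "nat \<Rightarrow> (nat \<Rightarrow> bool) \<Rightarrow> nat \<Rightarrow> nat \<Rightarrow> bool" where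
  "unary_ok d P c c' \<longleftrightarrow> (\<exists>a<d. P a \<and> (c + 2 ^ a) mod 2 ^ Suc d = c' mod 2 ^ Suc d)"

text \<open>Subtraction-free form of \<open>c' - c = 2 ^ b - 2 ^ a\<close>: for
  \<open>c = p + 2 ^ a\<close> and \<open>c' = p + 2 ^ b\<close> the palette colour \<open>p\<close>
  cancels.\<close>

definition binary_ok :: "nat \<Rightarrow> (nat \<Rightarrow> nat \<Rightarrow> bool) \<Rightarrow> nat \<Rightarrow> nat \<Rightarrow> bool" where
  "binary_ok d R c c' \<longleftrightarrow> (\<exists>a<d. \<exists>b<d. R a b \<and> (c' + 2 ^ a) mod 2 ^ Suc d = (c + 2 ^ b) mod 2 ^ Suc d)"

definition mark_ok :: "nat \<Rightarrow> (nat \<Rightarrow> nat \<Rightarrow> bool) \<Rightarrow> (nat \<Rightarrow> nat \<Rightarrow> bool) \<Rightarrow> nat \<Rightarrow> nat \<Rightarrow> nat \<Rightarrow> bool" where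
  "mark_ok d H V m c c' = (if m = 0 then True else if m = 1 then False
     else if m = 2 then binary_ok d H c c' else if m = 3 then binary_ok d H c' c
     else if m = 4 then binary_ok d V c c' else binary_ok d V c' c)"

text \<open>The grid is a single list with row length \<open>W\<close>. Thus \<open>H\<close> also
  relates the last cell of a row to the first cell of the next; the wall tiles will absorb
  this.\<close>

definition tiling :: "nat \<Rightarrow> (nat \<Rightarrow> nat \<Rightarrow> bool) \<Rightarrow> (nat \<Rightarrow> nat \<Rightarrow> bool) \<Rightarrow> (nat \<Rightarrow> nat \<Rightarrow> bool) \<Rightarrow> nat \<Rightarrow> nat list \<Rightarrow>
    (nat \<Rightarrow> nat) \<Rightarrow> bool" where
  "tiling d H V ty W us \<tau> \<longleftrightarrow> (\<forall>v<length us. \<tau> v < d \<and> ty (us ! v) (\<tau> v)) \<and>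
     (\<forall>v. v + 1 < length us \<longrightarrow> H (\<tau> v) (\<tau> (v + 1))) \<and>
     (\<forall>v. v + W < length us \<longrightarrow> V (\<tau> v) (\<tau> (v + W)))"

text \<open>Variable \<open>0\<close> is the palette, variable \<open>v + 1\<close> is cell \<open>v\<close>.\<close>

definition var_ok :: "nat \<Rightarrow> (nat \<Rightarrow> nat \<Rightarrow> bool) \<Rightarrow> (nat \<Rightarrow> nat \<Rightarrow> bool) \<Rightarrow> (nat \<Rightarrow> nat \<Rightarrow> bool) \<Rightarrow> nat \<Rightarrow> nat list \<Rightarrow>
    nat \<Rightarrow> nat \<Rightarrow> nat \<Rightarrow> nat \<Rightarrow> bool" where
  "var_ok d H V ty W us v c v' c' = (if v = v' then False else if v = 0 then unary_ok d (ty (us ! (v' - 1))) c c'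
     else if v' = 0 then unary_ok d (ty (us ! (v - 1))) c' c
     else mark_ok d H V (mark W (int v' - int v)) c c')"

text \<open>Index 0 is the flag. The others run through the variables in blocks of
  \<open>2 ^ Suc d\<close> colours.\<close>

definition index_ok :: "nat \<Rightarrow> (nat \<Rightarrow> nat \<Rightarrow> bool) \<Rightarrow> (nat \<Rightarrow> nat \<Rightarrow> bool) \<Rightarrow> (nat \<Rightarrow> nat \<Rightarrow> bool) \<Rightarrow> nat \<Rightarrow> nat list \<Rightarrow>
    nat \<Rightarrow> nat \<Rightarrow> bool" where
  "index_ok d H V ty W us i j = var_ok d H V ty W us ((i - 1) div 2 ^ Suc d) ((i - 1) mod 2 ^ Suc d)
     ((j - 1) div 2 ^ Suc d) ((j - 1) mod 2 ^ Suc d)"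

text \<open>\<open>2 \<le> W\<close> keeps the four neighbour offsets apart.\<close>

lemma mark_uminus: "2 \<le> W \<Longrightarrow> mark W (- z) = (if mark W z = 2 then 3 else if mark W z = 3 then 2
    else if mark W z = 4 then 5 else if mark W z = 5 then 4 else mark W z)"
  by (auto simp: mark_def)

lemma mark_ok_uminus: "2 \<le> W \<Longrightarrow> mark_ok d H V (mark W (- z)) c c' = mark_ok d H V (mark W z) c' c"
  unfolding mark_uminus by (auto simp: mark_ok_def mark_def)

lemma var_ok_sym:
  assumes "2 \<le> W"
  shows "var_ok d H V ty W us v c v' c' = var_ok d H V ty W us v' c' v c"
proof -
  have "mark_ok d H V (mark W (int v - int v')) c' c = mark_ok d H V (mark W (int v' - int v)) c c'"
    using mark_ok_uminus[OF assms, of d H V "int v' - int v" c' c] by (simp only: minus_diff_eq)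
  then show ?thesis unfolding var_ok_def by (simp only: eq_commute[of v v'] split: if_split) blast
qed

text \<open>Powers of two form a Sidon set: the binary expansion of the sum determines the
  exponents, where two equal ones merge into their successor.\<close>

lemma pow2_sum_eq:
  assumes "(2::nat) ^ a + 2 ^ b = 2 ^ c + 2 ^ e"
  shows "(a = c \<and> b = e) \<or> (a = e \<and> b = c)"
proof -
  define S where "S i j = (if i = j then {Suc i} else {i, j})" for i j :: nat
  have "set_encode (S i j) = 2 ^ i + 2 ^ j" "finite (S i j)" for i j
    by (simp_all add: S_def set_encode_def)
  then have "S a b = S c e" using assms by (metis set_encode_eq)
  then show ?thesis by (auto simp: S_def doubleton_eq_iff split: if_splits)
qed

text \<open>A sum of two powers, each below \<open>2 ^ d\<close>, is below the modulus, so the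
  congruence is an equation. The Sidon property then leaves \<open>a' = a\<close>,
  \<open>b' = b\<close>, or else \<open>a = b\<close>, \<open>a' = b'\<close>; the latter is a zero
  difference and is excluded by irreflexivity.\<close>

lemma binary_ok_iff:
  assumes irr: "\<And>a. a < d \<Longrightarrow> \<not> R a a" and ab: "a < d" "b < d"
  shows "binary_ok d R ((c + 2 ^ a) mod 2 ^ Suc d) ((c + 2 ^ b) mod 2 ^ Suc d) \<longleftrightarrow> R a b"
proof
  assume "R a b"
  moreover have "((c + 2 ^ b) mod 2 ^ Suc d + 2 ^ a) mod 2 ^ Suc d = ((c + 2 ^ a) mod 2 ^ Suc d + 2 ^ b) mod 2 ^ Suc d"
    unfolding mod_add_left_eq by (simp only: add_ac)
  ultimately show "binary_ok d R ((c + 2 ^ a) mod 2 ^ Suc d) ((c + 2 ^ b) mod 2 ^ Suc d)"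
    unfolding binary_ok_def using ab by blast
next
  assume "binary_ok d R ((c + 2 ^ a) mod 2 ^ Suc d) ((c + 2 ^ b) mod 2 ^ Suc d)"
  then obtain a' b' where R: "a' < d" "b' < d" "R a' b'"
    and eq: "((c + 2 ^ b) mod 2 ^ Suc d + 2 ^ a') mod 2 ^ Suc d = ((c + 2 ^ a) mod 2 ^ Suc d + 2 ^ b') mod 2 ^ Suc d"
    unfolding binary_ok_def by blast
  have "[c + (2 ^ b + 2 ^ a') = c + (2 ^ a + 2 ^ b')] (mod 2 ^ Suc d)"
    using eq unfolding cong_def mod_add_left_eq by (simp only: add.assoc)
  then have "[2 ^ b + 2 ^ a' = 2 ^ a + (2 ^ b' :: nat)] (mod 2 ^ Suc d)"
    by (simp only: cong_add_lcancel_nat)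
  moreover have lt: "(2::nat) ^ x + 2 ^ y < 2 ^ Suc d" if "x < d" "y < d" for x y
  proof -
    have "(2::nat) ^ x < 2 ^ d" "(2::nat) ^ y < 2 ^ d" using that by simp_all
    then show ?thesis unfolding power_Suc by linarith
  qed
  ultimately have "(2::nat) ^ b + 2 ^ a' = 2 ^ a + 2 ^ b'"
    using lt[OF ab(2) R(1)] lt[OF ab(1) R(2)] by (simp only: cong_def mod_less)
  then show "R a b" using pow2_sum_eq[of b a' a b'] R irr by auto
qed

lemma binary_ok_shift: "binary_ok d R ((c + t) mod 2 ^ Suc d) ((c' + t) mod 2 ^ Suc d) = binary_ok d R c c'"
proof -
  have "(((c' + t) mod 2 ^ Suc d + 2 ^ a) mod 2 ^ Suc d = ((c + t) mod 2 ^ Suc d + 2 ^ b) mod 2 ^ Suc d) \<longleftrightarrow>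
    (c' + 2 ^ a) mod 2 ^ Suc d = (c + 2 ^ b) mod 2 ^ Suc d" for a b
    using cong_add_rcancel_nat[of "c' + 2 ^ a" t "c + 2 ^ b" "2 ^ Suc d"]
    unfolding cong_def mod_add_left_eq by (simp only: add_ac)
  then show ?thesis unfolding binary_ok_def by (simp only:)
qed

lemma unary_ok_shift: "unary_ok d P ((c + t) mod 2 ^ Suc d) ((c' + t) mod 2 ^ Suc d) = unary_ok d P c c'"
proof -
  have "(((c + t) mod 2 ^ Suc d + 2 ^ a) mod 2 ^ Suc d = ((c' + t) mod 2 ^ Suc d) mod 2 ^ Suc d) \<longleftrightarrow>
    (c + 2 ^ a) mod 2 ^ Suc d = c' mod 2 ^ Suc d" for a
    using cong_add_rcancel_nat[of "c + 2 ^ a" t c' "2 ^ Suc d"]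
    unfolding cong_def mod_mod_trivial mod_add_left_eq by (simp only: add_ac)
  then show ?thesis unfolding unary_ok_def by (simp only:)
qed

lemma var_ok_shift: "var_ok d H V ty W us v ((c + t) mod 2 ^ Suc d) v' ((c' + t) mod 2 ^ Suc d) =
    var_ok d H V ty W us v c v' c'"
  unfolding var_ok_def mark_ok_def unary_ok_shift binary_ok_shift ..

section \<open>Tilings versus decompositions of bounded weight\<close>

locale tile_gram =
  fixes d :: nat and H V ty :: "nat \<Rightarrow> nat \<Rightarrow> bool" and W :: nat and us :: "nat list" and l D :: real
  assumes irr: "\<And>a. a < d \<Longrightarrow> \<not> H a a" "\<And>a. a < d \<Longrightarrow> \<not> V a a" and W: "2 \<le> W"
    and D: "1 + real (Suc (Suc (length us) * 2 ^ Suc d)) * 2 ^ Suc d \<le> D"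
    and l: "real (Suc (Suc (length us) * 2 ^ Suc d)) * D + 2 ^ Suc d \<le> l"
begin

abbreviation "n \<equiv> Suc (Suc (length us) * 2 ^ Suc d)"
abbreviation "ok \<equiv> index_ok d H V ty W us"

lemma ok_sym: "ok i j = ok j i"
  unfolding index_ok_def using W by (rule var_ok_sym)

lemma not_ok_same_var: "(i - 1) div 2 ^ Suc d = (j - 1) div 2 ^ Suc d \<Longrightarrow> \<not> ok i j"
  unfolding index_ok_def var_ok_def by (simp only: if_True simp_thms)

lemma var_le:
  assumes "i \<in> {1..<n}"
  shows "(i - 1) div 2 ^ Suc d \<le> length us"
proof -
  have "i \<noteq> 0" "i < n" using assms by auto
  then have "i - 1 < Suc (length us) * 2 ^ Suc d" by (cases i) (simp_all only: diff_Suc_1 Suc_less_eq not_False_eq_True)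
  then have "(i - 1) div 2 ^ Suc d < Suc (length us)" by (rule less_mult_imp_div_less)
  then show ?thesis unfolding less_Suc_eq_le .
qed

lemma corr_rep_ex: "\<exists>t. corr_rep n t (flag_gram l (2 ^ Suc d) D ok)"
  by (rule corr_rep_flag_gram[OF ok_sym _ D l]) simp

text \<open>The blocks of colours are the groups of the counting argument, so the flagged set picks
  exactly one colour for each variable. The palette constraint puts each cell colour a power of two
  above the palette colour; the exponent is the tile.\<close>

lemma corr_rep_imp_tiling:
  assumes "corr_rep n t (flag_gram l (2 ^ Suc d) D ok)" "t \<le> l"
  shows "\<exists>\<tau>. tiling d H V ty W us \<tau>"
proof -
  define k :: nat where "k = 2 ^ Suc d"
  have k: "1 \<le> k" by (simp add: k_def)
  have n: "n = Suc (Suc (length us) * k)" by (simp only: k_def)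
  have "corr_rep n t (flag_gram l (real k) D ok)" using assms(1) by (simp add: k_def)
  from corr_rep_flag_gram_independent[OF this assms(2) k n not_ok_same_var[folded k_def]]
  obtain C where C: "C \<subseteq> {1..<n}" "card C = Suc (length us)" "\<forall>i\<in>C. \<forall>j\<in>C. i \<noteq> j \<longrightarrow> ok i j"
    by blast
  have inj: "inj_on (\<lambda>i. (i - 1) div k) C"
    using C(3) not_ok_same_var by (intro inj_onI) (metis k_def)
  have "(\<lambda>i. (i - 1) div k) ` C \<subseteq> {..length us}"
    using var_le C(1) by (auto simp: k_def simp del: power_Suc)
  moreover have "card ((\<lambda>i. (i - 1) div k) ` C) = card {..length us}"
    unfolding card_image[OF inj] C(2) by simp
  ultimately have "(\<lambda>i. (i - 1) div k) ` C = {..length us}" by (intro card_subset_eq) auto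
  then have "\<forall>v\<in>{..length us}. \<exists>i\<in>C. v = (i - 1) div k" by blast
  then obtain f where f: "\<And>v. v \<le> length us \<Longrightarrow> f v \<in> C" "\<And>v. v \<le> length us \<Longrightarrow> (f v - 1) div k = v"
    by (metis atMost_iff)
  define c where "c v = (f v - 1) mod k" for v
  have adm: "var_ok d H V ty W us v (c v) v' (c v')" if "v \<le> length us" "v' \<le> length us" "v \<noteq> v'" for v v'
  proof -
    have "ok (f v) (f v')" using that f C(3) by metis
    then show ?thesis using f(2)[OF that(1)] f(2)[OF that(2)] by (simp add: index_ok_def c_def k_def)
  qed
  have "\<forall>v. \<exists>a. v < length us \<longrightarrow> a < d \<and> ty (us ! v) a \<and> c (Suc v) = (c 0 + 2 ^ a) mod k"
  proof
    fix v
    show "\<exists>a. v < length us \<longrightarrow> a < d \<and> ty (us ! v) a \<and> c (Suc v) = (c 0 + 2 ^ a) mod k"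
      using adm[of 0 "Suc v"] by (cases "v < length us") (auto simp: var_ok_def unary_ok_def c_def k_def)
  qed
  then obtain \<tau> where \<tau>: "\<And>v. v < length us \<Longrightarrow> \<tau> v < d \<and> ty (us ! v) (\<tau> v) \<and> c (Suc v) = (c 0 + 2 ^ \<tau> v) mod k"
    by metis
  have "H (\<tau> v) (\<tau> (v + 1))" if "v + 1 < length us" for v
  proof -
    have "binary_ok d H (c (Suc v)) (c (Suc (v + 1)))"
      using adm[of "Suc v" "Suc (v + 1)"] that by (simp add: var_ok_def mark_def mark_ok_def)
    then show ?thesis using \<tau>[of v] \<tau>[of "v + 1"] that irr(1) binary_ok_iff[of d H "\<tau> v" "\<tau> (v + 1)" "c 0"]
      by (simp add: k_def)
  qed
  moreover have "V (\<tau> v) (\<tau> (v + W))" if "v + W < length us" for v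
  proof -
    have "binary_ok d V (c (Suc v)) (c (Suc (v + W)))"
      using adm[of "Suc v" "Suc (v + W)"] that W by (simp add: var_ok_def mark_def mark_ok_def)
    then show ?thesis using \<tau>[of v] \<tau>[of "v + W"] that irr(2) binary_ok_iff[of d V "\<tau> v" "\<tau> (v + W)" "c 0"]
      by (simp add: k_def)
  qed
  ultimately have "tiling d H V ty W us \<tau>" using \<tau> unfolding tiling_def by blast
  then show ?thesis by blast
qed

lemma tiling_imp_corr_rep:
  assumes "tiling d H V ty W us \<tau>"
  shows "corr_rep n l (flag_gram l (2 ^ Suc d) D ok)"
proof -
  define k :: nat where "k = 2 ^ Suc d"
  \<comment> \<open>The base solution, with palette colour 0; its \<open>k\<close> shifts will be
    the colour classes.\<close>
  define c where "c v = (case v of 0 \<Rightarrow> 0 | Suc v \<Rightarrow> 2 ^ \<tau> v mod k)" for v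
  have ck: "c v < k" for v by (cases v) (auto simp: c_def k_def)
  have \<tau>: "\<tau> v < d" "ty (us ! v) (\<tau> v)" if "v < length us" for v
    using assms that by (auto simp: tiling_def)
  \<comment> \<open>By symmetry increasing pairs suffice, and these meet only the marks 0, 2 and
    4.\<close>
  have adm_less: "var_ok d H V ty W us v (c v) v' (c v')" if vv: "v < v'" "v' \<le> length us" for v v'
  proof -
    from vv obtain w' where w': "v' = Suc w'" "w' < length us" by (cases v') auto
    show ?thesis
    proof (cases v)
      case 0
      have "(c 0 + 2 ^ \<tau> w') mod 2 ^ Suc d = c v' mod 2 ^ Suc d"
        unfolding w' by (simp only: c_def k_def nat.case add_0 mod_mod_trivial)
      then show ?thesis using \<tau>[OF w'(2)] w'(1) 0 unfolding var_ok_def unary_ok_def by auto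
    next
      case (Suc w)
      have w: "w < length us" "w < w'" using Suc vv w' by auto
      have mk: "mark W (int v' - int v) \<in> {0, 2, 4}"
        "mark W (int v' - int v) = 2 \<Longrightarrow> w' = w + 1"
        "mark W (int v' - int v) = 4 \<Longrightarrow> w' = w + W"
        using W w w' Suc by (auto simp: mark_def split: if_splits)
      have col: "c v = (0 + 2 ^ \<tau> w) mod 2 ^ Suc d" "c v' = (0 + 2 ^ \<tau> w') mod 2 ^ Suc d"
        unfolding Suc w' by (simp_all only: c_def k_def nat.case add_0)
      have H: "binary_ok d H (c v) (c v')" if "w' = w + 1"
      proof -
        have "H (\<tau> w) (\<tau> w')" using assms that w'(2) unfolding tiling_def by blast
        then show ?thesis unfolding col using binary_ok_iff[of d H, OF irr(1) \<tau>(1)[OF w(1)] \<tau>(1)[OF w'(2)]] by blast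
      qed
      have V: "binary_ok d V (c v) (c v')" if "w' = w + W"
      proof -
        have "V (\<tau> w) (\<tau> w')" using assms that w'(2) unfolding tiling_def by blast
        then show ?thesis unfolding col using binary_ok_iff[of d V, OF irr(2) \<tau>(1)[OF w(1)] \<tau>(1)[OF w'(2)]] by blast
      qed
      have "mark_ok d H V (mark W (int v' - int v)) (c v) (c v')"
        using mk H V unfolding mark_ok_def by fastforce
      then show ?thesis using vv Suc w'(1) unfolding var_ok_def by simp
    qed
  qed
  have adm: "var_ok d H V ty W us v (c v) v' (c v')" if "v \<noteq> v'" "v \<le> length us" "v' \<le> length us" for v v'
  proof (cases "v < v'")
    case True
    then show ?thesis using adm_less that by blast
  next
    case False
    then have "v' < v" using that by simp
    then show ?thesis unfolding var_ok_sym[OF W, of d H V ty us v "c v"] using adm_less that by blast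
  qed
  \<comment> \<open>The shift that takes the base solution to the colour of index \<open>i\<close>:
    equal \<open>t\<close> means membership in the same shifted solution. The summand
    \<open>k - c\<close> stands for subtraction modulo \<open>k\<close>.\<close>
  define t where "t i = ((i - 1) mod k + (k - c ((i - 1) div k))) mod k" for i
  have t: "(i - 1) mod k = (c ((i - 1) div k) + t i) mod k" for i
  proof -
    have "(c ((i - 1) div k) + t i) mod k = ((i - 1) mod k + (c ((i - 1) div k) + (k - c ((i - 1) div k)))) mod k"
      unfolding t_def mod_add_right_eq mod_add_left_eq by (simp only: add_ac)
    then show ?thesis using ck[of "(i - 1) div k"] by simp
  qed
  have "corr_rep n l (flag_gram l (real k) D ok)"
  proof (rule corr_rep_flag_gram_colouring[OF ok_sym])
    show "t i < k" for i by (simp add: t_def k_def)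
    show "2 \<le> k" by (simp add: k_def)
    fix i j assume ij: "i \<in> {1..<n}" "j \<in> {1..<n}" "i \<noteq> j" "t i = t j"
    have le: "(i - 1) div k \<le> length us" if "i \<in> {1..<n}" for i
      using var_le[OF that] by (simp only: k_def)
    have ne: "(i - 1) div k \<noteq> (j - 1) div k"
    proof
      assume eq: "(i - 1) div k = (j - 1) div k"
      then have "(i - 1) mod k = (j - 1) mod k" using t[of i] t[of j] ij(4) by simp
      then have "i - 1 = j - 1" using eq by (metis div_mult_mod_eq)
      then show False using ij by auto
    qed
    show "ok i j"
      using adm[OF ne le[OF ij(1)] le[OF ij(2)]]
      unfolding index_ok_def k_def[symmetric] t[of i] t[of j] ij(4) unfolding k_def var_ok_shift .
  qed (use D l in \<open>simp_all add: k_def\<close>)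
  then show ?thesis by (simp add: k_def)
qed

end

section \<open>A structured language for Turing machines\<close>

text \<open>Tests and written symbols are arbitrary functions of the scanned symbols. They become
  entries of the transition table, so finite tables such as the tile relations cost no time.\<close>

datatype cmd =
    Act nat "(nat \<Rightarrow> nat) \<Rightarrow> nat" dir
  | Seq cmd cmd
  | While "(nat \<Rightarrow> nat) \<Rightarrow> bool" cmd

definition scans :: "nat \<Rightarrow> (nat \<Rightarrow> tape) \<Rightarrow> nat \<Rightarrow> nat" where
  "scans K s = (\<lambda>j. if j < K then scan (s j) else 0)"

inductive exec :: "nat \<Rightarrow> cmd \<Rightarrow> (nat \<Rightarrow> tape) \<Rightarrow> nat \<Rightarrow> (nat \<Rightarrow> tape) \<Rightarrow> bool" for K where
  exec_Act: "exec K (Act i g d) s 1 (s(i := act (g (scans K s), d) (s i)))"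
| exec_Seq: "exec K c1 s t1 s1 \<Longrightarrow> exec K c2 s1 t2 s2 \<Longrightarrow> exec K (Seq c1 c2) s (t1 + t2) s2"
| exec_While_False: "\<not> b (scans K s) \<Longrightarrow> exec K (While b c) s 1 s"
| exec_While_True: "b (scans K s) \<Longrightarrow> exec K c s t1 s1 \<Longrightarrow> exec K (While b c) s1 t2 s2
    \<Longrightarrow> exec K (While b c) s (1 + t1 + t2) s2"

fun cmd_size :: "cmd \<Rightarrow> nat" where
  "cmd_size (Act i g d) = 1"
| "cmd_size (Seq c1 c2) = cmd_size c1 + cmd_size c2"
| "cmd_size (While b c) = 1 + cmd_size c"

text \<open>\<open>cmd_trans c s e\<close> is the transition function of \<open>c\<close> with its states placed at
  \<open>s, s + 1, \<dots>\<close>, and with exit state \<open>e\<close>.\<close>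

fun cmd_trans :: "cmd \<Rightarrow> nat \<Rightarrow> nat \<Rightarrow> nat \<Rightarrow> (nat \<Rightarrow> nat) \<Rightarrow> nat \<times> (nat \<Rightarrow> nat \<times> dir)" where
  "cmd_trans (Act i g d) s e q f = (e, (\<lambda>j. (f j, Stay))(i := (g f, d)))"
| "cmd_trans (Seq c1 c2) s e q f =
     (if q < s + cmd_size c1 then cmd_trans c1 s (s + cmd_size c1) q f
      else cmd_trans c2 (s + cmd_size c1) e q f)"
| "cmd_trans (While b c) s e q f =
     (if q = s then (if b f then s + 1 else e, \<lambda>j. (f j, Stay)) else cmd_trans c (s + 1) s q f)"

definition cmd_tm :: "nat \<Rightarrow> nat \<Rightarrow> cmd \<Rightarrow> tm" where
  "cmd_tm K G c = \<lparr>tm_tapes = K, tm_symbols = G, tm_states = cmd_size c,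
     tm_trans = \<lambda>q ss. (case cmd_trans c 0 (cmd_size c) q (\<lambda>j. if j < K then ss ! j else 0) of
        (q', a) \<Rightarrow> (q', map a [0..<K]))\<rparr>"

lemma cmd_size_pos: "0 < cmd_size c"
  by (induction c) auto

lemma act_keep [simp]: "act (scan t, Stay) t = t"
  by (cases t) auto

lemma map_nth_scan: "(\<lambda>j. if j < K then map scan (map s [0..<K]) ! j else 0) = scans K s"
  by (auto simp: scans_def)

lemma map2_act_keep: "map2 act (map (\<lambda>j. (scans K s j, Stay)) [0..<K]) (map s [0..<K]) = map s [0..<K]"
  by (rule nth_equalityI) (auto simp: scans_def)

lemma map2_act_upd:
  "map2 act (map ((\<lambda>j. (scans K s j, Stay))(i := a)) [0..<K]) (map s [0..<K]) =
    map (s(i := act a (s i))) [0..<K]"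
  by (rule nth_equalityI) (auto simp: scans_def)

text \<open>Only the states that belong to \<open>c\<close> are constrained, so a part of a program
  can be treated inside the machine of the whole. The exit \<open>e\<close> is a parameter because
  the body of a loop exits to its test.\<close>

definition implements :: "tm \<Rightarrow> nat \<Rightarrow> cmd \<Rightarrow> nat \<Rightarrow> nat \<Rightarrow> bool" where
  "implements M K c o' e \<longleftrightarrow> o' + cmd_size c \<le> tm_states M \<and>
     (\<forall>q s. o' \<le> q \<longrightarrow> q < o' + cmd_size c \<longrightarrow>
       tm_step M (q, map s [0..<K]) = (case cmd_trans c o' e q (scans K s) of
        (q', a) \<Rightarrow> (q', map2 act (map a [0..<K]) (map s [0..<K]))))"

lemma implementsD:
  assumes "implements M K c p e" "p \<le> q" "q < p + cmd_size c" "cmd_trans c p e q (scans K s) = (q', a)"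
  shows "tm_step M (q, map s [0..<K]) = (q', map2 act (map a [0..<K]) (map s [0..<K]))"
  using assms unfolding implements_def by (auto simp del: tm_step.simps)

lemma implements_Seq:
  assumes "implements M K (Seq c1 c2) p e"
  shows "implements M K c1 p (p + cmd_size c1)" "implements M K c2 (p + cmd_size c1) e"
  using assms unfolding implements_def by auto

lemma implements_While:
  assumes "implements M K (While b c) p e"
  shows "implements M K c (Suc p) p"
  using assms unfolding implements_def by auto

lemma exec_implements:
  assumes "exec K c s t s'" "implements M K c p e"
  shows "(tm_step M ^^ t) (p, map s [0..<K]) = (e, map s' [0..<K])"
  using assms
proof (induction arbitrary: p e rule: exec.induct)
  case (exec_Act i g d s)
  have "tm_step M (p, map s [0..<K]) =
      (e, map2 act (map ((\<lambda>j. (scans K s j, Stay))(i := (g (scans K s), d))) [0..<K]) (map s [0..<K]))"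
    by (rule implementsD[OF exec_Act]) auto
  then show ?case unfolding map2_act_upd by (simp del: tm_step.simps)
next
  case (exec_Seq c1 s t1 s1 c2 t2 s2)
  show ?case
    using exec_Seq.IH(1)[OF implements_Seq(1)[OF exec_Seq.prems]]
      exec_Seq.IH(2)[OF implements_Seq(2)[OF exec_Seq.prems]]
    by (simp add: funpow_add add.commute[of t1] del: funpow.simps)
next
  case (exec_While_False b s c)
  have "tm_step M (p, map s [0..<K]) =
      (e, map2 act (map (\<lambda>j. (scans K s j, Stay)) [0..<K]) (map s [0..<K]))"
    by (rule implementsD[OF exec_While_False.prems]) (use exec_While_False.hyps in auto)
  then show ?case unfolding map2_act_keep by (simp del: tm_step.simps)
next
  case (exec_While_True b s c t1 s1 t2 s2)
  have 1: "(tm_step M ^^ 1) (p, map s [0..<K]) = (Suc p, map s [0..<K])"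
  proof -
    have "tm_step M (p, map s [0..<K]) =
        (Suc p, map2 act (map (\<lambda>j. (scans K s j, Stay)) [0..<K]) (map s [0..<K]))"
      by (rule implementsD[OF exec_While_True.prems]) (use exec_While_True.hyps(1) in auto)
    then show ?thesis unfolding map2_act_keep by (simp del: tm_step.simps)
  qed
  have "(tm_step M ^^ (t2 + (t1 + 1))) (p, map s [0..<K]) = (e, map s2 [0..<K])"
    unfolding funpow_add o_apply 1
    using exec_While_True.IH(1)[OF implements_While[OF exec_While_True.prems]]
      exec_While_True.IH(2)[OF exec_While_True.prems] by simp
  then show ?case by (simp add: algebra_simps)
qed

lemma implements_cmd_tm: "implements (cmd_tm K G c) K c 0 (cmd_size c)"
  unfolding implements_def
proof (intro conjI allI impI)
  fix q :: nat and s :: "nat \<Rightarrow> tape"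
  assume "q < 0 + cmd_size c"
  moreover obtain q' a where "cmd_trans c 0 (cmd_size c) q (scans K s) = (q', a)" by fastforce
  ultimately show "tm_step (cmd_tm K G c) (q, map s [0..<K]) = (case cmd_trans c 0 (cmd_size c) q (scans K s) of
        (q', a) \<Rightarrow> (q', map2 act (map a [0..<K]) (map s [0..<K])))"
    by (simp add: cmd_tm_def map_nth_scan del: map_map)
qed (simp add: cmd_tm_def)

section \<open>Well-formed machines and running times\<close>

fun cmd_wf :: "nat \<Rightarrow> cmd \<Rightarrow> bool" where
  "cmd_wf G (Act i g d) \<longleftrightarrow> (\<forall>f. (\<forall>j. f j < G) \<longrightarrow> g f < G)"
| "cmd_wf G (Seq c1 c2) \<longleftrightarrow> cmd_wf G c1 \<and> cmd_wf G c2"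
| "cmd_wf G (While b c) \<longleftrightarrow> cmd_wf G c"

lemma cmd_trans_wf:
  assumes "cmd_wf G c" "\<And>j. f j < G" "p \<le> q" "q < p + cmd_size c" "p + cmd_size c \<le> m" "e \<le> m"
    "cmd_trans c p e q f = (q', a)"
  shows "q' \<le> m \<and> (\<forall>j. fst (a j) < G)"
  using assms
proof (induction c arbitrary: p e)
  case (Seq c1 c2)
  show ?case
  proof (cases "q < p + cmd_size c1")
    case True
    then show ?thesis using Seq.IH(1)[of p "p + cmd_size c1"] Seq.prems by auto
  next
    case False
    then show ?thesis using Seq.IH(2)[of "p + cmd_size c1" e] Seq.prems by auto
  qed
next
  case (While b c)
  show ?case
  proof (cases "q = p")
    case False
    then show ?thesis using While.IH[of "p + 1" p] While.prems by auto
  qed (use While.prems in \<open>auto split: if_splits\<close>)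
qed auto

lemma wf_cmd_tm:
  assumes "cmd_wf G c" "2 \<le> K" "3 \<le> G"
  shows "wf_tm (cmd_tm K G c)"
  unfolding wf_tm_def
proof (intro conjI allI impI)
  fix q ss
  assume q: "q < tm_states (cmd_tm K G c)"
    and ss: "length ss = tm_tapes (cmd_tm K G c) \<and> (\<forall>s\<in>set ss. s < tm_symbols (cmd_tm K G c))"
  obtain q' a where tr: "cmd_trans c 0 (cmd_size c) q (\<lambda>j. if j < K then ss ! j else 0) = (q', a)"
    by fastforce
  have "q' \<le> cmd_size c \<and> (\<forall>j. fst (a j) < G)"
    by (rule cmd_trans_wf[OF assms(1) _ _ _ _ _ tr]) (use q ss assms in \<open>auto simp: cmd_tm_def\<close>)
  then show "case tm_trans (cmd_tm K G c) q ss of (q', as) \<Rightarrow> q' \<le> tm_states (cmd_tm K G c) \<and>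
      length as = tm_tapes (cmd_tm K G c) \<and> (\<forall>(s, d)\<in>set as. s < tm_symbols (cmd_tm K G c))"
    using tr by (auto simp: cmd_tm_def) (metis fst_conv)
qed (use assms cmd_size_pos[of c] in \<open>auto simp: cmd_tm_def Suc_le_eq\<close>)

lemma tm_step_halted: "(tm_step M ^^ t) (tm_states M, ts) = (tm_states M, ts)"
  by (induction t) auto

lemma tm_steps_halted_mono:
  assumes "(tm_step M ^^ t) c = (tm_states M, ts)" "t \<le> t'"
  shows "(tm_step M ^^ t') c = (tm_states M, ts)"
proof -
  have "(tm_step M ^^ (t' - t + t)) c = (tm_states M, ts)"
    unfolding funpow_add o_apply assms(1) by (rule tm_step_halted)
  then show ?thesis using assms(2) by simp
qed

definition init_state :: "bool list \<Rightarrow> nat \<Rightarrow> tape" where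
  "init_state x = (\<lambda>_. (\<lambda>_. 0, 0))(0 := input_tape x)"

text \<open>A halted machine stays as it is, so the exact time of a run can be padded to the
  polynomial.\<close>

lemma polytime_computable_cmd:
  assumes "cmd_wf G c" "2 \<le> K" "3 \<le> G"
    and "\<And>x. \<exists>t s. t \<le> poly T (length x) \<and> exec K c (init_state x) t s \<and> tape_output (s 1) (f x)"
  shows "polytime_computable f"
  unfolding polytime_computable_def
proof (intro exI conjI allI)
  show "wf_tm (cmd_tm K G c)" using assms(1-3) by (rule wf_cmd_tm)
  fix x
  obtain t s where *: "t \<le> poly T (length x)" "exec K c (init_state x) t s" "tape_output (s 1) (f x)"
    using assms(4) by blast
  have K: "[0..<K] = 0 # [1..<K]" using assms(2) by (simp add: upt_conv_Cons)
  have init: "tm_init (cmd_tm K G c) x = (0, map (init_state x) [0..<K])"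
    unfolding K by (simp add: tm_init_def cmd_tm_def init_state_def map_replicate_const)
  have "(tm_step (cmd_tm K G c) ^^ t) (0, map (init_state x) [0..<K]) = (cmd_size c, map s [0..<K])"
    by (rule exec_implements[OF *(2) implements_cmd_tm])
  then have "(tm_step (cmd_tm K G c) ^^ t) (tm_init (cmd_tm K G c) x)
      = (tm_states (cmd_tm K G c), map s [0..<K])"
    unfolding init by (simp only: cmd_tm_def tm.simps)
  then have "(tm_step (cmd_tm K G c) ^^ poly T (length x)) (tm_init (cmd_tm K G c) x)
      = (tm_states (cmd_tm K G c), map s [0..<K])"
    by (rule tm_steps_halted_mono[OF _ *(1)])
  moreover have "map s [0..<K] ! 1 = s 1" using assms(2) by simp
  ultimately show "tm_computes_within (cmd_tm K G c) (poly T (length x)) x (f x)"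
    unfolding tm_computes_within_def using *(3) by metis
qed

section \<open>Computations as tilings\<close>

text \<open>\<open>Cell b g e q ss sy po\<close>: parity \<open>b\<close> of the cell index; \<open>g\<close> tells tape positions \<open>< 0\<close>, \<open>0\<close>, \<open>1\<close>,
  \<open>\<ge> 2\<close> apart; \<open>e\<close> holds from the end of the input on; \<open>q\<close> is the state and \<open>ss\<close> the scanned symbols of the
  whole configuration; \<open>sy\<close> are the symbols in the cell; \<open>po\<close> is \<open>0\<close>, \<open>1\<close>, \<open>2\<close> for a cell before, at, after the head.
  Each row of the tableau starts with a \<open>Wall\<close>.\<close>

datatype tile = Wall bool | Cell bool nat bool nat "nat list" "nat list" "nat list"

fun tile_ok :: "tm \<Rightarrow> tile \<Rightarrow> bool" where
  "tile_ok M (Wall b) \<longleftrightarrow> True"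
| "tile_ok M (Cell b g e q ss sy po) \<longleftrightarrow> g \<le> 3 \<and> q \<le> tm_states M \<and>
     length ss = tm_tapes M \<and> length sy = tm_tapes M \<and> length po = tm_tapes M \<and>
     (\<forall>i<tm_tapes M. ss ! i < tm_symbols M \<and> sy ! i < tm_symbols M \<and> po ! i \<le> 2 \<and> (po ! i = 1 \<longrightarrow> sy ! i = ss ! i))"

definition pos_next :: "nat \<Rightarrow> nat \<Rightarrow> bool" where
  "pos_next a b \<longleftrightarrow> (a, b) \<in> {(0, 0), (0, 1), (1, 2), (2, 2)}"

text \<open>A single cell's view of a head move: its code before and the codes allowed after. Two
  options remain where the cell cannot see whether the head arrives; \<open>pos_next\<close> within
  the new row decides.\<close>

fun pos_step :: "dir \<Rightarrow> nat \<Rightarrow> nat \<Rightarrow> bool" where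
  "pos_step Stay a b \<longleftrightarrow> a = b"
| "pos_step Go_Right a b \<longleftrightarrow> (a, b) \<in> {(0, 0), (1, 0), (2, 1), (2, 2)}"
| "pos_step Go_Left a b \<longleftrightarrow> (a, b) \<in> {(2, 2), (1, 2), (0, 0), (0, 1)}"

text \<open>State and scanned symbols are copied along the row, so every cell knows the transition
  to apply without seeing the heads. The alternating bit serves irreflexivity; between a wall and a
  cell it is the only condition.\<close>

fun hrel :: "tm \<Rightarrow> tile \<Rightarrow> tile \<Rightarrow> bool" where
  "hrel M (Wall b) (Wall b') \<longleftrightarrow> False"
| "hrel M (Wall b) (Cell b' g e q ss sy po) \<longleftrightarrow> b \<noteq> b'"
| "hrel M (Cell b g e q ss sy po) (Wall b') \<longleftrightarrow> b \<noteq> b'"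
| "hrel M (Cell b g e q ss sy po) (Cell b' g' e' q' ss' sy' po') \<longleftrightarrow> b \<noteq> b' \<and> q = q' \<and> ss = ss' \<and>
     (g, g') \<in> {(0, 0), (0, 1), (1, 2), (2, 3), (3, 3)} \<and> (e \<longrightarrow> e') \<and> (\<forall>i<tm_tapes M. pos_next (po ! i) (po' ! i))"

fun vrel :: "tm \<Rightarrow> tile \<Rightarrow> tile \<Rightarrow> bool" where
  "vrel M (Wall b) (Wall b') \<longleftrightarrow> b \<noteq> b'"
| "vrel M (Wall b) (Cell b' g e q ss sy po) \<longleftrightarrow> False"
| "vrel M (Cell b g e q ss sy po) (Wall b') \<longleftrightarrow> False"
| "vrel M (Cell b g e q ss sy po) (Cell b' g' e' q' ss' sy' po') \<longleftrightarrow> b \<noteq> b' \<and> g = g' \<and> e = e' \<and>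
     (if q = tm_states M then q' = q \<and> sy' = sy \<and> po' = po
      else (case tm_trans M q ss of (q1, as) \<Rightarrow> q' = q1 \<and>
        (\<forall>i<tm_tapes M. sy' ! i = (if po ! i = 1 then fst (as ! i) else sy ! i) \<and> pos_step (snd (as ! i)) (po ! i) (po' ! i))))"

text \<open>Types: 1 the wall of the first row; 2 blanks left of the origin; 3 and 4 fixed input
  bits; 5 a certificate symbol or a blank behind it; 6 blanks on the right; 7 later rows without
  prescription; 8 the last row, halted and with output \<open>[True]\<close> in the cells 0 and
  1.\<close>

fun tile_type :: "tm \<Rightarrow> nat \<Rightarrow> tile \<Rightarrow> bool" where
  "tile_type M u (Wall b) \<longleftrightarrow> u \<in> {1, 7, 8}"
| "tile_type M u (Cell b g e q ss sy po) \<longleftrightarrow> (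
     if u = 2 then g = 0 \<and> q = 0 \<and> (\<forall>i<tm_tapes M. sy ! i = 0 \<and> po ! i = 0)
     else if u \<in> {3, 4, 5, 6} then g \<noteq> 0 \<and> q = 0 \<and> (\<forall>i<tm_tapes M. po ! i \<noteq> 0 \<and> (i \<noteq> 0 \<longrightarrow> sy ! i = 0)) \<and>
       (if u = 3 then \<not> e \<and> sy ! 0 = 1 else if u = 4 then \<not> e \<and> sy ! 0 = 2
        else if u = 5 then sy ! 0 \<le> 2 \<and> (e \<longleftrightarrow> sy ! 0 = 0) else e \<and> sy ! 0 = 0)
     else if u = 7 then True
     else if u = 8 then q = tm_states M \<and> (g = 1 \<longrightarrow> sy ! 1 = 2) \<and> (g = 2 \<longrightarrow> sy ! 1 = 0)
     else False)"

lemma finite_tiles: "finite {t. tile_ok M t}"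
proof -
  let ?L = "\<lambda>m. {xs. set xs \<subseteq> {..m} \<and> length xs = tm_tapes M}"
  have "{t. tile_ok M t} \<subseteq> range Wall \<union> (\<lambda>(b, g, e, q, ss, sy, po). Cell b g e q ss sy po) `
      (UNIV \<times> {..3} \<times> UNIV \<times> {..tm_states M} \<times> ?L (tm_symbols M) \<times> ?L (tm_symbols M) \<times> ?L 2)"
  proof
    fix t assume "t \<in> {t. tile_ok M t}"
    then show "t \<in> range Wall \<union> (\<lambda>(b, g, e, q, ss, sy, po). Cell b g e q ss sy po) `
      (UNIV \<times> {..3} \<times> UNIV \<times> {..tm_states M} \<times> ?L (tm_symbols M) \<times> ?L (tm_symbols M) \<times> ?L 2)"
      by (cases t) (force simp: image_iff in_set_conv_nth less_imp_le)+
  qed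
  then show ?thesis
    by (rule finite_subset) (intro finite_UnI finite_imageI finite_cartesian_product finite_lists_length_eq; simp)
qed

text \<open>The parity bit differs in every related pair; the encoding by colour differences depends
  on this.\<close>

lemma hrel_irrefl: "\<not> hrel M t t" and vrel_irrefl: "\<not> vrel M t t"
  by (cases t; simp)+

definition pos_code :: "int \<Rightarrow> int \<Rightarrow> nat" where
  "pos_code z h = (if z < h then 0 else if z = h then 1 else 2)"

text \<open>One neighbour settles each new code: the left one if the head moves right, the right one
  if it moves left. At the border, where this neighbour is missing, the old head position inside the
  window leaves only one option.\<close>

lemma pos_code_step:
  assumes new: "\<And>p. lo \<le> p \<Longrightarrow> p \<le> hi \<Longrightarrow> pos_step d (pos_code p h) (b p)"
    and nxt: "\<And>p. lo \<le> p \<Longrightarrow> p < hi \<Longrightarrow> pos_next (b p) (b (p + 1))"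
    and win: "lo \<le> h" "h \<le> hi" "lo \<le> h + dir_offset d" "h + dir_offset d \<le> hi"
    and p: "lo \<le> p" "p \<le> hi"
  shows "b p = pos_code p (h + dir_offset d)"
proof (cases d)
  case Go_Left
  show ?thesis
    using new[OF p] new[of "p + 1"] nxt[of p] p win Go_Left
    by (cases "p + 1 = h") (auto simp: pos_code_def pos_next_def split: if_splits)
next
  case Stay
  then show ?thesis using new[OF p] by simp
next
  case Go_Right
  show ?thesis
    using new[OF p] new[of "p - 1"] nxt[of "p - 1"] p win Go_Right
    by (cases "p = h + 1") (auto simp: pos_code_def pos_next_def split: if_splits)
qed

section \<open>Configurations of a run\<close>

definition conf :: "tm \<Rightarrow> bool list \<Rightarrow> nat \<Rightarrow> nat \<times> tape list" where
  "conf M z t = (tm_step M ^^ t) (tm_init M z)"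

definition conf_ok :: "tm \<Rightarrow> nat \<Rightarrow> nat \<times> tape list \<Rightarrow> bool" where
  "conf_ok M t c \<longleftrightarrow> fst c \<le> tm_states M \<and> length (snd c) = tm_tapes M \<and>
     (\<forall>i<tm_tapes M. (\<forall>z. fst (snd c ! i) z < tm_symbols M) \<and> \<bar>snd (snd c ! i)\<bar> \<le> int t)"

lemma scan_conv: "scan t = fst t (snd t)"
  by (cases t) simp

lemma act_conv: "act a t = ((fst t)(snd t := fst a), snd t + dir_offset (snd a))"
  by (cases a; cases t) simp

lemma trans_wf:
  assumes "wf_tm M" "conf_ok M t (q, ts)" "q \<noteq> tm_states M" "tm_trans M q (map scan ts) = (q', as)"
  shows "q' \<le> tm_states M" "length as = tm_tapes M" "i < tm_tapes M \<Longrightarrow> fst (as ! i) < tm_symbols M"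
proof -
  have "\<forall>t \<in> set ts. scan t < tm_symbols M"
    using assms(2) unfolding conf_ok_def scan_conv by (metis in_set_conv_nth snd_conv)
  then have "\<forall>s \<in> set (map scan ts). s < tm_symbols M" "length (map scan ts) = tm_tapes M" "q < tm_states M"
    using assms(2,3) by (auto simp: conf_ok_def)
  then have *: "q' \<le> tm_states M \<and> length as = tm_tapes M \<and> (\<forall>(s, d) \<in> set as. s < tm_symbols M)"
    using assms(1,4) unfolding wf_tm_def by fastforce
  then show "q' \<le> tm_states M" "length as = tm_tapes M" by auto
  assume "i < tm_tapes M"
  then have "as ! i \<in> set as" using * by simp
  then show "fst (as ! i) < tm_symbols M" using * by (auto simp: case_prod_unfold)
qed

lemma conf_ok_step:
  assumes "wf_tm M" "conf_ok M t c"
  shows "conf_ok M (Suc t) (tm_step M c)"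
proof (cases c)
  case (Pair q ts)
  show ?thesis
  proof (cases "q = tm_states M")
    case True
    then show ?thesis using assms(2) Pair by (auto simp: conf_ok_def)
  next
    case False
    obtain q' as where tr: "tm_trans M q (map scan ts) = (q', as)" by fastforce
    note wf = trans_wf[OF assms(1) assms(2)[unfolded Pair] False tr]
    have off: "\<bar>dir_offset d\<bar> \<le> 1" for d by (cases d) auto
    have "\<bar>snd (ts ! i) + dir_offset (snd (as ! i))\<bar> \<le> 1 + int t" if "i < tm_tapes M" for i
    proof -
      have "\<bar>snd (ts ! i)\<bar> \<le> int t" using assms(2) that Pair by (auto simp: conf_ok_def)
      then show ?thesis using off[of "snd (as ! i)"] by linarith
    qed
    then show ?thesis using False tr wf assms(2) Pair
      by (auto simp: conf_ok_def act_conv)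
  qed
qed

lemma conf_ok_conf:
  assumes "wf_tm M"
  shows "conf_ok M t (conf M z t)"
proof (induction t)
  case 0
  have "2 \<le> tm_tapes M" "3 \<le> tm_symbols M" using assms by (auto simp: wf_tm_def)
  then show ?case
    by (auto simp: conf_ok_def conf_def tm_init_def nth_Cons input_tape_def bit_symbol_def split: nat.splits)
next
  case (Suc t)
  then show ?case using conf_ok_step[OF assms, of t "conf M z t"] by (simp add: conf_def)
qed

lemma conf_Suc:
  assumes "conf M z t = (q, ts)" "q \<noteq> tm_states M" "tm_trans M q (map scan ts) = (q', as)"
  shows "conf M z (Suc t) = (q', map2 act as ts)"
  using assms by (simp add: conf_def)

lemma conf_Suc_halted:
  assumes "conf M z t = (tm_states M, ts)"
  shows "conf M z (Suc t) = (tm_states M, ts)"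
  using assms by (simp add: conf_def)

text \<open>A wall, \<open>B + 1\<close> cells left of the origin, the encoded input, room for a
  certificate, and blanks. Tape position \<open>z\<close> is column \<open>z + B + 2\<close>, and
  the heads stay in the window for \<open>B + 1\<close> steps. The summand \<open>q\<close> in the
  last block makes the length odd, so that vertical neighbours have different parity.\<close>

definition columns :: "nat \<Rightarrow> nat \<Rightarrow> bool list \<Rightarrow> nat list" where
  "columns B q x = 1 # replicate (Suc B) 2 @ map (\<lambda>b. if b then 4 else 3) (enc_bits x) @ replicate q 5 @ replicate (B + q + 2) 6"

text \<open>Rows for the times 0 to \<open>B + 1\<close>: the run has halted by time
  \<open>B\<close>, and one further row carries the check of the output.\<close>

definition cells :: "nat \<Rightarrow> nat \<Rightarrow> bool list \<Rightarrow> nat list" where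
  "cells B q x = columns B q x @ replicate (B * length (columns B q x)) 7 @ replicate (length (columns B q x)) 8"

lemma length_enc_bits: "length (enc_bits x) = 2 * length x + 1"
  by (induction x) (auto simp: enc_bits_def)

lemma length_columns: "length (columns B q x) = 2 * B + 2 * length x + 2 * q + 5"
  by (simp add: columns_def length_enc_bits)

definition pos_class :: "int \<Rightarrow> nat" where
  "pos_class p = (if p < 0 then 0 else if p = 0 then 1 else if p = 1 then 2 else 3)"

lemma columns_nth:
  assumes "p < length (columns B q x)"
  shows "columns B q x ! p = (if p = 0 then 1 else if p < B + 2 then 2
     else if p < B + 2 + length (enc_bits x) then (if enc_bits x ! (p - (B + 2)) then 4 else 3)
     else if p < B + 2 + length (enc_bits x) + q then 5 else 6)"
proof (cases p)
  case (Suc r)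
  have *: "(replicate a 2 @ map (\<lambda>b. if b then 4 else 3) ys @ replicate q 5 @ replicate m 6) ! r =
      (if r < a then 2 else if r < a + length ys then (if ys ! (r - a) then 4 else 3)
       else if r < a + length ys + q then 5 else (6::nat))"
    if "r < a + length ys + q + m" for a m and ys :: "bool list"
    using that by (auto simp: nth_append)
  have "r < Suc B + length (enc_bits x) + q + (B + q + 2)"
    using assms Suc by (simp add: columns_def)
  from *[OF this] show ?thesis unfolding columns_def Suc nth_Cons_Suc by simp
qed (simp add: columns_def)

lemma length_cells: "length (cells B q x) = (B + 2) * length (columns B q x)"
  by (simp add: cells_def)

lemma cells_nth:
  assumes "t < B + 2" "p < length (columns B q x)"
  shows "cells B q x ! (t * length (columns B q x) + p) =
     (if t = 0 then columns B q x ! p else if t < B + 1 then 7 else 8)"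
proof -
  define W where "W = length (columns B q x)"
  have p: "p < W" using assms(2) by (simp add: W_def)
  have "t * W + p < W + B * W" if "t < B + 1"
  proof -
    have "t * W \<le> B * W" using that by (intro mult_le_mono1) simp
    then show ?thesis using p by linarith
  qed
  moreover have "W \<le> t * W + p" if "t \<noteq> 0" using that by (cases t) auto
  moreover have "W + B * W \<le> t * W + p" "t * W + p - (W + B * W) < W" if "\<not> t < B + 1"
  proof -
    have t: "t = B + 1" using that assms(1) by simp
    show "W + B * W \<le> t * W + p" "t * W + p - (W + B * W) < W" using p unfolding t by simp_all
  qed
  ultimately show ?thesis using assms
    by (cases "t = 0"; cases "t < B + 1") (auto simp: cells_def nth_append W_def[symmetric])
qed

definition cell_at :: "tm \<Rightarrow> bool list \<Rightarrow> nat \<Rightarrow> bool \<Rightarrow> bool \<Rightarrow> nat \<Rightarrow> int \<Rightarrow> tile" where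
  "cell_at M z t b e g r = Cell b g e (fst (conf M z t)) (map scan (snd (conf M z t)))
     (map (\<lambda>t. fst t r) (snd (conf M z t))) (map (\<lambda>t. pos_code r (snd t)) (snd (conf M z t)))"

text \<open>The parity is that of the running cell number, so it alternates through the whole list,
  walls included.\<close>

definition tile_at :: "tm \<Rightarrow> bool list \<Rightarrow> nat \<Rightarrow> nat \<Rightarrow> nat \<Rightarrow> nat \<Rightarrow> tile" where
  "tile_at M z B W t p = (if p = 0 then Wall (odd (t * W + p)) else
     cell_at M z t (odd (t * W + p)) (int (length z) \<le> int p - int (B + 2)) (pos_class (int p - int (B + 2))) (int p - int (B + 2)))"

lemma tile_ok_cell_at:
  assumes "wf_tm M" "g \<le> 3"
  shows "tile_ok M (cell_at M z t b e g r)"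
  using conf_ok_conf[OF assms(1), of t z] assms(2)
  by (auto simp: cell_at_def conf_ok_def scan_conv pos_code_def simp del: scan.simps)

lemma hrel_cell_at:
  assumes "wf_tm M" "b \<noteq> b'" "e \<longrightarrow> e'"
  shows "hrel M (cell_at M z t b e (pos_class r) r) (cell_at M z t b' e' (pos_class (r + 1)) (r + 1))"
  using assms conf_ok_conf[OF assms(1), of t z]
  by (auto simp: cell_at_def conf_ok_def pos_class_def pos_next_def pos_code_def)

lemma pos_step_code: "pos_step d (pos_code r h) (pos_code r (h + dir_offset d))"
  by (cases d) (auto simp: pos_code_def)

lemma vrel_cell_at:
  assumes M: "wf_tm M" and b: "b \<noteq> b'"
  shows "vrel M (cell_at M z t b e g r) (cell_at M z (Suc t) b' e g r)"
proof (cases "conf M z t")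
  case (Pair q ts)
  note ok = conf_ok_conf[OF M, of t z, unfolded Pair]
  show ?thesis
  proof (cases "q = tm_states M")
    case True
    then show ?thesis using b conf_Suc_halted[of M z t ts] Pair by (simp add: cell_at_def)
  next
    case False
    obtain q' as where tr: "tm_trans M q (map scan ts) = (q', as)" by fastforce
    note wf = trans_wf[OF M ok False tr]
    have len: "length ts = tm_tapes M" using ok by (simp add: conf_ok_def)
    have sy: "fst (act (as ! i) (ts ! i)) r = (if pos_code r (snd (ts ! i)) = 1 then fst (as ! i) else fst (ts ! i) r)"
      and po: "pos_step (snd (as ! i)) (pos_code r (snd (ts ! i))) (pos_code r (snd (act (as ! i) (ts ! i))))" for i
      using pos_step_code by (auto simp: act_conv) (auto simp: pos_code_def split: if_splits)
    show ?thesis using False tr b wf len sy po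
      by (simp add: cell_at_def conf_Suc[OF Pair False tr] Pair del: act.simps)
  qed
qed

lemma bit_symbol_nonzero: "bit_symbol b \<noteq> 0"
  by (simp add: bit_symbol_def)

lemma conf_0: "conf M z 0 = (0, input_tape z # replicate (tm_tapes M - 1) (\<lambda>_. 0, 0))"
  by (simp add: conf_def tm_init_def)

lemma conf_0_nth: "i < tm_tapes M \<Longrightarrow> snd (conf M z 0) ! i = (if i = 0 then input_tape z else (\<lambda>_. 0, 0))"
  by (cases i) (auto simp: conf_0)

lemma fst_input_tape: "fst (input_tape z) r = (if 0 \<le> r \<and> r < int (length z) then bit_symbol (z ! nat r) else 0)"
  and snd_input_tape: "snd (input_tape z) = 0"
  by (simp_all add: input_tape_def)

text \<open>Bits are nonzero symbols, so the first blank determines the length.\<close>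

lemma tape_output_unique: "tape_output t y \<Longrightarrow> tape_output t y' \<Longrightarrow> y = y'"
proof -
  have le: "length y \<le> length y'" if "tape_output t y" "tape_output t y'" for y y'
  proof (rule ccontr)
    assume "\<not> length y \<le> length y'"
    then have "fst t (int (length y')) = bit_symbol (y ! length y')" using that(1) by (auto simp: tape_output_def)
    then show False using that(2) bit_symbol_nonzero by (simp add: tape_output_def)
  qed
  assume y: "tape_output t y" "tape_output t y'"
  then have "length y = length y'" using le by (simp add: le_antisym)
  then show "y = y'" using y by (intro nth_equalityI) (auto simp: tape_output_def bit_symbol_def split: if_splits)
qed

lemma tape_output_True: "tape_output t [True] \<longleftrightarrow> fst t 0 = 2 \<and> fst t 1 = 0"
  by (simp add: tape_output_def bit_symbol_def)

lemma conf_halted_mono: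
  assumes "conf M z t = (tm_states M, ts)" "t \<le> t'"
  shows "conf M z t' = (tm_states M, ts)"
  using tm_steps_halted_mono[of t M _ ts t'] assms by (simp add: conf_def)

section \<open>Tilings of the tableau and accepted certificates\<close>

locale tableau =
  fixes M :: tm and B q :: nat and x :: "bool list" and V :: "bool list \<Rightarrow> bool list"
  assumes wf: "wf_tm M"
    and run: "\<And>y. length y \<le> q \<Longrightarrow> tm_computes_within M B (enc_pair x y) (V (enc_pair x y))"
begin

abbreviation "W \<equiv> length (columns B q x)"
abbreviation "el \<equiv> length (enc_bits x)"

definition tiled :: "(nat \<Rightarrow> tile) \<Rightarrow> bool" where
  "tiled \<tau> \<longleftrightarrow> (\<forall>v<length (cells B q x). tile_ok M (\<tau> v) \<and> tile_type M (cells B q x ! v) (\<tau> v)) \<and>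
     (\<forall>v. v + 1 < length (cells B q x) \<longrightarrow> hrel M (\<tau> v) (\<tau> (v + 1))) \<and>
     (\<forall>v. v + W < length (cells B q x) \<longrightarrow> vrel M (\<tau> v) (\<tau> (v + W)))"

lemma K: "2 \<le> tm_tapes M"
  using wf by (simp add: wf_tm_def)

lemma W: "W = 2 * B + el + 2 * q + 4"
  by (simp add: length_columns length_enc_bits)

lemma odd_W: "odd W"
  by (simp add: length_columns)

lemma halted:
  assumes "length y \<le> q"
  shows "\<exists>ts. (\<forall>t\<ge>B. conf M (enc_pair x y) t = (tm_states M, ts)) \<and> tape_output (ts ! 1) (V (enc_pair x y))"
  using run[OF assms] conf_halted_mono unfolding tm_computes_within_def conf_def[symmetric] by blast

lemma tile_type_tile_at:
  assumes y: "length y \<le> q" "V (enc_pair x y) = [True]" and tp: "t < B + 2" "p < W"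
  shows "tile_type M (cells B q x ! (t * W + p)) (tile_at M (enc_pair x y) B W t p)"
proof (cases "p = 0")
  case True
  have "columns B q x ! p = 1" unfolding columns_nth[OF tp(2)] using True by simp
  then show ?thesis unfolding cells_nth[OF tp] tile_at_def using True by simp
next
  case p: False
  define z where "z = enc_pair x y"
  have z: "length z = el + length y" "i < el \<Longrightarrow> z ! i = enc_bits x ! i" for i
    by (auto simp: z_def enc_pair_def nth_append)
  have K0: "0 < tm_tapes M" "Suc 0 < tm_tapes M" using K by auto
  consider "t = 0" | "t \<noteq> 0" "t < B + 1" | "t = B + 1" using tp(1) by linarith
  then show ?thesis
  proof cases
    case 1
    define r where "r = int p - int (B + 2)"
    have len: "length (snd (conf M z 0)) = tm_tapes M" using K0 by (simp add: conf_0)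
    have q: "fst (conf M z 0) = 0" by (simp add: conf_0)
    note cell = cell_at_def q nth_map len conf_0_nth fst_input_tape snd_input_tape pos_code_def pos_class_def r_def[symmetric]
    have tile: "tile_at M z B W t p = cell_at M z 0 (odd p) (int (length z) \<le> r) (pos_class r) r"
      using p by (simp add: tile_at_def r_def 1)
    consider "p < B + 2" | "B + 2 \<le> p" "p < B + 2 + el" | "B + 2 + el \<le> p" "p < B + 2 + el + q"
      | "B + 2 + el + q \<le> p" by linarith
    then have "tile_type M (columns B q x ! p) (cell_at M z 0 (odd p) (int (length z) \<le> r) (pos_class r) r)"
    proof cases
      case 1
      then show ?thesis unfolding columns_nth[OF tp(2)] using p by (simp add: cell r_def)
    next
      case 2
      then have r: "0 \<le> r" "nat r = p - (B + 2)" "r < int el" by (auto simp: r_def)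
      have u: "columns B q x ! p = (if enc_bits x ! (p - (B + 2)) then 4 else 3)"
        using p 2 unfolding columns_nth[OF tp(2)] by simp
      show ?thesis using r K0 z unfolding u by (auto simp: cell bit_symbol_def)
    next
      case 3
      then have r: "int el \<le> r" by (auto simp: r_def)
      have u: "columns B q x ! p = 5" using p 3 unfolding columns_nth[OF tp(2)] by simp
      show ?thesis using r K0 z unfolding u by (auto simp: cell bit_symbol_def)
    next
      case 4
      then have r: "int (length z) \<le> r" using y(1) z(1) by (auto simp: r_def)
      have u: "columns B q x ! p = 6" using p 4 unfolding columns_nth[OF tp(2)] by simp
      show ?thesis using r K0 z unfolding u by (auto simp: cell)
    qed
    then show ?thesis unfolding z_def[symmetric] tile cells_nth[OF tp] using 1 by simp
  next
    case 2
    then show ?thesis using p unfolding cells_nth[OF tp] by (simp add: tile_at_def cell_at_def)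
  next
    case 3
    obtain ts where ts: "conf M z t = (tm_states M, ts)" "tape_output (ts ! 1) [True]"
      using halted[OF y(1)] y(2) 3 unfolding z_def by auto
    then have "length ts = tm_tapes M" using conf_ok_conf[OF wf, of t z] by (simp add: conf_ok_def)
    moreover obtain r where "tile_at M z B W t p = cell_at M z t (odd (t * W + p)) (int (length z) \<le> r) (pos_class r) r"
      using p unfolding tile_at_def by (simp only: if_False)
    moreover have "pos_class r = 1 \<longrightarrow> r = 0" "pos_class r = 2 \<longrightarrow> r = 1"
      by (auto simp: pos_class_def split: if_splits)
    ultimately show ?thesis using 3 ts K0 unfolding z_def[symmetric] cells_nth[OF tp]
      by (auto simp: cell_at_def tape_output_True)
  qed
qed

lemma tiled_tile_at:
  assumes y: "length y \<le> q" "V (enc_pair x y) = [True]"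
  shows "tiled (\<lambda>v. tile_at M (enc_pair x y) B W (v div W) (v mod W))"
  unfolding tiled_def
proof (intro conjI allI impI)
  fix v assume v: "v < length (cells B q x)"
  have W0: "0 < W" using W by simp
  have d: "v div W < B + 2" "v mod W < W" using v W0 by (auto simp: length_cells less_mult_imp_div_less)
  show "tile_ok M (tile_at M (enc_pair x y) B W (v div W) (v mod W))"
    unfolding tile_at_def by (auto intro!: tile_ok_cell_at[OF wf] simp: pos_class_def)
  show "tile_type M (cells B q x ! v) (tile_at M (enc_pair x y) B W (v div W) (v mod W))"
    using tile_type_tile_at[OF y d] by simp
next
  fix v
  show "hrel M (tile_at M (enc_pair x y) B W (v div W) (v mod W)) (tile_at M (enc_pair x y) B W ((v + 1) div W) ((v + 1) mod W))"
  \<comment> \<open>The last cell of a row is followed by the wall of the next row, and this pair is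
    subject to \<open>hrel\<close> as well.\<close>
  proof (cases "Suc (v mod W) = W")
    case True
    then have "(v + 1) mod W = 0" by (simp add: mod_Suc)
    moreover have "v mod W \<noteq> 0" using True W by linarith
    moreover have "(v + 1) div W * W = v + 1" using calculation(1) by auto
    ultimately show ?thesis by (simp add: tile_at_def cell_at_def)
  next
    case False
    then have m: "(v + 1) mod W = Suc (v mod W)" by (simp add: mod_Suc)
    have dv: "(v + 1) div W = v div W" using m by (simp add: div_Suc)
    have int: "int (Suc p) - int (B + 2) = int p - int (B + 2) + 1" for p by simp
    have par: "odd (v div W * W + v mod W) \<noteq> odd (v div W * W + Suc (v mod W))" by simp
    have e: "int (length (enc_pair x y)) \<le> int p - int (B + 2) \<longrightarrow> int (length (enc_pair x y)) \<le> int p - int (B + 2) + 1" for p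
      by simp
    show ?thesis
    proof (cases "v mod W = 0")
      case True
      then show ?thesis unfolding m dv by (simp add: tile_at_def cell_at_def)
    next
      case False
      then show ?thesis unfolding m dv tile_at_def int using hrel_cell_at[OF wf par e]
        by (simp only: if_False nat.distinct)
    qed
  qed
next
  fix v
  have "0 < W" using W by simp
  then have m: "(v + W) mod W = v mod W" and dv: "(v + W) div W = Suc (v div W)" by simp_all
  have par: "odd (v div W * W + v mod W) \<noteq> odd (Suc (v div W) * W + v mod W)" using odd_W by simp
  show "vrel M (tile_at M (enc_pair x y) B W (v div W) (v mod W)) (tile_at M (enc_pair x y) B W ((v + W) div W) ((v + W) mod W))"
    unfolding m dv tile_at_def using vrel_cell_at[OF wf par] par
    by (cases "v mod W = 0") (simp_all only: if_True if_False vrel.simps simp_thms)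
qed

lemma tiledD:
  assumes "tiled \<tau>"
  shows "t < B + 2 \<Longrightarrow> p < W \<Longrightarrow> tile_ok M (\<tau> (t * W + p))"
    and "t < B + 2 \<Longrightarrow> p < W \<Longrightarrow> tile_type M (if t = 0 then columns B q x ! p else if t < B + 1 then 7 else 8) (\<tau> (t * W + p))"
    and "t < B + 2 \<Longrightarrow> p + 1 < W \<Longrightarrow> hrel M (\<tau> (t * W + p)) (\<tau> (t * W + (p + 1)))"
    and "t + 1 < B + 2 \<Longrightarrow> p < W \<Longrightarrow> vrel M (\<tau> (t * W + p)) (\<tau> ((t + 1) * W + p))"
proof -
  have lt: "t * W + p < length (cells B q x)" if "t < B + 2" "p < W" for t p
  proof -
    have "Suc t * W \<le> (B + 2) * W" using that by (intro mult_le_mono1) simp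
    then show ?thesis using that unfolding length_cells by simp
  qed
  note tl = assms[unfolded tiled_def]
  show "tile_ok M (\<tau> (t * W + p))" if "t < B + 2" "p < W" using tl lt[OF that] by blast
  show "tile_type M (if t = 0 then columns B q x ! p else if t < B + 1 then 7 else 8) (\<tau> (t * W + p))"
    if "t < B + 2" "p < W" using tl lt[OF that] unfolding cells_nth[OF that, symmetric] by blast
  show "hrel M (\<tau> (t * W + p)) (\<tau> (t * W + (p + 1)))" if "t < B + 2" "p + 1 < W"
    using tl lt[OF that] unfolding add.assoc[symmetric] by blast
  show "vrel M (\<tau> (t * W + p)) (\<tau> ((t + 1) * W + p))" if "t + 1 < B + 2" "p < W"
  proof -
    have "(t + 1) * W + p = (t * W + p) + W" by simp
    then show ?thesis using tl lt[OF that] by metis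
  qed
qed

text \<open>The tile shows the configuration at time \<open>t\<close>; parity and \<open>e\<close>
  stay existential, as the comparison with the run concerns the configuration.\<close>

definition matches :: "bool list \<Rightarrow> nat \<Rightarrow> nat \<Rightarrow> tile \<Rightarrow> bool" where
  "matches z t p T \<longleftrightarrow> (if p = 0 then (\<exists>b. T = Wall b)
     else \<exists>b e. T = cell_at M z t b e (pos_class (int p - int (B + 2))) (int p - int (B + 2)))"

text \<open>State and scanned symbols in row \<open>t\<close> fix the state and the cell symbols of
  row \<open>t + 1\<close>; the head codes follow from the column and row relations together. The
  scanned symbols of the new row are a guess at first. They are constant along the row, and
  \<open>tile_ok\<close> compares them with the symbol under each head, which lies in the
  window.\<close>

lemma matches_Suc:
  assumes \<tau>: "tiled \<tau>" and t: "t + 1 < B + 2"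
    and row: "\<And>p. p < W \<Longrightarrow> matches z t p (\<tau> (t * W + p))" and p: "p < W"
  shows "matches z (t + 1) p (\<tau> ((t + 1) * W + p))"
proof -
  define R where "R p = \<tau> ((t + 1) * W + p)" for p
  define r where "r p = int p - int (B + 2)" for p
  obtain Q ts where Q: "conf M z t = (Q, ts)" by fastforce
  obtain Q' ts' where Q': "conf M z (t + 1) = (Q', ts')" by fastforce
  have ok: "conf_ok M t (Q, ts)" "conf_ok M (t + 1) (Q', ts')"
    using conf_ok_conf[OF wf] Q Q' by metis+
  have len: "length ts = tm_tapes M" "length ts' = tm_tapes M" using ok by (auto simp: conf_ok_def)
  have v: "vrel M (\<tau> (t * W + p)) (R p)" if "p < W" for p
    unfolding R_def by (rule tiledD(4)[OF \<tau> t that])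
  have h: "hrel M (R p) (R (p + 1))" if "p + 1 < W" for p
    unfolding R_def by (rule tiledD(3)[OF \<tau> t that])
  have okR: "tile_ok M (R p)" if "p < W" for p
    unfolding R_def by (rule tiledD(1)[OF \<tau> t that])
  have wall: "\<exists>b. R 0 = Wall b"
  proof -
    have "0 < W" using W by simp
    then show ?thesis using v[of 0] row[of 0] by (cases "R 0") (auto simp: matches_def)
  qed
  \<comment> \<open>What the column relation alone says about cell \<open>p\<close>:
    \<open>ss\<close> and, while the machine runs, \<open>po\<close> are not yet determined. The
    guard makes \<open>P\<close> satisfiable for all \<open>p\<close>, so that choice functions
    exist.\<close>
  define P where "P p b e ss sy po \<longleftrightarrow> (0 < p \<longrightarrow> p < W \<longrightarrow> R p = Cell b (pos_class (r p)) e Q' ss sy po \<and>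
      sy = map (\<lambda>t. fst t (r p)) ts' \<and> (\<forall>i<tm_tapes M. if Q = tm_states M then po ! i = pos_code (r p) (snd (ts' ! i))
        else pos_step (snd (snd (tm_trans M Q (map scan ts)) ! i)) (pos_code (r p) (snd (ts ! i))) (po ! i)))"
    for p b e ss sy po
  have "\<exists>b e ss sy po. P p b e ss sy po" for p
  proof (cases "0 < p \<and> p < W")
      case True
      then obtain b e where old: "\<tau> (t * W + p) = cell_at M z t b e (pos_class (r p)) (r p)"
        using row[of p] by (auto simp: matches_def r_def)
      obtain b' g' e' q' ss' sy' po' where new: "R p = Cell b' g' e' q' ss' sy' po'"
        using v[of p] True unfolding old by (cases "R p") (auto simp: cell_at_def)
      have len': "length sy' = tm_tapes M" using okR[of p] True new by simp
      show ?thesis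
      proof (cases "Q = tm_states M")
        case halt: True
        have "Q' = Q" "ts' = ts" using conf_Suc_halted[of M z t ts] Q Q' halt by auto
        then show ?thesis unfolding P_def using v[of p] True old new halt len by (auto simp: cell_at_def Q)
      next
        case False
        obtain q1 as where tr: "tm_trans M Q (map scan ts) = (q1, as)" by fastforce
        have eq: "Q' = q1" "ts' = map2 act as ts" using conf_Suc[OF Q False tr] Q' by auto
        have la: "length as = tm_tapes M" by (rule trans_wf(2)[OF wf ok(1) False tr])
        have "sy' = map (\<lambda>t. fst t (r p)) ts'"
        proof (rule nth_equalityI)
          fix i assume "i < length sy'"
          then show "sy' ! i = map (\<lambda>t. fst t (r p)) ts' ! i"
            using v[of p] True old new False tr len' len la unfolding eq
            by (auto simp: cell_at_def Q act_conv pos_code_def)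
        qed (use len len' in simp)
        then show ?thesis unfolding P_def using v[of p] True old new False tr len' len la unfolding eq
          by (auto simp: cell_at_def Q)
      qed
    qed (auto simp: P_def)
  then obtain b e ss sy po where P: "\<And>p. P p (b p) (e p) (ss p) (sy p) (po p)"
    by metis
  have R: "\<And>p. 0 < p \<Longrightarrow> p < W \<Longrightarrow> R p = Cell (b p) (pos_class (r p)) (e p) Q' (ss p) (sy p) (po p)"
    and sy: "\<And>p. 0 < p \<Longrightarrow> p < W \<Longrightarrow> sy p = map (\<lambda>t. fst t (r p)) ts'"
    and po: "\<And>p i. 0 < p \<Longrightarrow> p < W \<Longrightarrow> i < tm_tapes M \<Longrightarrow> if Q = tm_states M then po p ! i = pos_code (r p) (snd (ts' ! i))
        else pos_step (snd (snd (tm_trans M Q (map scan ts)) ! i)) (pos_code (r p) (snd (ts ! i))) (po p ! i)"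
    using P unfolding P_def by blast+
  have pos: "po p ! i = pos_code (r p) (snd (ts' ! i))" if p: "0 < p" "p < W" and i: "i < tm_tapes M" for p i
  proof (cases "Q = tm_states M")
    case True
    then show ?thesis using po[OF that] by simp
  next
    case False
    obtain q1 as where tr: "tm_trans M Q (map scan ts) = (q1, as)" by fastforce
    have la: "length as = tm_tapes M" by (rule trans_wf(2)[OF wf ok(1) False tr])
    have hd: "snd (ts' ! i) = snd (ts ! i) + dir_offset (snd (as ! i))"
    proof -
      have "ts' = map2 act as ts" using conf_Suc[OF Q False tr] Q' by simp
      then have "ts' ! i = act (as ! i) (ts ! i)" using la len i by simp
      then show ?thesis by (simp add: act_conv)
    qed
    have bnd: "\<bar>snd (ts ! i)\<bar> \<le> int t" "\<bar>snd (ts' ! i)\<bar> \<le> int (t + 1)"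
      using ok i by (auto simp: conf_ok_def)
    define f where "f z = po (nat (z + int (B + 2))) ! i" for z
    have hi: "int W = 2 * int B + int el + 2 * int q + 4" using W by simp
    have idx: "0 < nat (z + int (B + 2)) \<and> nat (z + int (B + 2)) < W \<and> r (nat (z + int (B + 2))) = z"
      if "r 1 \<le> z" "z \<le> r (W - 1)" for z
      using that W by (auto simp: r_def)
    have "f (r p) = pos_code (r p) (snd (ts ! i) + dir_offset (snd (as ! i)))"
    \<comment> \<open>The window is formed by the columns 1 to \<open>W - 1\<close>, which the heads
      cannot leave up to time \<open>t + 1 \<le> B + 1\<close>.\<close>
    proof (rule pos_code_step[where lo = "r 1" and hi = "r (W - 1)"])
      fix z assume z: "r 1 \<le> z" "z \<le> r (W - 1)"
      show "pos_step (snd (as ! i)) (pos_code z (snd (ts ! i))) (f z)"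
        using po[of "nat (z + int (B + 2))", OF _ _ i] idx[OF z] False tr by (simp add: f_def)
    next
      fix z assume z: "r 1 \<le> z" "z < r (W - 1)"
      define c where "c = nat (z + int (B + 2))"
      have c: "0 < c" "c + 1 < W" "nat (z + 1 + int (B + 2)) = c + 1" using z W by (auto simp: r_def c_def)
      have "hrel M (R c) (R (c + 1))" using c by (intro h)
      then show "pos_next (f z) (f (z + 1))"
        using R[of c] R[of "c + 1"] c(1,2) i unfolding f_def c(3) c_def[symmetric] by simp
    qed (use bnd p t W hd in \<open>auto simp: r_def\<close>)
    then show ?thesis unfolding hd by (simp add: f_def r_def)
  qed
  have ss: "ss p = ss 1" if "0 < p" "p < W" for p
    using that
  proof (induction p)
    case (Suc p)
    show ?case
    proof (cases "p = 0")
      case False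
      then show ?thesis using Suc h[of p] R[of p] R[of "p + 1"] by simp
    qed simp
  qed simp
  have ss1: "ss 1 = map scan ts'"
  proof (rule nth_equalityI)
    have "1 < W" using W by simp
    then show l: "length (ss 1) = length (map scan ts')" using okR[of 1] R[of 1] len by simp
    fix i assume "i < length (ss 1)"
    then have i: "i < tm_tapes M" using l len by simp
    \<comment> \<open>The column of head \<open>i\<close>, where the guessed scanned symbol meets
      the tape content.\<close>
    define c where "c = nat (snd (ts' ! i) + int (B + 2))"
    have "\<bar>snd (ts' ! i)\<bar> \<le> int (t + 1)" using ok(2) i by (auto simp: conf_ok_def)
    then have c: "0 < c" "c < W" "r c = snd (ts' ! i)" using t W by (auto simp: c_def r_def)
    have "sy c ! i = ss c ! i"
      using okR[OF c(2)] R[OF c(1,2)] pos[OF c(1,2) i] i by (simp add: c(3) pos_code_def)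
    then show "ss 1 ! i = map scan ts' ! i"
      unfolding ss[OF c(1,2)] sy[OF c(1,2)] c(3) using i len by (simp add: scan_conv del: scan.simps)
  qed
  have "R p = cell_at M z (t + 1) (b p) (e p) (pos_class (r p)) (r p)" if "0 < p"
  proof -
    have "length (po p) = tm_tapes M" using okR[OF p] R[OF that p] by simp
    then have "po p = map (\<lambda>t. pos_code (r p) (snd t)) ts'"
      using pos[OF that p] len by (intro nth_equalityI) auto
    then show ?thesis unfolding R[OF that p] cell_at_def ss[OF that p] ss1 sy[OF that p] Q' by simp
  qed
  then show ?thesis using wall unfolding matches_def R_def r_def by (cases "p = 0") auto
qed

text \<open>The certificate is what stands in the guess zone before its first blank. The flag
  \<open>e\<close> can only switch on along the row, so no symbol follows a blank. The cell types
  replace the column relation here: they make head codes and position classes nonzero exactly from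
  the origin on, and the row relation does the rest.\<close>

lemma matches_0:
  assumes \<tau>: "tiled \<tau>"
  shows "\<exists>y. length y \<le> q \<and> (\<forall>p<W. matches (enc_pair x y) 0 p (\<tau> p))"
proof -
  have K0: "0 < tm_tapes M" using K by simp
  have el: "1 \<le> el" by (simp add: length_enc_bits)
  have h: "hrel M (\<tau> p) (\<tau> (p + 1))" if "p + 1 < W" for p
    using tiledD(3)[OF \<tau> _ that, of 0] by simp
  have okT: "tile_ok M (\<tau> p)" if "p < W" for p
    using tiledD(1)[OF \<tau> _ that, of 0] by simp
  have ty: "tile_type M (columns B q x ! p) (\<tau> p)" if "p < W" for p
    using tiledD(2)[OF \<tau> _ that, of 0] by simp
  define P where "P p b g e Q ss sy po \<longleftrightarrow> (0 < p \<longrightarrow> p < W \<longrightarrow> \<tau> p = Cell b g e Q ss sy po)"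
    for p b g e Q ss sy po
  have "\<exists>b g e Q ss sy po. P p b g e Q ss sy po" for p
  proof (cases "0 < p \<and> p < W")
    case True
    then have "columns B q x ! p \<notin> {1, 7, 8}" using columns_nth[of p B q x] by auto
    then show ?thesis using True ty[of p] unfolding P_def by (cases "\<tau> p") auto
  qed (auto simp: P_def)
  then obtain b g e Q ss sy po where "\<And>p. P p (b p) (g p) (e p) (Q p) (ss p) (sy p) (po p)"
    by metis
  then have T: "\<tau> p = Cell (b p) (g p) (e p) (Q p) (ss p) (sy p) (po p)" if "0 < p" "p < W" for p
    using that unfolding P_def by blast
  have hn: "(g p, g (p + 1)) \<in> {(0, 0), (0, 1), (1, 2), (2, 3), (3, 3)}" "e p \<longrightarrow> e (p + 1)" "ss p = ss (p + 1)"
    "i < tm_tapes M \<Longrightarrow> pos_next (po p ! i) (po (p + 1) ! i)"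
    if "0 < p" "p + 1 < W" for p i
    using h[OF that(2)] T[of p] T[of "p + 1"] that by auto
  have left: "g p = 0 \<and> Q p = 0 \<and> (\<forall>i<tm_tapes M. sy p ! i = 0 \<and> po p ! i = 0)" if "0 < p" "p < B + 2" for p
  proof -
    have pW: "p < W" using that W by simp
    have "columns B q x ! p = 2" unfolding columns_nth[OF pW] using that by simp
    then show ?thesis using ty[OF pW] T[OF that(1) pW] by simp
  qed
  have right: "g p \<noteq> 0 \<and> Q p = 0 \<and> (\<forall>i<tm_tapes M. po p ! i \<noteq> 0 \<and> (i \<noteq> 0 \<longrightarrow> sy p ! i = 0))" if "B + 2 \<le> p" "p < W" for p
  proof -
    have "columns B q x ! p \<in> {3, 4, 5, 6}" unfolding columns_nth[OF that(2)] using that by auto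
    then show ?thesis using ty[OF that(2)] T[of p] that by auto
  qed
  have bits: "sy p ! 0 = bit_symbol (enc_bits x ! (p - (B + 2)))" if "B + 2 \<le> p" "p < B + 2 + el" for p
  proof -
    have pW: "p < W" using that W by simp
    show ?thesis using ty[OF pW] T[of p] that pW unfolding columns_nth[OF pW] by (auto simp: bit_symbol_def split: if_splits)
  qed
  have guess: "sy p ! 0 \<le> 2 \<and> (e p \<longleftrightarrow> sy p ! 0 = 0)" if "B + 2 + el \<le> p" "p < B + 2 + el + q" for p
  proof -
    have pW: "p < W" using that W by simp
    have "columns B q x ! p = 5" unfolding columns_nth[OF pW] using that by simp
    then show ?thesis using ty[OF pW] T[of p] that pW by auto
  qed
  have blank: "sy p ! 0 = 0" if "B + 2 + el + q \<le> p" "p < W" for p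
  proof -
    have "columns B q x ! p = 6" unfolding columns_nth[OF that(2)] using that by simp
    then show ?thesis using ty[OF that(2)] T[of p] that by auto
  qed
  define s where "s j = sy (B + 2 + el + j) ! 0" for j
  \<comment> \<open>The certificate ends at its first blank, or at \<open>q\<close> if it fills the
    zone.\<close>
  define m where "m = (LEAST j. j = q \<or> s j = 0)"
  define y where "y = map (\<lambda>j. s j = 2) [0..<m]"
  define z where "z = enc_pair x y"
  have m: "m = q \<or> s m = 0" unfolding m_def by (rule LeastI[of "\<lambda>j. j = q \<or> s j = 0" q]) simp
  have mq: "m \<le> q" unfolding m_def by (rule Least_le) simp
  have less_m: "s j \<noteq> 0" if "j < m" for j using not_less_Least[OF that[unfolded m_def]] by simp
  have sj: "s j = bit_symbol (y ! j)" if "j < m" for j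
  proof -
    have "s j \<le> 2" using guess[of "B + 2 + el + j"] that mq by (simp add: s_def)
    then show ?thesis using less_m[OF that] that by (auto simp: y_def bit_symbol_def)
  qed
  have s0: "s j = 0" if "m \<le> j" "j < q" for j
    using that
  proof (induction j)
    case 0
    then show ?case using m by auto
  next
    case (Suc j)
    show ?case
    proof (cases "m = Suc j")
      case True
      then show ?thesis using m Suc.prems by auto
    next
      case False
      then have "s j = 0" using Suc by simp
      then have "e (B + 2 + el + j)" using guess[of "B + 2 + el + j"] Suc.prems by (simp add: s_def)
      then have "e (B + 2 + el + j + 1)" using hn(2)[of "B + 2 + el + j"] Suc.prems W by simp
      then show ?thesis using guess[of "B + 2 + el + j + 1"] Suc.prems by (simp add: s_def)
    qed
  qed
  have lz: "length z = el + m" by (simp add: z_def enc_pair_def y_def)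
  have zn: "z ! i = (if i < el then enc_bits x ! i else y ! (i - el))" for i
    by (simp add: z_def enc_pair_def nth_append)
  define r where "r p = int p - int (B + 2)" for p
  have sym0: "sy p ! 0 = fst (input_tape z) (r p)" if p: "0 < p" "p < W" for p
  proof -
    consider "p < B + 2" | "B + 2 \<le> p" "p < B + 2 + el" | "B + 2 + el \<le> p" "p < B + 2 + el + m"
      | "B + 2 + el + m \<le> p" "p < B + 2 + el + q" | "B + 2 + el + q \<le> p" by linarith
    then show ?thesis
    proof cases
      case 1
      then show ?thesis using left[OF p(1)] K0 by (simp add: fst_input_tape r_def)
    next
      case 2
      then have "nat (r p) = p - (B + 2)" "0 \<le> r p" "r p < int el" by (auto simp: r_def)
      then show ?thesis using 2 bits[OF 2] by (auto simp: fst_input_tape lz zn)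
    next
      case 3
      define j where "j = p - (B + 2 + el)"
      have j: "p = B + 2 + el + j" "j < m" using 3 by (auto simp: j_def)
      have "nat (r p) = el + j" "0 \<le> r p" "r p < int (el + m)" using j by (auto simp: r_def)
      then show ?thesis using sj[OF j(2)] unfolding j(1)[symmetric] s_def by (auto simp: fst_input_tape lz zn j(1)[symmetric])
    next
      case 4
      define j where "j = p - (B + 2 + el)"
      have j: "p = B + 2 + el + j" "m \<le> j" "j < q" using 4 by (auto simp: j_def)
      have "\<not> r p < int (el + m)" using 4 by (auto simp: r_def)
      then show ?thesis using s0[OF j(2,3)] unfolding s_def j(1)[symmetric] by (simp add: fst_input_tape lz)
    next
      case 5
      then have "\<not> r p < int (el + m)" using mq by (auto simp: r_def)
      then show ?thesis using blank[OF 5 p(2)] by (simp add: fst_input_tape lz)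
    qed
  qed
  have sym: "sy p ! i = (if i = 0 then fst (input_tape z) (r p) else 0)" if p: "0 < p" "p < W" and i: "i < tm_tapes M" for p i
    using sym0[OF p] left[OF p(1)] right[OF _ p(2)] i by (cases "p < B + 2") auto
  have pos: "po p ! i = pos_code (r p) 0" if p: "0 < p" "p < W" and i: "i < tm_tapes M" for p i
  proof (cases "p < B + 2")
    case True
    then show ?thesis using left[OF p(1)] i by (simp add: pos_code_def r_def)
  next
    case False
    have "po p ! i \<noteq> 0" using right[OF _ p(2)] False i by simp
    have nx: "pos_next (po (p - 1) ! i) (po p ! i)" using hn(4)[of "p - 1" i] p i False by simp
    show ?thesis
    proof (cases "p = B + 2")
      case True
      then have "po (p - 1) ! i = 0" using left[of "p - 1"] i by simp
      then show ?thesis using nx \<open>po p ! i \<noteq> 0\<close> True by (simp add: pos_next_def pos_code_def r_def)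
    next
      case F: False
      then have "po (p - 1) ! i \<noteq> 0" using right[of "p - 1"] i False p by auto
      then show ?thesis using nx F False by (auto simp: pos_next_def pos_code_def r_def)
    qed
  qed
  have gcl: "g p = pos_class (r p)" if p: "0 < p" "p < W" for p
    using that
  proof (induction p)
    case (Suc p)
    show ?case
    proof (cases "Suc p < B + 2")
      case True
      then show ?thesis using left[of "Suc p"] by (simp add: pos_class_def r_def)
    next
      case False
      then have "0 < p" by simp
      then have "(g p, g (Suc p)) \<in> {(0, 0), (0, 1), (1, 2), (2, 3), (3, 3)}" "g p = pos_class (r p)" "g (Suc p) \<noteq> 0"
        using hn(1)[of p] Suc right[of "Suc p"] False by auto
      then show ?thesis using False by (auto simp: pos_class_def r_def split: if_splits)
    qed
  qed simp
  have QQ: "Q p = 0" if "0 < p" "p < W" for p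
    using left[of p] right[of p] that by (cases "p < B + 2") auto
  have ss1: "ss p = ss 1" if "0 < p" "p < W" for p
    using that
  proof (induction p)
    case (Suc p)
    then show ?case using hn(3)[of p] by (cases "p = 0") auto
  qed simp
  have len: "length (ss p) = tm_tapes M" "length (sy p) = tm_tapes M" "length (po p) = tm_tapes M"
    "\<And>i. i < tm_tapes M \<Longrightarrow> po p ! i = 1 \<Longrightarrow> sy p ! i = ss p ! i" if "0 < p" "p < W" for p
    using okT[OF that(2)] T[OF that] by auto
  define ts where "ts = snd (conf M z 0)"
  have lts: "length ts = tm_tapes M" using K0 by (simp add: ts_def conf_0)
  have tsn: "fst (ts ! i) r = (if i = 0 then fst (input_tape z) r else 0)" "snd (ts ! i) = 0" if "i < tm_tapes M" for i r
    using conf_0_nth[OF that, of z] by (simp_all add: ts_def snd_input_tape)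
  have cW: "0 < B + 2" "B + 2 < W" using W by auto
  have ssts: "ss 1 = map scan ts"
  proof (rule nth_equalityI)
    show "length (ss 1) = length (map scan ts)" using len(1)[of 1] lts W by simp
    fix i assume "i < length (ss 1)"
    then have i: "i < tm_tapes M" using len(1)[of 1] W by simp
    have "po (B + 2) ! i = 1" using pos[OF cW i] by (simp add: pos_code_def r_def)
    then have "ss 1 ! i = sy (B + 2) ! i" using len(4)[OF cW i] ss1[OF cW] by simp
    then show "ss 1 ! i = map scan ts ! i" using sym[OF cW i] tsn[OF i] i lts
      by (simp add: scan_conv r_def del: scan.simps)
  qed
  have "matches z 0 p (\<tau> p)" if "p < W" for p
  proof (cases "p = 0")
    case True
    then have "columns B q x ! p = 1" unfolding columns_nth[OF that] by simp
    then have "\<exists>b. \<tau> p = Wall b" using ty[OF that] by (cases "\<tau> p") auto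
    then show ?thesis using True by (simp add: matches_def)
  next
    case False
    then have p: "0 < p" "p < W" using that by auto
    have "sy p = map (\<lambda>t. fst t (r p)) ts"
      using len(2)[OF p] lts sym[OF p] tsn by (intro nth_equalityI) auto
    moreover have "po p = map (\<lambda>t. pos_code (r p) (snd t)) ts"
      using len(3)[OF p] lts pos[OF p] tsn by (intro nth_equalityI) auto
    moreover have "Q p = fst (conf M z 0)" using QQ[OF p] by (simp add: conf_0)
    ultimately have "\<tau> p = cell_at M z 0 (b p) (e p) (pos_class (r p)) (r p)"
      unfolding T[OF p] cell_at_def gcl[OF p] ss1[OF p] ssts by (simp add: ts_def)
    then show ?thesis using False unfolding matches_def r_def by auto
  qed
  then show ?thesis using mq by (intro exI[of _ y]) (simp add: z_def y_def)
qed

text \<open>Row \<open>B + 1\<close> shows a halted configuration, since every run on a certificate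
  of the allowed length halts by time \<open>B\<close>. Its cells of type 8 at the tape positions 0
  and 1 force the output \<open>[True]\<close>.\<close>

lemma tiled_imp:
  assumes "tiled \<tau>"
  shows "\<exists>y. length y \<le> q \<and> V (enc_pair x y) = [True]"
proof -
  obtain y where y: "length y \<le> q" "\<And>p. p < W \<Longrightarrow> matches (enc_pair x y) 0 p (\<tau> p)"
    using matches_0[OF assms] by blast
  have rows: "matches (enc_pair x y) t p (\<tau> (t * W + p))" if "t < B + 2" "p < W" for t p
    using that
  proof (induction t arbitrary: p)
    case (Suc t)
    then show ?case using matches_Suc[OF assms, of t] by simp
  qed (simp add: y(2))
  obtain ts where ts: "conf M (enc_pair x y) (B + 1) = (tm_states M, ts)" "tape_output (ts ! 1) (V (enc_pair x y))"
    using halted[OF y(1)] by auto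
  have "length ts = tm_tapes M" using conf_ok_conf[OF wf, of "B + 1" "enc_pair x y"] ts by (simp add: conf_ok_def)
  then have len: "1 < length ts" using K by simp
  have sym: "fst (ts ! 1) r = (if r = 0 then 2 else 0)" if r: "r = 0 \<or> r = 1" for r
  proof -
    define p where "p = B + 2 + nat r"
    have p: "p \<noteq> 0" "p < W" "int p - int (B + 2) = r" using r W by (auto simp: p_def)
    have "matches (enc_pair x y) (B + 1) p (\<tau> ((B + 1) * W + p))" by (rule rows) (use p in auto)
    then obtain b e where "\<tau> ((B + 1) * W + p) = cell_at M (enc_pair x y) (B + 1) b e (pos_class r) r"
      using p unfolding matches_def by auto
    moreover have "tile_type M 8 (\<tau> ((B + 1) * W + p))"
      using tiledD(2)[OF assms _ p(2), of "B + 1"] by simp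
    ultimately show ?thesis using r ts len by (auto simp: cell_at_def pos_class_def)
  qed
  have "tape_output (ts ! 1) [True]" unfolding tape_output_True using sym[of 0] sym[of 1] by simp
  then have "V (enc_pair x y) = [True]" using ts(2) tape_output_unique by blast
  then show ?thesis using y(1) by blast
qed

end

section \<open>Programs on unary tapes\<close>

text \<open>Times are upper bounds, which compose more easily than exact ones. The nine tapes: 0
  input, 1 output, 2 the first row, 3 and 4 the bounds \<open>q\<close> and \<open>B\<close> in
  unary, 5 scratch and later the dimension in binary, 6 and 7 two copies of the cell types, 8 the
  marks.\<close>

definition runs :: "cmd \<Rightarrow> (nat \<Rightarrow> tape) \<Rightarrow> nat \<Rightarrow> (nat \<Rightarrow> tape) \<Rightarrow> bool" where
  "runs c s b s' \<longleftrightarrow> (\<exists>t\<le>b. exec 9 c s t s')"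

lemma runs_Act: "runs (Act i g d) s 1 (s(i := act (g (scans 9 s), d) (s i)))"
  unfolding runs_def by (intro exI[of _ 1] conjI exec_Act order_refl)

lemma runs_Seq: "runs c1 s b1 s1 \<Longrightarrow> runs c2 s1 b2 s2 \<Longrightarrow> runs (Seq c1 c2) s (b1 + b2) s2"
proof -
  assume "runs c1 s b1 s1" "runs c2 s1 b2 s2"
  then obtain t1 t2 where "t1 \<le> b1" "exec 9 c1 s t1 s1" "t2 \<le> b2" "exec 9 c2 s1 t2 s2"
    unfolding runs_def by blast
  then show "runs (Seq c1 c2) s (b1 + b2) s2"
    unfolding runs_def by (intro exI[of _ "t1 + t2"] conjI add_mono exec_Seq)
qed

lemma runs_mono: "runs c s b s' \<Longrightarrow> b \<le> b' \<Longrightarrow> runs c s b' s'"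
  unfolding runs_def by (meson le_trans)

lemma runs_cong: "runs c s b s' \<Longrightarrow> b \<le> b' \<Longrightarrow> s' = s'' \<Longrightarrow> runs c s b' s''"
  using runs_mono by blast

lemma runs_While:
  assumes "\<And>j. j < n \<Longrightarrow> b (scans 9 (S j))" "\<And>j. j < n \<Longrightarrow> runs c (S j) B (S (Suc j))" "\<not> b (scans 9 (S n))"
  shows "runs (While b c) (S 0) (n * (B + 1) + 1) (S n)"
  using assms
proof (induction n arbitrary: S)
  case 0
  then have "exec 9 (While b c) (S 0) 1 (S 0)" by (intro exec_While_False)
  then show ?case unfolding runs_def by (intro exI[of _ 1]) simp
next
  case (Suc n)
  have "runs (While b c) (S (Suc 0)) (n * (B + 1) + 1) (S (Suc n))"
    by (rule Suc.IH[of "\<lambda>j. S (Suc j)"]) (use Suc.prems in auto)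
  then obtain t2 where t2: "t2 \<le> n * (B + 1) + 1" "exec 9 (While b c) (S (Suc 0)) t2 (S (Suc n))"
    unfolding runs_def by blast
  obtain t1 where t1: "t1 \<le> B" "exec 9 c (S 0) t1 (S (Suc 0))"
    using Suc.prems(2)[of 0] unfolding runs_def by blast
  have "exec 9 (While b c) (S 0) (1 + t1 + t2) (S (Suc n))"
    using exec_While_True[OF _ t1(2) t2(2)] Suc.prems(1)[of 0] by simp
  moreover have "1 + t1 + t2 \<le> Suc n * (B + 1) + 1" using t1(1) t2(1) by simp
  ultimately show ?case unfolding runs_def by blast
qed

definition skip :: cmd where
  "skip = Act 0 (\<lambda>f. f 0) Stay"

lemma scans_nth [simp]: "j < 9 \<Longrightarrow> scans 9 s j = scan (s j)"
  by (simp add: scans_def)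

lemma runs_skip: "runs skip s 1 s"
  using runs_Act[of 0 "\<lambda>f. f 0" Stay s] by (simp add: skip_def)

definition seqs :: "cmd list \<Rightarrow> cmd" where
  "seqs cs = foldr Seq cs skip"

lemma seqs_simps: "seqs [] = skip" "seqs (c # cs) = Seq c (seqs cs)"
  by (simp_all add: seqs_def)

lemma runs_seqs:
  assumes "\<And>j. j < length cs \<Longrightarrow> runs (cs ! j) (S j) B (S (Suc j))"
  shows "runs (seqs cs) (S 0) (length cs * B + 1) (S (length cs))"
  using assms
proof (induction cs arbitrary: S)
  case Nil
  show ?case using runs_skip by (simp add: seqs_simps)
next
  case (Cons c cs)
  have "runs (seqs cs) (S (Suc 0)) (length cs * B + 1) (S (Suc (length cs)))"
  proof (rule Cons.IH[of "\<lambda>j. S (Suc j)"])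
    fix j assume "j < length cs"
    then show "runs (cs ! j) (S (Suc j)) B (S (Suc (Suc j)))" using Cons.prems[of "Suc j"] by simp
  qed
  moreover have "runs c (S 0) B (S (Suc 0))" using Cons.prems[of 0] by simp
  ultimately have "runs (seqs (c # cs)) (S 0) (B + (length cs * B + 1)) (S (Suc (length cs)))"
    unfolding seqs_simps by (rule runs_Seq[rotated])
  then show ?case by (simp add: add.assoc)
qed

lemma runs_seqs_Nil: "runs (seqs []) s 1 s"
  using runs_skip by (simp add: seqs_simps)

lemma runs_seqs_Cons: "runs c s b s1 \<Longrightarrow> runs (seqs cs) s1 b' s2 \<Longrightarrow> runs (seqs (c # cs)) s (b + b') s2"
  using runs_Seq by (simp add: seqs_simps)

section \<open>Tapes as words, and loops over a tape\<close>

definition tp :: "nat list \<Rightarrow> int \<Rightarrow> tape" where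
  "tp w h = ((\<lambda>i. if 0 \<le> i \<and> i < int (length w) then w ! nat i else 0), h)"

definition te :: "nat list \<Rightarrow> tape" where
  "te w = tp w (int (length w))"

lemma scan_tp: "scan (tp w h) = (if 0 \<le> h \<and> h < int (length w) then w ! nat h else 0)"
  by (simp add: tp_def)

lemma scan_te [simp]: "scan (te w) = 0"
  by (simp add: te_def scan_tp)

lemma act_move_tp: "act (scan (tp w h), d) (tp w h) = tp w (h + dir_offset d)"
  by (auto simp: tp_def)

lemma act_te: "act (a, Go_Right) (te w) = te (w @ [a])"
  by (auto simp: te_def tp_def fun_eq_iff nth_append)

lemma act_tp: "j < length w \<Longrightarrow> act (a, d) (tp w (int j)) = tp (w[j := a]) (int j + dir_offset d)"
  by (auto simp: tp_def fun_eq_iff nth_list_update)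

lemma act_tp_last: "act (0, d) (tp (w @ [a]) (int (length w))) = tp w (int (length w) + dir_offset d)"
  by (auto simp: tp_def fun_eq_iff nth_append)

lemma blank_tape: "((\<lambda>_. 0), 0) = tp [] 0" "tp [] 0 = te []"
  by (auto simp: tp_def te_def)

definition move :: "nat \<Rightarrow> dir \<Rightarrow> cmd" where
  "move i d = Act i (\<lambda>f. f i) d"

definition app :: "nat \<Rightarrow> ((nat \<Rightarrow> nat) \<Rightarrow> nat) \<Rightarrow> cmd" where
  "app i g = Act i g Go_Right"

definition rewind :: "nat \<Rightarrow> cmd" where
  "rewind i = seqs [move i Go_Left, While (\<lambda>f. f i \<noteq> 0) (move i Go_Left), move i Go_Right]"

definition each :: "nat \<Rightarrow> cmd \<Rightarrow> cmd" where
  "each i c = Seq (While (\<lambda>f. f i \<noteq> 0) (Seq c (move i Go_Right))) (rewind i)"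

definition drain :: "nat \<Rightarrow> cmd \<Rightarrow> cmd" where
  "drain i c = seqs [move i Go_Left, While (\<lambda>f. f i \<noteq> 0) (Seq c (Act i (\<lambda>_. 0) Go_Left)), move i Go_Right]"

lemma runs_move:
  assumes "i < 9" "s i = tp w h"
  shows "runs (move i d) s 1 (s(i := tp w (h + dir_offset d)))"
  using runs_Act[of i "\<lambda>f. f i" d s] assms by (simp add: move_def act_move_tp)

lemma runs_app:
  assumes "s i = te w" "g (scans 9 s) = a"
  shows "runs (app i g) s 1 (s(i := te (w @ [a])))"
  using runs_Act[of i g Go_Right s] assms by (simp add: app_def act_te)

lemma runs_rewind:
  assumes "i < 9" "s i = tp w (int h)" "h \<le> length w" "0 \<notin> set w"
  shows "runs (rewind i) s (2 * h + 4) (s(i := tp w 0))"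
proof -
  define S where "S j = s(i := tp w (int h - 1 - int j))" for j
  have 1: "runs (move i Go_Left) s 1 (S 0)"
    using runs_move[where s = s and d = Go_Left, OF assms(1,2)] by (simp add: S_def)
  have "runs (While (\<lambda>f. f i \<noteq> 0) (move i Go_Left)) (S 0) (h * (1 + 1) + 1) (S h)"
  proof (rule runs_While)
    fix j assume j: "j < h"
    have "runs (move i Go_Left) (S j) 1 ((S j)(i := tp w (int h - 1 - int j + dir_offset Go_Left)))"
      by (rule runs_move[OF assms(1)]) (simp add: S_def)
    then show "runs (move i Go_Left) (S j) 1 (S (Suc j))"
      by (simp add: S_def algebra_simps)
    have "w ! nat (int h - 1 - int j) \<in> set w" using j assms(3) by (intro nth_mem) auto
    then have "w ! nat (int h - 1 - int j) \<noteq> 0" using assms(4) by metis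
    then show "scans 9 (S j) i \<noteq> 0" using assms(1,3) j by (simp add: S_def scan_tp)
  next
    show "\<not> scans 9 (S h) i \<noteq> 0" using assms(1) by (simp add: S_def scan_tp)
  qed
  note 2 = this
  have 3: "runs (move i Go_Right) (S h) 1 (s(i := tp w 0))"
    using runs_move[OF assms(1), of "S h" w "-1" Go_Right] by (simp add: S_def)
  show ?thesis unfolding rewind_def
    by (rule runs_mono, rule runs_seqs_Cons[OF 1 runs_seqs_Cons[OF 2 runs_seqs_Cons[OF 3 runs_seqs_Nil]]]) simp
qed

text \<open>\<open>S j\<close> describes the other tapes after \<open>j\<close> rounds. Its value at
  \<open>i\<close> is overwritten everywhere, so the invariant can be stated without the loop tape.
  The blank behind the word ends the loop.\<close>

lemma runs_each:
  assumes i: "i < 9" and w: "0 \<notin> set w"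
    and body: "\<And>j. j < length w \<Longrightarrow> runs c ((S j)(i := tp w (int j))) B ((S (Suc j))(i := tp w (int j)))"
    and s: "s = (S 0)(i := tp w 0)" and s': "s' = (S (length w))(i := tp w 0)"
  shows "runs (each i c) s (length w * (B + 4) + 5) s'"
proof -
  define S' where "S' j = (S j)(i := tp w (int j))" for j
  have "runs (While (\<lambda>f. f i \<noteq> 0) (Seq c (move i Go_Right))) (S' 0) (length w * ((B + 1) + 1) + 1) (S' (length w))"
  proof (rule runs_While)
    fix j assume j: "j < length w"
    have "w ! j \<in> set w" using j by simp
    then have "w ! j \<noteq> 0" using w by metis
    then show "scans 9 (S' j) i \<noteq> 0" using i j by (simp add: S'_def scan_tp)
    have "runs (move i Go_Right) ((S (Suc j))(i := tp w (int j))) 1 (((S (Suc j))(i := tp w (int j)))(i := tp w (int j + dir_offset Go_Right)))"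
      by (rule runs_move[OF i]) simp
    then have "runs (move i Go_Right) ((S (Suc j))(i := tp w (int j))) 1 (S' (Suc j))"
      by (simp add: S'_def add.commute)
    then show "runs (Seq c (move i Go_Right)) (S' j) (B + 1) (S' (Suc j))"
      unfolding S'_def[of j] by (rule runs_Seq[OF body[OF j]])
  qed (use i in \<open>simp add: S'_def scan_tp\<close>)
  moreover have "runs (rewind i) (S' (length w)) (2 * length w + 4) ((S' (length w))(i := tp w 0))"
    by (rule runs_rewind[OF i _ order_refl w]) (simp add: S'_def)
  ultimately have "runs (each i c) (S' 0) (length w * ((B + 1) + 1) + 1 + (2 * length w + 4)) ((S' (length w))(i := tp w 0))"
    unfolding each_def by (rule runs_Seq)
  moreover have "S' 0 = s" "(S' (length w))(i := tp w 0) = s'" by (simp_all add: S'_def s s')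
  ultimately show ?thesis by (simp only:) (rule runs_mono, assumption, simp add: algebra_simps)
qed

text \<open>The word is consumed from its right end, next to which the head of an appended tape
  stands. The body is assumed for any content \<open>t\<close> of the loop tape, as this content
  shrinks from round to round.\<close>

lemma runs_drain:
  assumes i: "i < 9" and a: "a \<noteq> 0"
    and body: "\<And>j t. j < m \<Longrightarrow> runs c ((S j)(i := t)) B ((S (Suc j))(i := t))"
    and s: "s = (S 0)(i := te (replicate m a))" and s': "s' = (S m)(i := te [])"
  shows "runs (drain i c) s (m * (B + 2) + 4) s'"
proof -
  define S' where "S' j = (S j)(i := tp (replicate (m - j) a) (int (m - j) - 1))" for j
  have 1: "runs (move i Go_Left) s 1 (S' 0)"
    using runs_move[where s = s and i = i and w = "replicate m a" and h = "int m" and d = Go_Left] i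
    by (simp add: s S'_def te_def)
  have 2: "runs (While (\<lambda>f. f i \<noteq> 0) (Seq c (Act i (\<lambda>_. 0) Go_Left))) (S' 0) (m * ((B + 1) + 1) + 1) (S' m)"
  proof (rule runs_While)
    fix j assume j: "j < m"
    define k where "k = m - Suc j"
    have k: "m - j = Suc k" "m - Suc j = k" using j by (auto simp: k_def)
    define t where "t = tp (replicate k a @ [a]) (int (length (replicate k a)))"
    have t: "(S j)(i := t) = S' j" by (simp add: S'_def t_def k replicate_append_same)
    show "scans 9 (S' j) i \<noteq> 0" using i a by (simp add: S'_def k scan_tp del: replicate_Suc)
    have "runs (Act i (\<lambda>_. 0) Go_Left) ((S (Suc j))(i := t)) 1 (((S (Suc j))(i := t))(i := act (0, Go_Left) t))"
      using runs_Act[of i "\<lambda>_. 0" Go_Left "(S (Suc j))(i := t)"] by simp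
    moreover have "((S (Suc j))(i := t))(i := act (0, Go_Left) t) = S' (Suc j)"
      unfolding t_def act_tp_last by (simp add: S'_def k)
    ultimately have "runs (Act i (\<lambda>_. 0) Go_Left) ((S (Suc j))(i := t)) 1 (S' (Suc j))" by (simp only:)
    from runs_Seq[OF body[OF j, of t] this] show "runs (Seq c (Act i (\<lambda>_. 0) Go_Left)) (S' j) (B + 1) (S' (Suc j))"
      unfolding t .
  qed (use i in \<open>simp add: S'_def scan_tp\<close>)
  have 3: "runs (move i Go_Right) (S' m) 1 s'"
    using runs_move[OF i, of "S' m" "[]" "-1" Go_Right] by (simp add: S'_def s' te_def)
  show ?thesis unfolding drain_def
    by (rule runs_mono, rule runs_seqs_Cons[OF 1 runs_seqs_Cons[OF 2 runs_seqs_Cons[OF 3 runs_seqs_Nil]]])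
      (simp add: algebra_simps)
qed

lemma runs_each_app:
  assumes ik: "i < 9" "i \<noteq> k" and s: "s i = tp w 0" "s k = te u" and w: "0 \<notin> set w"
  shows "runs (each i (app k (\<lambda>f. F (f i)))) s (5 * length w + 5) (s(k := te (u @ map F w)))"
proof -
  have "runs (each i (app k (\<lambda>f. F (f i)))) s (length w * (1 + 4) + 5) (s(k := te (u @ map F w)))"
  proof (rule runs_each[OF ik(1) w, where S = "\<lambda>j. s(k := te (u @ map F (take j w)))"])
    fix j assume j: "j < length w"
    have "runs (app k (\<lambda>f. F (f i))) (s(k := te (u @ map F (take j w)), i := tp w (int j))) 1
      ((s(k := te (u @ map F (take j w)), i := tp w (int j)))(k := te ((u @ map F (take j w)) @ [F (w ! j)])))"
      by (rule runs_app) (use ik j in \<open>auto simp: scan_tp\<close>)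
    then show "runs (app k (\<lambda>f. F (f i))) (s(k := te (u @ map F (take j w)), i := tp w (int j))) 1
      (s(k := te (u @ map F (take (Suc j) w)), i := tp w (int j)))"
      using ik j by (simp add: take_Suc_conv_app_nth fun_upd_twist)
  qed (use ik s in \<open>auto simp: fun_upd_twist\<close>)
  then show ?thesis by (rule runs_mono) simp
qed

text \<open>One step \<open>m := a + n * m\<close> of Horner's scheme in unary, with
  \<open>n\<close> the input length: the input is traversed once per symbol on \<open>A\<close>, and
  the product is moved back from \<open>C\<close>.\<close>

definition horner_step :: "nat \<Rightarrow> nat \<Rightarrow> nat \<Rightarrow> cmd" where
  "horner_step A C a = seqs [drain A (each 0 (app C (\<lambda>_. 1))), drain C (app A (\<lambda>_. 1)), seqs (replicate a (app A (\<lambda>_. 1)))]"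

fun unary_poly :: "nat \<Rightarrow> nat \<Rightarrow> nat list \<Rightarrow> cmd" where
  "unary_poly A C [] = skip"
| "unary_poly A C (a # as) = Seq (unary_poly A C as) (horner_step A C a)"

definition horner :: "nat list \<Rightarrow> nat \<Rightarrow> nat" where
  "horner as n = foldr (\<lambda>a m. a + n * m) as 0"

lemma poly_eq_horner: "poly p n = horner (coeffs p) n"
  by (simp add: poly_def horner_def horner_sum_foldr)

lemma runs_replicate_app:
  assumes "s A = te u"
  shows "runs (seqs (replicate a (app A (\<lambda>_. c)))) s (a + 1) (s(A := te (u @ replicate a c)))"
proof -
  have "runs (seqs (replicate a (app A (\<lambda>_. c)))) (s(A := te (u @ replicate 0 c)))
      (length (replicate a (app A (\<lambda>_. c))) * 1 + 1) (s(A := te (u @ replicate (length (replicate a (app A (\<lambda>_. c)))) c)))"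
  proof (rule runs_seqs)
    fix j assume "j < length (replicate a (app A (\<lambda>_. c)))"
    then have "replicate a (app A (\<lambda>_. c)) ! j = app A (\<lambda>_. c)" by simp
    moreover have "runs (app A (\<lambda>_. c)) (s(A := te (u @ replicate j c))) 1
       ((s(A := te (u @ replicate j c)))(A := te ((u @ replicate j c) @ [c])))"
      by (rule runs_app) simp_all
    ultimately show "runs (replicate a (app A (\<lambda>_. c)) ! j) (s(A := te (u @ replicate j c))) 1
       (s(A := te (u @ replicate (Suc j) c)))"
      by (simp add: replicate_append_same)
  qed
  moreover have "s(A := te (u @ replicate 0 c)) = s" using assms by auto
  ultimately show ?thesis by simp
qed

lemma runs_horner_step:
  assumes AC: "A < 9" "C < 9" "A \<noteq> C" "A \<noteq> 0" "C \<noteq> 0" and s: "s 0 = tp xs 0" "s A = te (replicate m 1)" "s C = te []"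
    and xs: "0 \<notin> set xs"
  shows "runs (horner_step A C a) s (20 * (m + 1) * (length xs + 1) + a) (s(A := te (replicate (a + length xs * m) 1)))"
proof -
  define n where "n = length xs"
  define s1 where "s1 = s(A := te [], C := te (replicate (m * n) 1))"
  have "runs (drain A (each 0 (app C (\<lambda>_. 1)))) s (m * ((5 * n + 5) + 2) + 4) s1"
  proof (rule runs_drain[OF AC(1), where a = 1 and S = "\<lambda>j. s(C := te (replicate (j * n) 1))"])
    fix j t
    have "runs (each 0 (app C (\<lambda>f. (\<lambda>_. 1) (f 0)))) (s(C := te (replicate (j * n) 1), A := t)) (5 * length xs + 5)
      ((s(C := te (replicate (j * n) 1), A := t))(C := te (replicate (j * n) 1 @ map (\<lambda>_. 1) xs)))"
      by (rule runs_each_app) (use AC s xs in auto)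
    moreover have "replicate (j * n) (1::nat) @ map (\<lambda>_. 1) xs = replicate (Suc j * n) 1"
      by (simp add: map_replicate_const n_def replicate_add[symmetric] add.commute)
    ultimately show "runs (each 0 (app C (\<lambda>_. 1))) (s(C := te (replicate (j * n) 1), A := t)) (5 * n + 5)
      (s(C := te (replicate (Suc j * n) 1), A := t))"
      using AC by (simp add: fun_upd_twist n_def)
  qed (use AC s in \<open>auto simp: s1_def fun_upd_idem fun_upd_twist\<close>)
  note 1 = this
  define s2 where "s2 = s(A := te (replicate (m * n) 1))"
  have "runs (drain C (app A (\<lambda>_. 1))) s1 (m * n * (1 + 2) + 4) s2"
  proof (rule runs_drain[OF AC(2), where a = 1 and S = "\<lambda>j. s(A := te (replicate j 1))"])
    fix j t
    have "runs (app A (\<lambda>_. 1)) (s(A := te (replicate j 1), C := t)) 1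
      ((s(A := te (replicate j 1), C := t))(A := te (replicate j 1 @ [1])))"
      by (rule runs_app) (use AC in auto)
    then show "runs (app A (\<lambda>_. 1)) (s(A := te (replicate j 1), C := t)) 1 (s(A := te (replicate (Suc j) 1), C := t))"
      using AC by (simp add: fun_upd_twist replicate_append_same)
  qed (use AC s in \<open>auto simp: s1_def s2_def fun_upd_idem fun_upd_twist\<close>)
  note 2 = this
  have "runs (seqs (replicate a (app A (\<lambda>_. 1)))) s2 (a + 1) (s2(A := te (replicate (m * n) 1 @ replicate a 1)))"
    by (rule runs_replicate_app) (simp add: s2_def)
  then have 3: "runs (seqs (replicate a (app A (\<lambda>_. 1)))) s2 (a + 1) (s(A := te (replicate (a + n * m) 1)))"
    by (simp add: s2_def replicate_add[symmetric] ac_simps)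
  show ?thesis unfolding horner_step_def n_def[symmetric]
    by (rule runs_mono, rule runs_seqs_Cons[OF 1 runs_seqs_Cons[OF 2 runs_seqs_Cons[OF 3 runs_seqs_Nil]]]) (simp add: algebra_simps)
qed

definition poly_bounded :: "(nat \<Rightarrow> nat) \<Rightarrow> bool" where
  "poly_bounded f \<longleftrightarrow> (\<exists>T :: nat poly. \<forall>n. f n \<le> poly T n)"

named_theorems poly_bounded_intros

lemma poly_bounded_const [poly_bounded_intros]: "poly_bounded (\<lambda>n. c)"
  unfolding poly_bounded_def by (intro exI[of _ "[:c:]"]) simp

lemma poly_bounded_id [poly_bounded_intros]: "poly_bounded (\<lambda>n. n)"
  unfolding poly_bounded_def by (intro exI[of _ "[:0, 1:]"]) simp

lemma poly_bounded_add [poly_bounded_intros]: "poly_bounded f \<Longrightarrow> poly_bounded g \<Longrightarrow> poly_bounded (\<lambda>n. f n + g n)"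
  unfolding poly_bounded_def by (metis add_mono poly_add)

lemma poly_bounded_mult [poly_bounded_intros]: "poly_bounded f \<Longrightarrow> poly_bounded g \<Longrightarrow> poly_bounded (\<lambda>n. f n * g n)"
  unfolding poly_bounded_def by (metis mult_le_mono poly_mult)

lemma poly_bounded_horner [poly_bounded_intros]: "poly_bounded (\<lambda>n. horner as n)"
proof (induction as)
  case Nil
  show ?case by (simp add: horner_def poly_bounded_const)
next
  case (Cons a as)
  have "poly_bounded (\<lambda>n. a + n * horner as n)" by (intro poly_bounded_intros Cons)
  then show ?case by (simp add: horner_def)
qed

lemma runs_unary_poly:
  assumes AC: "A < 9" "C < 9" "A \<noteq> C" "A \<noteq> 0" "C \<noteq> 0"
  shows "\<exists>f. poly_bounded f \<and> (\<forall>s xs. s 0 = tp xs 0 \<longrightarrow> s A = te [] \<longrightarrow> s C = te [] \<longrightarrow> 0 \<notin> set xs \<longrightarrow>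
    runs (unary_poly A C as) s (f (length xs)) (s(A := te (replicate (horner as (length xs)) 1))))"
proof (induction as)
  case Nil
  show ?case
    by (intro exI[of _ "\<lambda>_. 1"]) (auto simp: horner_def poly_bounded_const fun_upd_idem intro: runs_skip[unfolded One_nat_def])
next
  case (Cons a as)
  then obtain f where f: "poly_bounded f" "\<And>s xs. s 0 = tp xs 0 \<Longrightarrow> s A = te [] \<Longrightarrow> s C = te [] \<Longrightarrow> 0 \<notin> set xs \<Longrightarrow>
    runs (unary_poly A C as) s (f (length xs)) (s(A := te (replicate (horner as (length xs)) 1)))"
    by blast
  define g where "g n = 20 * (horner as n + 1) * (n + 1) + a" for n
  have "runs (unary_poly A C (a # as)) s (f (length xs) + g (length xs)) (s(A := te (replicate (horner (a # as) (length xs)) 1)))"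
    if s: "s 0 = tp xs 0" "s A = te []" "s C = te []" and xs: "0 \<notin> set xs" for s xs
  proof -
    define s1 where "s1 = s(A := te (replicate (horner as (length xs)) 1))"
    have "runs (horner_step A C a) s1 (g (length xs)) (s1(A := te (replicate (a + length xs * horner as (length xs)) 1)))"
      unfolding g_def by (rule runs_horner_step) (use AC s xs in \<open>auto simp: s1_def\<close>)
    then have 2: "runs (horner_step A C a) s1 (g (length xs)) (s(A := te (replicate (horner (a # as) (length xs)) 1)))"
      by (simp add: s1_def horner_def)
    have 1: "runs (unary_poly A C as) s (f (length xs)) s1" unfolding s1_def by (rule f(2)[OF s xs])
    show ?thesis unfolding unary_poly.simps by (rule runs_Seq[OF 1 2])
  qed
  moreover have "poly_bounded (\<lambda>n. f n + g n)" unfolding g_def by (intro poly_bounded_intros f(1))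
  ultimately show ?case by blast
qed

text \<open>An input bit becomes two columns: the announcing \<open>True\<close>, with code 4, and
  the bit itself. The 3 after this loop is the final \<open>False\<close> of
  \<open>enc_bits\<close>.\<close>

definition build_columns :: cmd where
  "build_columns = seqs [app 2 (\<lambda>_. 1), each 4 (app 2 (\<lambda>_. 2)), app 2 (\<lambda>_. 2),
     each 0 (Seq (app 2 (\<lambda>_. 4)) (app 2 (\<lambda>f. if f 0 = 2 then 4 else 3))), app 2 (\<lambda>_. 3),
     each 3 (app 2 (\<lambda>_. 5)), each 4 (app 2 (\<lambda>_. 6)), each 3 (app 2 (\<lambda>_. 6)), app 2 (\<lambda>_. 6), app 2 (\<lambda>_. 6), rewind 2]"

lemma bit_symbols_nonzero: "0 \<notin> set (map bit_symbol x)"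
  by (auto simp: bit_symbol_def)

lemma columns_nonzero: "0 \<notin> set (columns B q x)"
  by (auto simp: columns_def)

lemma cells_nonzero: "0 \<notin> set (cells B q x)"
  by (auto simp: cells_def columns_nonzero)

lemma runs_app2: "runs (app k (\<lambda>_. a)) (s(k := te u)) 1 (s(k := te (u @ [a])))"
  using runs_app[of "s(k := te u)" k u "\<lambda>_. a" a] by simp

lemma runs_each_app2:
  assumes "i < 9" "i \<noteq> k" "s i = tp w 0" "0 \<notin> set w"
  shows "runs (each i (app k (\<lambda>_. a))) (s(k := te u)) (5 * length w + 5) (s(k := te (u @ replicate (length w) a)))"
  using runs_each_app[of i k "s(k := te u)" w u "\<lambda>_. a"] assms by (simp add: map_replicate_const)

lemma runs_build_columns:
  assumes s: "s 0 = tp (map bit_symbol x) 0" "s 2 = tp [] 0" "s 3 = tp (replicate q 1) 0" "s 4 = tp (replicate B 1) 0"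
  shows "runs build_columns s (50 * (B + q + length x + 2)) (s(2 := tp (columns B q x) 0))"
proof -
  define S where "S u = s(2 := te u)" for u
  let ?b = "\<lambda>b. if b then 4 else 3 :: nat"
  define u where "u = [] @ [1] @ replicate B 2 @ [2] @ concat (map (\<lambda>b. [4, ?b b]) x) @ [3] @ replicate q 5 @ replicate B 6
     @ replicate q 6 @ [6] @ [6 :: nat]"
  have "s = S []" using s(2) by (auto simp: S_def blank_tape)
  have a: "runs (app 2 (\<lambda>_. a)) (S u) 1 (S (u @ [a]))" for a u
    unfolding S_def by (rule runs_app2)
  have e4: "runs (each 4 (app 2 (\<lambda>_. a))) (S u) (5 * B + 5) (S (u @ replicate B a))" for a u
    using runs_each_app2[of 4 2 s "replicate B 1" a u] s unfolding S_def by simp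
  have e3: "runs (each 3 (app 2 (\<lambda>_. a))) (S u) (5 * q + 5) (S (u @ replicate q a))" for a u
    using runs_each_app2[of 3 2 s "replicate q 1" a u] s unfolding S_def by simp
  have e0: "runs (each 0 (Seq (app 2 (\<lambda>_. 4)) (app 2 (\<lambda>f. if f 0 = 2 then 4 else 3)))) (S u)
      (length (map bit_symbol x) * (2 + 4) + 5) (S (u @ concat (map (\<lambda>b. [4, ?b b]) x)))" for u
  proof (rule runs_each[OF _ bit_symbols_nonzero, where S = "\<lambda>j. S (u @ concat (map (\<lambda>b. [4, ?b b]) (take j x)))"])
    fix j assume j: "j < length (map bit_symbol x)"
    define v where "v = u @ concat (map (\<lambda>b. [4, ?b b]) (take j x))"
    define T where "T w = (S w)(0 := tp (map bit_symbol x) (int j))" for w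
    have 1: "runs (app 2 (\<lambda>_. 4)) (T v) 1 (T (v @ [4]))"
      using runs_app[of "T v" 2 v "\<lambda>_. 4" 4] by (simp add: T_def S_def fun_upd_twist)
    have "bit_symbol (x ! j) = 2 \<longleftrightarrow> x ! j" by (simp add: bit_symbol_def)
    then have 2: "runs (app 2 (\<lambda>f. if f 0 = 2 then 4 else 3)) (T (v @ [4])) 1 (T ((v @ [4]) @ [?b (x ! j)]))"
      using runs_app[of "T (v @ [4])" 2 "v @ [4]" "\<lambda>f. if f 0 = 2 then 4 else 3" "?b (x ! j)"] j
      by (simp add: T_def S_def fun_upd_twist scan_tp)
    have "(v @ [4]) @ [?b (x ! j)] = u @ concat (map (\<lambda>b. [4, ?b b]) (take (Suc j) x))"
      using j by (simp add: v_def take_Suc_conv_app_nth)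
    then show "runs (Seq (app 2 (\<lambda>_. 4)) (app 2 (\<lambda>f. if f 0 = 2 then 4 else 3)))
       ((S (u @ concat (map (\<lambda>b. [4, ?b b]) (take j x))))(0 := tp (map bit_symbol x) (int j))) 2
       ((S (u @ concat (map (\<lambda>b. [4, ?b b]) (take (Suc j) x))))(0 := tp (map bit_symbol x) (int j)))"
      using runs_Seq[OF 1 2] unfolding T_def v_def[symmetric] by (simp only: one_add_one)
  qed (use s in \<open>auto simp: S_def fun_upd_idem fun_upd_twist\<close>)
  have "replicate (Suc B) (2::nat) = replicate B 2 @ [2]"
    by (simp add: replicate_append_same)
  moreover have "replicate (B + q + 2) (6::nat) = replicate B 6 @ replicate q 6 @ [6] @ [6]"
    by (simp only: replicate_add) (simp add: numeral_2_eq_2)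
  moreover have "map ?b (enc_bits x) = concat (map (\<lambda>b. [4, ?b b]) x) @ [3]"
    by (induction x) (auto simp: enc_bits_def)
  ultimately have u: "u = columns B q x" unfolding u_def columns_def by simp
  have "runs (rewind 2) (S u) (2 * length u + 4) ((S u)(2 := tp u 0))"
    by (rule runs_rewind) (use columns_nonzero in \<open>auto simp: S_def te_def u\<close>)
  then have r: "runs (rewind 2) (S u) (2 * length u + 4) (s(2 := tp u 0))" by (simp add: S_def)
  have lu: "length u = 2 * B + 2 * length x + 2 * q + 5" unfolding u by (rule length_columns)
  show ?thesis unfolding build_columns_def u[symmetric] \<open>s = S []\<close>
    by (rule runs_cong, rule runs_seqs_Cons[OF a runs_seqs_Cons[OF e4 runs_seqs_Cons[OF a runs_seqs_Cons[OF e0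
      runs_seqs_Cons[OF a runs_seqs_Cons[OF e3 runs_seqs_Cons[OF e4 runs_seqs_Cons[OF e3
      runs_seqs_Cons[OF a runs_seqs_Cons[OF a runs_seqs_Cons[OF r[unfolded u_def append_assoc[symmetric]] runs_seqs_Nil]]]]]]]]]]])
      (use lu in \<open>simp_all add: u_def S_def\<close>)
qed

definition build_cells :: cmd where
  "build_cells = seqs [each 2 (app 6 (\<lambda>f. f 2)), each 4 (each 2 (app 6 (\<lambda>_. 7))), each 2 (app 6 (\<lambda>_. 8)), rewind 6,
     each 6 (app 7 (\<lambda>f. f 6)), rewind 7]"

lemma runs_build_cells:
  assumes s: "s 2 = tp (columns B q x) 0" "s 4 = tp (replicate B 1) 0" "s 6 = te []" "s 7 = te []"
    and W: "W = length (columns B q x)"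
  shows "runs build_cells s (50 * (B + 1) * (W + 1)) (s(6 := tp (cells B q x) 0, 7 := tp (cells B q x) 0))"
proof -
  define S where "S u = s(6 := te u)" for u
  define c where "c = columns B q x"
  define us where "us = cells B q x"
  note nz = columns_nonzero[of B q x, folded c_def] cells_nonzero[of B q x, folded us_def]
  have 1: "runs (each 2 (app 6 (\<lambda>f. f 2))) s (5 * W + 5) (S c)"
    using runs_each_app[of 2 6 s c "[]" "\<lambda>a. a"] s nz unfolding S_def W c_def by simp
  have e: "runs (each 2 (app 6 (\<lambda>_. a))) (s'(6 := te u)) (5 * W + 5) (s'(6 := te (u @ replicate W a)))" if "s' 2 = s 2" for a u s'
    using runs_each_app2[of 2 6 s' c a u] s nz that unfolding W c_def by simp
  have "runs (each 4 (each 2 (app 6 (\<lambda>_. 7)))) (S c) (length (replicate B (1::nat)) * ((5 * W + 5) + 4) + 5) (S (c @ replicate (B * W) 7))"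
  proof (rule runs_each[where S = "\<lambda>j. S (c @ replicate (j * W) 7)"])
    fix j
    have "(c @ replicate (j * W) 7) @ replicate W 7 = c @ replicate (Suc j * W) (7::nat)"
      by (simp add: replicate_add[symmetric] add.commute)
    then show "runs (each 2 (app 6 (\<lambda>_. 7))) ((S (c @ replicate (j * W) 7))(4 := tp (replicate B 1) (int j))) (5 * W + 5)
      ((S (c @ replicate (Suc j * W) 7))(4 := tp (replicate B 1) (int j)))"
      using e[where s' = "s(4 := tp (replicate B 1) (int j))" and u = "c @ replicate (j * W) 7" and a = 7]
      by (simp add: S_def fun_upd_twist)
  qed (use s in \<open>auto simp: S_def fun_upd_idem fun_upd_twist\<close>)
  note 2 = this
  have 3: "runs (each 2 (app 6 (\<lambda>_. 8))) (S (c @ replicate (B * W) 7)) (5 * W + 5) (S us)"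
    using e[where s' = s and u = "c @ replicate (B * W) 7" and a = 8] by (simp add: S_def us_def cells_def c_def W)
  have len: "length us = (B + 2) * W" by (simp add: us_def length_cells W)
  have "runs (rewind 6) (S us) (2 * length us + 4) ((S us)(6 := tp us 0))"
    by (rule runs_rewind) (use nz in \<open>auto simp: S_def te_def\<close>)
  then have 4: "runs (rewind 6) (S us) (2 * length us + 4) (s(6 := tp us 0))" by (simp add: S_def)
  have 5: "runs (each 6 (app 7 (\<lambda>f. f 6))) (s(6 := tp us 0)) (5 * length us + 5) (s(6 := tp us 0, 7 := te us))"
    using runs_each_app[of 6 7 "s(6 := tp us 0)" us "[]" "\<lambda>a. a"] s nz by simp
  have "runs (rewind 7) (s(6 := tp us 0, 7 := te us)) (2 * length us + 4) (s(6 := tp us 0, 7 := te us, 7 := tp us 0))"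
    by (rule runs_rewind) (use nz in \<open>auto simp: te_def\<close>)
  then have 6: "runs (rewind 7) (s(6 := tp us 0, 7 := te us)) (2 * length us + 4) (s(6 := tp us 0, 7 := tp us 0))" by simp
  show ?thesis unfolding build_cells_def us_def[symmetric]
    by (rule runs_mono, rule runs_seqs_Cons[OF 1 runs_seqs_Cons[OF 2 runs_seqs_Cons[OF 3 runs_seqs_Cons[OF 4
      runs_seqs_Cons[OF 5 runs_seqs_Cons[OF 6 runs_seqs_Nil]]]]]]) (simp add: len algebra_simps)
qed

text \<open>Tape 8 becomes a table indexed by the difference of two cell numbers. Its head is moved
  along with the heads on the two copies of the cells, so the relation between the two cells is a
  scanned symbol and no distance is ever computed.\<close>

definition build_marks :: cmd where
  "build_marks = seqs [Act 8 (\<lambda>_. 1) Stay, each 2 (move 8 Go_Right), Act 8 (\<lambda>_. 4) Stay, each 2 (move 8 Go_Left), each 2 (move 8 Go_Left),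
     Act 8 (\<lambda>_. 5) Stay, each 2 (move 8 Go_Right), move 8 Go_Right, Act 8 (\<lambda>_. 2) Go_Left, move 8 Go_Left, Act 8 (\<lambda>_. 3) Go_Right]"

lemma runs_move_gen: "i < 9 \<Longrightarrow> s i = (c, h) \<Longrightarrow> runs (move i d) s 1 (s(i := (c, h + dir_offset d)))"
  using runs_Act[of i "\<lambda>f. f i" d s] by (simp add: move_def)

lemma runs_each_move:
  assumes "i < 9" "k < 9" "i \<noteq> k" "s i = tp w 0" "0 \<notin> set w" "s k = (c, h)"
  shows "runs (each i (move k d)) s (5 * length w + 5) (s(k := (c, h + int (length w) * dir_offset d)))"
proof -
  have "runs (each i (move k d)) s (length w * (1 + 4) + 5) (s(k := (c, h + int (length w) * dir_offset d)))"
  proof (rule runs_each[OF assms(1,5), where S = "\<lambda>j. s(k := (c, h + int j * dir_offset d))"])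
    fix j
    have "runs (move k d) (s(k := (c, h + int j * dir_offset d), i := tp w (int j))) 1
       (s(k := (c, h + int j * dir_offset d), i := tp w (int j), k := (c, h + int j * dir_offset d + dir_offset d)))"
      by (rule runs_move_gen) (use assms in auto)
    then show "runs (move k d) (s(k := (c, h + int j * dir_offset d), i := tp w (int j))) 1
       (s(k := (c, h + int (Suc j) * dir_offset d), i := tp w (int j)))"
      using assms by (simp add: fun_upd_twist algebra_simps)
  qed (use assms in \<open>auto simp: fun_upd_twist fun_upd_idem\<close>)
  then show ?thesis by (rule runs_mono) simp
qed

lemma runs_build_marks:
  assumes s: "s 2 = tp w 0" "s 8 = tp [] 0" and w: "0 \<notin> set w" "2 \<le> length w"
  shows "runs build_marks s (20 * length w + 50) (s(8 := (mark (length w), 0)))"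
proof -
  define W where "W = int (length w)"
  have a: "runs (Act 8 (\<lambda>_. a) d) (s(8 := (c, h))) 1 (s(8 := (c(h := a), h + dir_offset d)))" for a d c h
    using runs_Act[of 8 "\<lambda>_. a" d "s(8 := (c, h))"] by simp
  have m: "runs (move 8 d) (s(8 := (c, h))) 1 (s(8 := (c, h + dir_offset d)))" for d c h
    using runs_move_gen[of 8 "s(8 := (c, h))" c h d] by simp
  have e: "runs (each 2 (move 8 d)) (s(8 := (c, h))) (5 * length w + 5) (s(8 := (c, h + W * dir_offset d)))" for d c h
    using runs_each_move[of 2 8 "s(8 := (c, h))" w c h d] s w by (simp add: W_def)
  have s8: "s = s(8 := ((\<lambda>_. 0), 0))" unfolding blank_tape(1) using s(2) by (simp add: fun_upd_idem)
  have mark: "mark (length w) = (\<lambda>_. 0)(0 := 1, W := 4, - W := 5, 1 := 2, - 1 := 3)"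
    using w(2) by (auto simp: fun_eq_iff mark_def W_def)
  show ?thesis unfolding build_marks_def
    by (subst s8, rule runs_cong, rule runs_seqs_Cons[OF a runs_seqs_Cons[OF e runs_seqs_Cons[OF a runs_seqs_Cons[OF e
      runs_seqs_Cons[OF e runs_seqs_Cons[OF a runs_seqs_Cons[OF e runs_seqs_Cons[OF m
      runs_seqs_Cons[OF a runs_seqs_Cons[OF m runs_seqs_Cons[OF a runs_seqs_Nil]]]]]]]]]]])
      (use mark in \<open>simp_all\<close>)
qed

section \<open>Counting in binary\<close>

fun bits_Suc :: "bool list \<Rightarrow> bool list" where
  "bits_Suc [] = [True]"
| "bits_Suc (False # bs) = True # bs"
| "bits_Suc (True # bs) = False # bits_Suc bs"

lemma nat_bits_Suc: "nat_bits (Suc m) = bits_Suc (nat_bits m)"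
proof (induction m rule: less_induct)
  case (less m)
  consider "m = 0" | "m \<noteq> 0" "even m" | "odd m" by blast
  then show ?case
  proof cases
    case 1
    then show ?thesis by (simp add: nat_bits.simps)
  next
    case 2
    then show ?thesis by (simp add: nat_bits.simps[of m] nat_bits.simps[of "Suc m"])
  next
    case 3
    then have "m div 2 < m" "Suc m div 2 = Suc (m div 2)" "m \<noteq> 0" by presburger+
    then show ?thesis using less[of "m div 2"] 3
      by (simp add: nat_bits.simps[of m] nat_bits.simps[of "Suc m"])
  qed
qed

text \<open>The carry runs through the initial block of \<open>True\<close> and stops at the first
  \<open>False\<close> or at the end, where a new digit arises. The loop of \<open>increment\<close>
  is this block.\<close>

lemma bits_Suc_decomp:
  "\<exists>j r. bs = replicate j True @ r \<and> (r = [] \<or> (\<exists>r'. r = False # r')) \<and> bits_Suc bs = replicate j False @ True # tl r"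
proof (induction bs rule: bits_Suc.induct)
  case 1
  show ?case by (intro exI[of _ 0] exI[of _ "[]"]) simp
next
  case (2 bs)
  show ?case by (intro exI[of _ 0] exI[of _ "False # bs"]) simp
next
  case (3 bs)
  then obtain j r where "bs = replicate j True @ r" "r = [] \<or> (\<exists>r'. r = False # r')" "bits_Suc bs = replicate j False @ True # tl r"
    by blast
  then show ?case by (intro exI[of _ "Suc j"] exI[of _ r]) simp
qed

lemma length_nat_bits: "length (nat_bits m) \<le> m"
proof (induction m)
  case 0
  then show ?case by (simp add: nat_bits.simps)
next
  case (Suc m)
  have "length (bits_Suc bs) \<le> Suc (length bs)" for bs
    by (induction bs rule: bits_Suc.induct) auto
  from this[of "nat_bits m"] show ?case using Suc by (simp add: nat_bits_Suc)
qed

definition increment :: cmd where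
  "increment = seqs [While (\<lambda>f. f 5 = 2) (Act 5 (\<lambda>_. 1) Go_Right), Act 5 (\<lambda>_. 2) Stay, rewind 5]"

lemma runs_increment:
  assumes s: "s 5 = tp (map bit_symbol bs) 0"
  shows "runs increment s (5 * length bs + 10) (s(5 := tp (map bit_symbol (bits_Suc bs)) 0))"
proof -
  obtain j r where bs: "bs = replicate j True @ r" and r: "r = [] \<or> (\<exists>r'. r = False # r')"
    and Suc: "bits_Suc bs = replicate j False @ True # tl r" using bits_Suc_decomp by blast
  define S where "S i = s(5 := tp (replicate i 1 @ replicate (j - i) 2 @ map bit_symbol r) (int i))" for i
  have "runs (While (\<lambda>f. f 5 = 2) (Act 5 (\<lambda>_. 1) Go_Right)) (S 0) (j * (1 + 1) + 1) (S j)"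
  proof (rule runs_While)
    fix i assume i: "i < j"
    show "scans 9 (S i) 5 = 2" using i by (simp add: S_def scan_tp nth_append)
    obtain m where m: "j - i = Suc m" using i by (metis Suc_diff_Suc)
    have S: "S i 5 = tp (replicate i 1 @ replicate (j - i) 2 @ map bit_symbol r) (int i)" by (simp add: S_def)
    have lst: "(replicate i 1 @ replicate (j - i) 2 @ map bit_symbol r)[i := 1] = replicate (Suc i) 1 @ replicate (j - Suc i) 2 @ map bit_symbol r"
      using m by (simp add: list_update_append replicate_app_Cons_same)
    have "act (1, Go_Right) (S i 5) = tp (replicate (Suc i) 1 @ replicate (j - Suc i) 2 @ map bit_symbol r) (int (Suc i))"
      unfolding S lst[symmetric] using i by (subst act_tp) (simp_all add: add.commute)
    then show "runs (Act 5 (\<lambda>_. 1) Go_Right) (S i) 1 (S (Suc i))"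
      using runs_Act[of 5 "\<lambda>_. 1" Go_Right "S i"] by (simp add: S_def)
  next
    show "\<not> scans 9 (S j) 5 = 2" using r by (auto simp: S_def scan_tp nth_append bit_symbol_def)
  qed
  moreover have "S 0 = s" using s by (auto simp: S_def bs bit_symbol_def)
  ultimately have 1: "runs (While (\<lambda>f. f 5 = 2) (Act 5 (\<lambda>_. 1) Go_Right)) s (j * (1 + 1) + 1) (S j)" by simp
  define w where "w = map bit_symbol (bits_Suc bs)"
  have "act (2, Stay) (S j 5) = tp w (int j)"
  proof (cases "r = []")
    case True
    then show ?thesis by (auto simp: S_def w_def Suc tp_def fun_eq_iff nth_append bit_symbol_def)
  next
    case False
    then obtain r' where r': "r = False # r'" using r by blast
    show ?thesis unfolding S_def fun_upd_same
      by (subst act_tp) (simp_all add: r' w_def Suc bit_symbol_def list_update_append)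
  qed
  then have 2: "runs (Act 5 (\<lambda>_. 2) Stay) (S j) 1 (s(5 := tp w (int j)))"
    using runs_Act[of 5 "\<lambda>_. 2" Stay "S j"] by (simp add: S_def)
  have "runs (rewind 5) (s(5 := tp w (int j))) (2 * j + 4) (s(5 := tp w (int j), 5 := tp w 0))"
    by (rule runs_rewind) (auto simp: w_def Suc bit_symbol_def)
  then have 3: "runs (rewind 5) (s(5 := tp w (int j))) (2 * j + 4) (s(5 := tp w 0))" by simp
  show ?thesis unfolding increment_def w_def[symmetric]
    by (rule runs_mono, rule runs_seqs_Cons[OF 1 runs_seqs_Cons[OF 2 runs_seqs_Cons[OF 3 runs_seqs_Nil]]])
      (simp add: bs)
qed

text \<open>The dimension \<open>Suc (Suc (length us) * k)\<close> is counted as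
  \<open>Suc k\<close> for flag and palette plus \<open>k\<close> for each cell.\<close>

definition counter :: "nat \<Rightarrow> cmd" where
  "counter k = seqs [seqs (replicate (Suc k) increment), each 6 (seqs (replicate k increment))]"

lemma runs_increments:
  assumes "m + k \<le> F"
  shows "runs (seqs (replicate k increment)) (s(5 := tp (map bit_symbol (nat_bits m)) 0)) (k * (5 * F + 10) + 1)
    (s(5 := tp (map bit_symbol (nat_bits (m + k))) 0))"
proof -
  define S where "S j = s(5 := tp (map bit_symbol (nat_bits (m + j))) 0)" for j
  have "runs (seqs (replicate k increment)) (S 0) (length (replicate k increment) * (5 * F + 10) + 1) (S (length (replicate k increment)))"
  proof (rule runs_seqs)
    fix j assume "j < length (replicate k increment)"
    then have j: "replicate k increment ! j = increment" "m + j \<le> F" using assms by auto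
    have le: "5 * length (nat_bits (m + j)) + 10 \<le> 5 * F + 10" using length_nat_bits[of "m + j"] j(2) by linarith
    have "runs increment (S j) (5 * length (nat_bits (m + j)) + 10) ((S j)(5 := tp (map bit_symbol (bits_Suc (nat_bits (m + j)))) 0))"
      by (rule runs_increment) (simp add: S_def)
    from runs_mono[OF this le] show "runs (replicate k increment ! j) (S j) (5 * F + 10) (S (Suc j))"
      unfolding j(1) by (simp add: S_def nat_bits_Suc)
  qed
  then show ?thesis by (simp add: S_def)
qed

lemma runs_counter:
  assumes s: "s 5 = tp [] 0" "s 6 = tp us 0" and us: "0 \<notin> set us" and F: "F = Suc (Suc (length us) * k)"
  shows "runs (counter k) s ((length us + 2) * (Suc k * (5 * F + 10) + 10))
    (s(5 := tp (map bit_symbol (nat_bits F)) 0))"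
proof -
  define S where "S m = s(5 := tp (map bit_symbol (nat_bits m)) 0)" for m
  have nb: "nat_bits 0 = []" by (simp add: nat_bits.simps)
  have s0: "s = S 0" using s(1) by (auto simp: S_def nb)
  have 1: "runs (seqs (replicate (Suc k) increment)) s (Suc k * (5 * F + 10) + 1) (S (Suc k))"
  proof -
    have "runs (seqs (replicate (Suc k) increment)) (S 0) (Suc k * (5 * F + 10) + 1) (S (0 + Suc k))"
      unfolding S_def by (rule runs_increments) (simp add: F)
    then show ?thesis by (simp only: s0[symmetric] add_0)
  qed
  have "runs (each 6 (seqs (replicate k increment))) (S (Suc k)) (length us * ((k * (5 * F + 10) + 1) + 4) + 5) (S F)"
  proof (rule runs_each[OF _ us, where S = "\<lambda>j. S (Suc k + j * k)"])
    fix j assume j: "j < length us"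
    then have "Suc j * k \<le> length us * k" by (intro mult_le_mono1) simp
    then have "Suc k + j * k + k \<le> F" unfolding F by simp
    from runs_increments[OF this, of "s(6 := tp us (int j))"]
    show "runs (seqs (replicate k increment)) ((S (Suc k + j * k))(6 := tp us (int j))) (k * (5 * F + 10) + 1)
      ((S (Suc k + Suc j * k))(6 := tp us (int j)))"
      by (simp add: S_def fun_upd_twist algebra_simps)
  qed (use s in \<open>auto simp: S_def F fun_upd_twist fun_upd_idem\<close>)
  note 2 = this
  show ?thesis unfolding counter_def S_def[symmetric]
    by (rule runs_mono, rule runs_seqs_Cons[OF 1 runs_seqs_Cons[OF 2 runs_seqs_Nil]]) (simp add: algebra_simps)
qed

definition out :: "(nat \<Rightarrow> tape) \<Rightarrow> bool list \<Rightarrow> nat \<Rightarrow> tape" where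
  "out s o' = s(1 := te (map bit_symbol o'))"

lemma out_nth [simp]: "j \<noteq> 1 \<Longrightarrow> out s w j = s j"
  by (simp add: out_def)

lemma out_upd: "j \<noteq> 1 \<Longrightarrow> (out s w)(j := t) = out (s(j := t)) w"
  by (simp add: out_def fun_upd_twist)

definition outs :: "((nat \<Rightarrow> nat) \<Rightarrow> bool) list \<Rightarrow> cmd" where
  "outs gs = seqs (map (\<lambda>g. app 1 (\<lambda>f. bit_symbol (g f))) gs)"

text \<open>The tests must not look at tape 1, so they can all be evaluated in \<open>s\<close>,
  whose own tape 1 is hidden by \<open>out\<close>.\<close>

lemma runs_outs:
  assumes "\<And>g f f'. g \<in> set gs \<Longrightarrow> (\<And>j. j \<noteq> 1 \<Longrightarrow> f j = f' j) \<Longrightarrow> g f = g f'"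
  shows "runs (outs gs) (out s w) (length gs + 1) (out s (w @ map (\<lambda>g. g (scans 9 s)) gs))"
proof -
  define S where "S j = out s (w @ map (\<lambda>g. g (scans 9 s)) (take j gs))" for j
  have "runs (seqs (map (\<lambda>g. app 1 (\<lambda>f. bit_symbol (g f))) gs)) (S 0) (length (map (\<lambda>g. app 1 (\<lambda>f. bit_symbol (g f))) gs) * 1 + 1)
     (S (length (map (\<lambda>g. app 1 (\<lambda>f. bit_symbol (g f))) gs)))"
  proof (rule runs_seqs)
    fix j assume "j < length (map (\<lambda>g. app 1 (\<lambda>f. bit_symbol (g f))) gs)"
    then have j: "j < length gs" by simp
    define v where "v = w @ map (\<lambda>g. g (scans 9 s)) (take j gs)"
    have "(gs ! j) (scans 9 (out s v)) = (gs ! j) (scans 9 s)"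
    proof (rule assms[of "gs ! j"])
      show "gs ! j \<in> set gs" using j by simp
      show "scans 9 (out s v) i = scans 9 s i" if "i \<noteq> 1" for i using that by (simp add: scans_def out_def)
    qed
    then have "runs (app 1 (\<lambda>f. bit_symbol ((gs ! j) f))) (out s v) 1
      ((out s v)(1 := te (map bit_symbol v @ [bit_symbol ((gs ! j) (scans 9 s))])))"
      by (intro runs_app) (simp_all add: out_def)
    then show "runs (map (\<lambda>g. app 1 (\<lambda>f. bit_symbol (g f))) gs ! j) (S j) 1 (S (Suc j))"
      using j by (simp add: S_def v_def out_def take_Suc_conv_app_nth)
  qed
  then show ?thesis by (simp add: outs_def S_def)
qed

definition enc_body :: "bool list \<Rightarrow> bool list" where
  "enc_body bs = concat (map (\<lambda>b. [True, b]) bs)"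

lemma enc_body_append: "enc_body (xs @ ys) = enc_body xs @ enc_body ys"
  by (simp add: enc_body_def)

lemma enc_bits_eq: "enc_bits bs = enc_body bs @ [False]"
  by (simp add: enc_bits_def enc_body_def)

definition header :: cmd where
  "header = Seq (each 5 (outs [\<lambda>_. True, \<lambda>f. f 5 = 2])) (app 1 (\<lambda>_. 1))"

lemma runs_header:
  assumes s: "s 5 = tp (map bit_symbol bs) 0"
  shows "runs header (out s w) (10 * length bs + 10) (out s (w @ enc_bits bs))"
proof -
  have "runs (each 5 (outs [\<lambda>_. True, \<lambda>f. f 5 = 2])) (out s w) (length (map bit_symbol bs) * (3 + 4) + 5) (out s (w @ enc_body bs))"
  proof (rule runs_each[OF _ bit_symbols_nonzero, where S = "\<lambda>j. out s (w @ enc_body (take j bs))"])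
    fix j assume j: "j < length (map bit_symbol bs)"
    define T where "T = s(5 := tp (map bit_symbol bs) (int j))"
    have "runs (outs [\<lambda>_. True, \<lambda>f. f 5 = 2]) (out T v) (length [\<lambda>_ :: nat \<Rightarrow> nat. True, \<lambda>f. f 5 = 2] + 1)
      (out T (v @ map (\<lambda>g. g (scans 9 T)) [\<lambda>_. True, \<lambda>f. f 5 = 2]))" for v
      by (rule runs_outs) auto
    moreover have "scans 9 T 5 = 2 \<longleftrightarrow> bs ! j" using j by (simp add: T_def scan_tp bit_symbol_def)
    ultimately have "runs (outs [\<lambda>_. True, \<lambda>f. f 5 = 2]) (out T v) 3 (out T (v @ [True, bs ! j]))" for v
      by (simp add: numeral_3_eq_3)
    from this[of "w @ enc_body (take j bs)"]
    show "runs (outs [\<lambda>_. True, \<lambda>f. f 5 = 2]) ((out s (w @ enc_body (take j bs)))(5 := tp (map bit_symbol bs) (int j))) 3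
       ((out s (w @ enc_body (take (Suc j) bs)))(5 := tp (map bit_symbol bs) (int j)))"
      using j by (simp add: out_upd T_def take_Suc_conv_app_nth enc_body_def)
  qed (use s in \<open>simp_all add: enc_body_def fun_upd_idem\<close>)
  note 1 = this
  have 2: "runs (app 1 (\<lambda>_. 1)) (out s (w @ enc_body bs)) 1 (out s (w @ enc_bits bs))"
    using runs_app[of "out s (w @ enc_body bs)" 1 "map bit_symbol (w @ enc_body bs)" "\<lambda>_. 1" 1]
    by (simp add: out_def enc_bits_eq bit_symbol_def)
  show ?thesis unfolding header_def by (rule runs_mono[OF runs_Seq[OF 1 2]]) simp
qed

definition low_bits :: "nat \<Rightarrow> nat \<Rightarrow> bool list" where
  "low_bits c m = map (bit m) [0..<c]"

text \<open>The code of the integer \<open>2 ^ (2 * (W + c)) + a * 2 ^ (W + c) + b\<close>, seen as a rational number, for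
  \<open>a, b < 2 ^ c\<close>.\<close>

definition entry_word :: "nat \<Rightarrow> nat \<Rightarrow> nat \<times> nat \<Rightarrow> bool list" where
  "entry_word c W = (\<lambda>(a, b). [False] @ enc_body (low_bits c b) @ enc_body (replicate W False) @ enc_body (low_bits c a) @
     enc_body (replicate W False) @ [True, True, False, False, True, True, False])"

definition out_bits :: "nat \<Rightarrow> (nat \<Rightarrow> nat \<Rightarrow> nat \<Rightarrow> nat) \<Rightarrow> cmd" where
  "out_bits c h = outs (concat (map (\<lambda>i. [\<lambda>_. True, \<lambda>f. bit (h (f 7) (f 6) (f 8)) i]) [0..<c]))"

definition entry :: "nat \<Rightarrow> (nat \<Rightarrow> nat \<Rightarrow> nat \<Rightarrow> nat \<times> nat) \<Rightarrow> cmd" where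
  "entry c code = seqs [app 1 (\<lambda>_. 1), out_bits c (\<lambda>u v m. snd (code u v m)), each 2 (outs [\<lambda>_. True, \<lambda>_. False]),
     out_bits c (\<lambda>u v m. fst (code u v m)), each 2 (outs [\<lambda>_. True, \<lambda>_. False]),
     outs [\<lambda>_. True, \<lambda>_. True, \<lambda>_. False, \<lambda>_. False, \<lambda>_. True, \<lambda>_. True, \<lambda>_. False]]"

lemma runs_zeros:
  assumes s: "s 2 = tp R 0" "0 \<notin> set R"
  shows "runs (each 2 (outs [\<lambda>_. True, \<lambda>_. False])) (out s w) (7 * length R + 5) (out s (w @ enc_body (replicate (length R) False)))"
proof -
  have "runs (each 2 (outs [\<lambda>_. True, \<lambda>_. False])) (out s w) (length R * (3 + 4) + 5) (out s (w @ enc_body (replicate (length R) False)))"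
  proof (rule runs_each[OF _ s(2), where S = "\<lambda>j. out s (w @ enc_body (replicate j False))"])
    fix j
    have "runs (outs [\<lambda>_. True, \<lambda>_. False]) (out (s(2 := tp R (int j))) (w @ enc_body (replicate j False))) (length [\<lambda>_ :: nat \<Rightarrow> nat. True, \<lambda>_. False] + 1)
      (out (s(2 := tp R (int j))) ((w @ enc_body (replicate j False)) @ map (\<lambda>g. g (scans 9 (s(2 := tp R (int j))))) [\<lambda>_. True, \<lambda>_. False]))"
      by (rule runs_outs) auto
    moreover have "replicate (Suc j) False = replicate j False @ [False]" by (simp add: replicate_append_same)
    then have "(w @ enc_body (replicate j False)) @ [True, False] = w @ enc_body (replicate (Suc j) False)"
      by (simp only: enc_body_append) (simp add: enc_body_def)
    ultimately show "runs (outs [\<lambda>_. True, \<lambda>_. False]) ((out s (w @ enc_body (replicate j False)))(2 := tp R (int j))) 3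
       ((out s (w @ enc_body (replicate (Suc j) False)))(2 := tp R (int j)))"
      by (simp add: out_upd numeral_3_eq_3)
  qed (use s in \<open>auto simp: out_upd fun_upd_idem enc_body_def\<close>)
  then show ?thesis by (rule runs_mono) simp
qed

lemma map_bits_enc_body: "map (\<lambda>g. g f) (concat (map (\<lambda>i. [\<lambda>_. True, \<lambda>f. bit (h f) i]) is)) = enc_body (map (bit (h f)) is)"
  by (induction "is") (simp_all add: enc_body_def)

lemma length_bits_outs: "length (concat (map (\<lambda>i. [\<lambda>_. True, \<lambda>f. bit (h f) i]) is)) = 2 * length is"
  by (induction "is") simp_all

lemma runs_out_bits:
  "runs (out_bits c h) (out s w) (2 * c + 1) (out s (w @ enc_body (low_bits c (h (scan (s 7)) (scan (s 6)) (scan (s 8))))))"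
proof -
  define g where "g f = h (f 7) (f 6) (f 8)" for f :: "nat \<Rightarrow> nat"
  define gs where "gs = concat (map (\<lambda>i. [\<lambda>_. True, \<lambda>f. bit (g f) i]) [0..<c])"
  have len: "length gs = 2 * c" unfolding gs_def length_bits_outs by simp
  have "runs (outs gs) (out s w) (length gs + 1) (out s (w @ map (\<lambda>g. g (scans 9 s)) gs))"
  proof (rule runs_outs)
    fix e and f f' :: "nat \<Rightarrow> nat" assume e: "e \<in> set gs" and eq: "\<And>j. j \<noteq> 1 \<Longrightarrow> f j = f' j"
    from e have "e = (\<lambda>_. True) \<or> (\<exists>i. e = (\<lambda>f. bit (g f) i))" by (auto simp: gs_def split: if_splits)
    moreover have "g f = g f'" by (simp add: g_def eq)
    ultimately show "e f = e f'" by auto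
  qed
  moreover have "map (\<lambda>g. g (scans 9 s)) gs = enc_body (low_bits c (g (scans 9 s)))"
    unfolding gs_def map_bits_enc_body low_bits_def by (rule refl)
  moreover have "out_bits c h = outs gs" by (simp only: out_bits_def gs_def g_def)
  ultimately show ?thesis unfolding len by (simp only: g_def) simp
qed

lemma runs_entry:
  assumes s: "s 2 = tp R 0" "0 \<notin> set R"
  shows "runs (entry c code) (out s w) (14 * length R + 4 * c + 40)
    (out s (w @ entry_word c (length R) (code (scan (s 7)) (scan (s 6)) (scan (s 8)))))"
proof -
  obtain a b where ab: "code (scan (s 7)) (scan (s 6)) (scan (s 8)) = (a, b)" by fastforce
  have 1: "runs (app 1 (\<lambda>_. 1)) (out s w) 1 (out s (w @ [False]))"
    using runs_app[of "out s w" 1 "map bit_symbol w" "\<lambda>_. 1" 1] by (simp add: out_def bit_symbol_def)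
  have 2: "runs (out_bits c (\<lambda>u v m. snd (code u v m))) (out s w) (2 * c + 1) (out s (w @ enc_body (low_bits c b)))" for w
    using runs_out_bits[of c "\<lambda>u v m. snd (code u v m)" s w] by (simp add: ab)
  have 3: "runs (out_bits c (\<lambda>u v m. fst (code u v m))) (out s w) (2 * c + 1) (out s (w @ enc_body (low_bits c a)))" for w
    using runs_out_bits[of c "\<lambda>u v m. fst (code u v m)" s w] by (simp add: ab)
  have 4: "runs (each 2 (outs [\<lambda>_. True, \<lambda>_. False])) (out s w) (7 * length R + 5) (out s (w @ enc_body (replicate (length R) False)))" for w
    by (rule runs_zeros[where s = s and R = R, OF s])
  have 5: "runs (outs [\<lambda>_. True, \<lambda>_. True, \<lambda>_. False, \<lambda>_. False, \<lambda>_. True, \<lambda>_. True, \<lambda>_. False]) (out s w) 8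
    (out s (w @ [True, True, False, False, True, True, False]))" for w
  proof -
    let ?gs = "[\<lambda>_. True, \<lambda>_. True, \<lambda>_. False, \<lambda>_. False, \<lambda>_. True, \<lambda>_. True, \<lambda>_. False] :: ((nat \<Rightarrow> nat) \<Rightarrow> bool) list"
    have "runs (outs ?gs) (out s w) (length ?gs + 1) (out s (w @ map (\<lambda>g. g (scans 9 s)) ?gs))"
      by (rule runs_outs) auto
    then show ?thesis by (rule runs_cong) simp_all
  qed
  show ?thesis unfolding entry_def ab
    by (rule runs_cong, rule runs_seqs_Cons[OF 1 runs_seqs_Cons[OF 2 runs_seqs_Cons[OF 4 runs_seqs_Cons[OF 3
      runs_seqs_Cons[OF 4 runs_seqs_Cons[OF 5 runs_seqs_Nil]]]]]]) (simp_all add: entry_word_def)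
qed

section \<open>Writing the matrix\<close>

definition entry_time :: "nat \<Rightarrow> nat \<Rightarrow> nat" where
  "entry_time c W = 14 * W + 4 * c + 40"

lemma runs_entries:
  assumes s: "s 2 = tp R 0" "0 \<notin> set R"
  shows "runs (seqs (map (\<lambda>a. entry c (code a)) [0..<k])) (out s w) (k * entry_time c (length R) + 1)
    (out s (w @ concat (map (\<lambda>a. entry_word c (length R) (code a (scan (s 7)) (scan (s 6)) (scan (s 8)))) [0..<k])))"
proof -
  define E where "E a = entry_word c (length R) (code a (scan (s 7)) (scan (s 6)) (scan (s 8)))" for a
  define S where "S j = out s (w @ concat (map E [0..<j]))" for j
  define cs where "cs = map (\<lambda>a. entry c (code a)) [0..<k]"
  have "runs (seqs cs) (S 0) (length cs * entry_time c (length R) + 1) (S (length cs))"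
  proof (rule runs_seqs)
    fix j assume "j < length cs"
    then have "cs ! j = entry c (code j)" by (simp add: cs_def)
    moreover have "runs (entry c (code j)) (S j) (14 * length R + 4 * c + 40) (out s ((w @ concat (map E [0..<j])) @ E j))"
      unfolding S_def E_def by (rule runs_entry[where s = s and R = R, OF s])
    ultimately show "runs (cs ! j) (S j) (entry_time c (length R)) (S (Suc j))"
      by (simp add: S_def entry_time_def)
  qed
  then show ?thesis by (simp add: cs_def S_def E_def[abs_def])
qed

text \<open>The codes of a row: first the flag column, then the palette columns, then the columns of the cells.\<close>

definition row :: "nat \<Rightarrow> nat \<Rightarrow> nat \<times> nat \<Rightarrow> (nat \<Rightarrow> nat \<Rightarrow> nat \<times> nat) \<Rightarrow> (nat \<Rightarrow> nat \<Rightarrow> nat \<Rightarrow> nat \<times> nat) \<Rightarrow> cmd" where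
  "row c k e0 e1 e2 = seqs [entry c (\<lambda>_ _ _. e0), seqs (map (\<lambda>a. entry c (\<lambda>u _ _. e1 a u)) [0..<k]),
     each 6 (Seq (seqs (map (\<lambda>a. entry c (\<lambda>_ u m. e2 a u m)) [0..<k])) (move 8 Go_Right)), each 6 (move 8 Go_Left)]"

definition row_word :: "nat \<Rightarrow> nat \<Rightarrow> nat \<Rightarrow> nat list \<Rightarrow> (int \<Rightarrow> nat) \<Rightarrow> nat \<times> nat \<Rightarrow> (nat \<Rightarrow> nat \<times> nat) \<Rightarrow> (nat \<Rightarrow> nat \<Rightarrow> nat \<Rightarrow> nat \<times> nat) \<Rightarrow> bool list" where
  "row_word c k W us mk e0 e1 e2 = entry_word c W e0 @ concat (map (\<lambda>a. entry_word c W (e1 a)) [0..<k]) @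
     concat (map (\<lambda>v. concat (map (\<lambda>a. entry_word c W (e2 a (us ! v) (mk (int v)))) [0..<k])) [0..<length us])"

definition row_time :: "nat \<Rightarrow> nat \<Rightarrow> nat \<Rightarrow> nat \<Rightarrow> nat" where
  "row_time c k W N = (N + 2) * (k * entry_time c W + entry_time c W + 20)"

text \<open>The head of tape 8 advances with that of tape 6, so at cell \<open>v\<close> it reads
  position \<open>h + v\<close>. The second sweep brings it back, and only the output has
  changed.\<close>

lemma runs_row:
  assumes s: "s 2 = tp R 0" "0 \<notin> set R" "s 6 = tp us 0" "0 \<notin> set us" "s 8 = (mk, h)"
  shows "runs (row c k e0 e1 e2) (out s w) (row_time c k (length R) (length us))
    (out s (w @ row_word c k (length R) us (\<lambda>z. mk (h + z)) e0 (\<lambda>a. e1 a (scan (s 7))) e2))"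
proof -
  define E where "E = entry_word c (length R)"
  define e where "e = entry_time c (length R)"
  define w1 where "w1 = w @ E e0"
  define w2 where "w2 = w1 @ concat (map (\<lambda>a. E (e1 a (scan (s 7)))) [0..<k])"
  define cell where "cell v = concat (map (\<lambda>a. E (e2 a (us ! v) (mk (h + int v)))) [0..<k])" for v
  define w3 where "w3 = w2 @ concat (map cell [0..<length us])"
  have 1: "runs (entry c (\<lambda>_ _ _. e0)) (out s w) e (out s w1)"
    using runs_entry[where s = s and R = R, OF s(1,2), of c "\<lambda>_ _ _. e0" w] by (simp add: e_def entry_time_def w1_def E_def)
  have 2: "runs (seqs (map (\<lambda>a. entry c (\<lambda>u _ _. e1 a u)) [0..<k])) (out s w1) (k * e + 1) (out s w2)"
    using runs_entries[where s = s and R = R, OF s(1,2), of c "\<lambda>a u _ _. e1 a u" k w1] by (simp add: e_def w2_def E_def)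
  have 3: "runs (each 6 (Seq (seqs (map (\<lambda>a. entry c (\<lambda>_ u m. e2 a u m)) [0..<k])) (move 8 Go_Right))) (out s w2)
    (length us * ((k * e + 1 + 1) + 4) + 5) (out (s(8 := (mk, h + int (length us)))) w3)"
  proof (rule runs_each[OF _ s(4), where S = "\<lambda>j. out (s(8 := (mk, h + int j))) (w2 @ concat (map cell [0..<j]))"])
    fix j assume j: "j < length us"
    define T where "T = s(6 := tp us (int j), 8 := (mk, h + int j))"
    define v where "v = w2 @ concat (map cell [0..<j])"
    have T: "T 2 = tp R 0" "scan (T 6) = us ! j" "scan (T 8) = mk (h + int j)" "T 8 = (mk, h + int j)"
      using s j by (simp_all add: T_def scan_tp)
    have a: "runs (seqs (map (\<lambda>a. entry c (\<lambda>_ u m. e2 a u m)) [0..<k])) (out T v) (k * e + 1) (out T (v @ cell j))"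
      using runs_entries[where s = T and R = R, OF T(1) s(2), of c "\<lambda>a _ u m. e2 a u m" k v] T by (simp add: e_def cell_def E_def)
    have "runs (move 8 Go_Right) (out T (v @ cell j)) 1 ((out T (v @ cell j))(8 := (mk, h + int j + dir_offset Go_Right)))"
      by (rule runs_move_gen) (simp_all add: T)
    then have b: "runs (move 8 Go_Right) (out T (v @ cell j)) 1 (out (T(8 := (mk, h + int (Suc j)))) (v @ cell j))"
      by (simp add: out_upd add_ac)
    have "v @ cell j = w2 @ concat (map cell [0..<Suc j])" by (simp add: v_def)
    moreover have "(out (s(8 := (mk, h + int j'))) u)(6 := tp us (int j)) = out (s(6 := tp us (int j), 8 := (mk, h + int j'))) u" for j' u
      by (simp add: out_upd fun_upd_twist)
    moreover have "T(8 := (mk, h + int (Suc j))) = s(6 := tp us (int j), 8 := (mk, h + int (Suc j)))"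
      by (simp add: T_def)
    ultimately show "runs (Seq (seqs (map (\<lambda>a. entry c (\<lambda>_ u m. e2 a u m)) [0..<k])) (move 8 Go_Right))
      ((out (s(8 := (mk, h + int j))) (w2 @ concat (map cell [0..<j])))(6 := tp us (int j))) (k * e + 1 + 1)
      ((out (s(8 := (mk, h + int (Suc j)))) (w2 @ concat (map cell [0..<Suc j])))(6 := tp us (int j)))"
      using runs_Seq[OF a b] by (simp only: T_def[symmetric] v_def[symmetric])
  next
    show "out s w2 = (out (s(8 := (mk, h + int 0))) (w2 @ concat (map cell [0..<0])))(6 := tp us 0)"
      using s by (simp add: out_upd fun_upd_idem)
    show "out (s(8 := (mk, h + int (length us)))) w3 = (out (s(8 := (mk, h + int (length us)))) (w2 @ concat (map cell [0..<length us])))(6 := tp us 0)"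
      using s by (simp add: w3_def fun_upd_idem)
  qed simp
  have "runs (each 6 (move 8 Go_Left)) (out (s(8 := (mk, h + int (length us)))) w3) (5 * length us + 5)
    ((out (s(8 := (mk, h + int (length us)))) w3)(8 := (mk, h + int (length us) + int (length us) * dir_offset Go_Left)))"
    by (rule runs_each_move) (use s in simp_all)
  moreover have "(out (s(8 := (mk, h + int (length us)))) w3)(8 := (mk, h + int (length us) + int (length us) * dir_offset Go_Left)) = out s w3"
    using s by (simp add: out_upd fun_upd_idem)
  ultimately have 4: "runs (each 6 (move 8 Go_Left)) (out (s(8 := (mk, h + int (length us)))) w3) (5 * length us + 5) (out s w3)"
    by (simp only:)
  have w3: "w3 = w @ row_word c k (length R) us (\<lambda>z. mk (h + z)) e0 (\<lambda>a. e1 a (scan (s 7))) e2"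
    by (simp add: w3_def w2_def w1_def row_word_def E_def cell_def[abs_def])
  have time: "e + (k * e + 1 + (length us * ((k * e + 1 + 1) + 4) + 5 + (5 * length us + 5 + 1))) \<le> row_time c k (length R) (length us)"
    by (simp add: row_time_def e_def[symmetric] algebra_simps)
  show ?thesis unfolding row_def w3[symmetric]
    by (rule runs_mono[OF runs_seqs_Cons[OF 1 runs_seqs_Cons[OF 2 runs_seqs_Cons[OF 3 runs_seqs_Cons[OF 4 runs_seqs_Nil]]]] time])
qed

definition flag_row :: "nat \<Rightarrow> nat \<Rightarrow> cmd" where
  "flag_row c k = row c k (2, 0) (\<lambda>_ _. (1, 1)) (\<lambda>_ _ _. (1, 1))"

definition palette_row :: "nat \<Rightarrow> nat \<Rightarrow> (nat \<Rightarrow> nat \<Rightarrow> nat \<Rightarrow> bool) \<Rightarrow> nat \<Rightarrow> cmd" where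
  "palette_row c k un a = row c k (1, 1) (\<lambda>a' _. if a = a' then (1, k) else (0, k)) (\<lambda>a' u _. (0, k + of_bool (un u a a')))"

definition cell_row :: "nat \<Rightarrow> nat \<Rightarrow> (nat \<Rightarrow> nat \<Rightarrow> nat \<Rightarrow> bool) \<Rightarrow> (nat \<Rightarrow> nat \<Rightarrow> nat \<Rightarrow> bool) \<Rightarrow> nat \<Rightarrow> cmd" where
  "cell_row c k un nb a = row c k (1, 1) (\<lambda>a' u. (0, k + of_bool (un u a' a)))
     (\<lambda>a' _ m. if m = 1 \<and> a = a' then (1, k) else (0, k + of_bool (nb m a a')))"

text \<open>The head of tape 8 starts the rows of cell \<open>v\<close> at \<open>- v\<close>, hence
  it meets cell \<open>v'\<close> with the mark of \<open>v' - v\<close>.\<close>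

definition rows :: "nat \<Rightarrow> nat \<Rightarrow> (nat \<Rightarrow> nat \<Rightarrow> nat \<Rightarrow> bool) \<Rightarrow> (nat \<Rightarrow> nat \<Rightarrow> nat \<Rightarrow> bool) \<Rightarrow> cmd" where
  "rows c k un nb = seqs [flag_row c k, seqs (map (palette_row c k un) [0..<k]),
     each 7 (Seq (seqs (map (cell_row c k un nb) [0..<k])) (move 8 Go_Left))]"

definition flag_word :: "nat \<Rightarrow> nat \<Rightarrow> nat \<Rightarrow> nat list \<Rightarrow> bool list" where
  "flag_word c k W us = row_word c k W us (mark W) (2, 0) (\<lambda>_. (1, 1)) (\<lambda>_ _ _. (1, 1))"

definition palette_word :: "nat \<Rightarrow> nat \<Rightarrow> nat \<Rightarrow> nat list \<Rightarrow> (nat \<Rightarrow> nat \<Rightarrow> nat \<Rightarrow> bool) \<Rightarrow> nat \<Rightarrow> bool list" where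
  "palette_word c k W us un a = row_word c k W us (mark W) (1, 1) (\<lambda>a'. if a = a' then (1, k) else (0, k)) (\<lambda>a' u _. (0, k + of_bool (un u a a')))"

definition cell_word :: "nat \<Rightarrow> nat \<Rightarrow> nat \<Rightarrow> nat list \<Rightarrow> (nat \<Rightarrow> nat \<Rightarrow> nat \<Rightarrow> bool) \<Rightarrow> (nat \<Rightarrow> nat \<Rightarrow> nat \<Rightarrow> bool) \<Rightarrow> nat \<Rightarrow> nat \<Rightarrow> bool list" where
  "cell_word c k W us un nb v a = row_word c k W us (\<lambda>z. mark W (z - int v)) (1, 1) (\<lambda>a'. (0, k + of_bool (un (us ! v) a' a)))
     (\<lambda>a' _ m. if m = 1 \<and> a = a' then (1, k) else (0, k + of_bool (nb m a a')))"

lemma runs_outs_list: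
  assumes "\<And>a w. a < k \<Longrightarrow> runs (cmd a) (out s w) B (out s (w @ word a))"
  shows "runs (seqs (map cmd [0..<k])) (out s w) (k * B + 1) (out s (w @ concat (map word [0..<k])))"
proof -
  define S where "S j = out s (w @ concat (map word [0..<j]))" for j
  have "runs (seqs (map cmd [0..<k])) (S 0) (length (map cmd [0..<k]) * B + 1) (S (length (map cmd [0..<k])))"
  proof (rule runs_seqs)
    fix j assume "j < length (map cmd [0..<k])"
    then have j: "j < k" by simp
    show "runs (map cmd [0..<k] ! j) (S j) B (S (Suc j))"
      using assms[OF j, of "w @ concat (map word [0..<j])"] j by (simp add: S_def)
  qed
  then show ?thesis by (simp add: S_def)
qed

lemma runs_rows:
  assumes s: "s 2 = tp R 0" "0 \<notin> set R" "s 6 = tp us 0" "s 7 = tp us 0" "0 \<notin> set us" "s 8 = (mark W, 0)"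
    and W: "W = length R"
  shows "\<exists>s'. runs (rows c k un nb) (out s w) ((length us + 2) * (k * row_time c k W (length us) + row_time c k W (length us) + 20))
    (out s' (w @ flag_word c k W us @ concat (map (palette_word c k W us un) [0..<k]) @
       concat (map (\<lambda>v. concat (map (cell_word c k W us un nb v) [0..<k])) [0..<length us])))"
proof -
  define t where "t = row_time c k W (length us)"
  have 1: "runs (flag_row c k) (out s w) t (out s (w @ flag_word c k W us))"
    using runs_row[where s = s and R = R, OF s(1,2,3,5,6), of c k "(2, 0)" "\<lambda>_ _. (1, 1)" "\<lambda>_ _ _. (1, 1)" w]
    by (simp add: flag_row_def flag_word_def t_def W)
  have p: "runs (palette_row c k un a) (out s w) t (out s (w @ palette_word c k W us un a))" for a w
    using runs_row[where s = s and R = R, OF s(1,2,3,5,6), of c k "(1, 1)" "\<lambda>a' _. if a = a' then (1, k) else (0, k)" "\<lambda>a' u _. (0, k + of_bool (un u a a'))" w]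
    by (simp add: palette_row_def palette_word_def t_def W)
  have 2: "runs (seqs (map (palette_row c k un) [0..<k])) (out s w) (k * t + 1) (out s (w @ concat (map (palette_word c k W us un) [0..<k])))" for w
    by (rule runs_outs_list) (rule p)
  define cell where "cell v = concat (map (cell_word c k W us un nb v) [0..<k])" for v
  have 3: "runs (each 7 (Seq (seqs (map (cell_row c k un nb) [0..<k])) (move 8 Go_Left))) (out s w)
     (length us * ((k * t + 1 + 1) + 4) + 5) (out (s(8 := (mark W, - int (length us)))) (w @ concat (map cell [0..<length us])))" for w
  proof (rule runs_each[OF _ s(5), where S = "\<lambda>j. out (s(8 := (mark W, - int j))) (w @ concat (map cell [0..<j]))"])
    fix j assume j: "j < length us"
    define T where "T = s(7 := tp us (int j), 8 := (mark W, - int j))"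
    define v where "v = w @ concat (map cell [0..<j])"
    have T: "T 2 = tp R 0" "T 6 = tp us 0" "scan (T 7) = us ! j" "T 8 = (mark W, - int j)"
      using s j by (simp_all add: T_def scan_tp)
    have r: "runs (cell_row c k un nb a) (out T w) t (out T (w @ cell_word c k W us un nb j a))" for a w
      using runs_row[where s = T and R = R, OF T(1) s(2) T(2) s(5) T(4), of c k "(1, 1)" "\<lambda>a' u. (0, k + of_bool (un u a' a))"
        "\<lambda>a' _ m. if m = 1 \<and> a = a' then (1, k) else (0, k + of_bool (nb m a a'))" w] T(3)
      by (simp add: cell_row_def cell_word_def t_def W)
    have a: "runs (seqs (map (cell_row c k un nb) [0..<k])) (out T v) (k * t + 1) (out T (v @ cell j))"
      unfolding cell_def by (rule runs_outs_list) (rule r)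
    have "runs (move 8 Go_Left) (out T (v @ cell j)) 1 ((out T (v @ cell j))(8 := (mark W, - int j + dir_offset Go_Left)))"
      by (rule runs_move_gen) (simp_all add: T)
    moreover have "- int j + dir_offset Go_Left = - int (Suc j)" by simp
    moreover have "(out T (v @ cell j))(8 := t) = out (T(8 := t)) (v @ cell j)" for t by (rule out_upd) simp
    ultimately have b: "runs (move 8 Go_Left) (out T (v @ cell j)) 1 (out (T(8 := (mark W, - int (Suc j)))) (v @ cell j))"
      by (simp only:)
    have "v @ cell j = w @ concat (map cell [0..<Suc j])" by (simp add: v_def)
    moreover have "(out (s(8 := (mark W, - int j'))) u)(7 := tp us (int j)) = out (s(7 := tp us (int j), 8 := (mark W, - int j'))) u" for j' u
      by (simp add: out_upd fun_upd_twist)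
    moreover have "T(8 := (mark W, - int (Suc j))) = s(7 := tp us (int j), 8 := (mark W, - int (Suc j)))"
      by (simp add: T_def)
    ultimately show "runs (Seq (seqs (map (cell_row c k un nb) [0..<k])) (move 8 Go_Left))
      ((out (s(8 := (mark W, - int j))) (w @ concat (map cell [0..<j])))(7 := tp us (int j))) (k * t + 1 + 1)
      ((out (s(8 := (mark W, - int (Suc j)))) (w @ concat (map cell [0..<Suc j])))(7 := tp us (int j)))"
      using runs_Seq[OF a b] by (simp only: T_def[symmetric] v_def[symmetric])
  next
    show "out s w = (out (s(8 := (mark W, - int 0))) (w @ concat (map cell [0..<0])))(7 := tp us 0)"
      using s by (simp add: out_upd fun_upd_idem)
    show "out (s(8 := (mark W, - int (length us)))) (w @ concat (map cell [0..<length us])) =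
       (out (s(8 := (mark W, - int (length us)))) (w @ concat (map cell [0..<length us])))(7 := tp us 0)"
      using s by (simp add: fun_upd_idem)
  qed simp
  have time: "t + (k * t + 1 + (length us * ((k * t + 1 + 1) + 4) + 5 + 1)) \<le> (length us + 2) * (k * t + t + 20)"
    by (simp add: algebra_simps)
  have "runs (rows c k un nb) (out s w) ((length us + 2) * (k * t + t + 20))
    (out (s(8 := (mark W, - int (length us)))) (((w @ flag_word c k W us) @ concat (map (palette_word c k W us un) [0..<k])) @ concat (map cell [0..<length us])))"
    unfolding rows_def by (rule runs_mono[OF runs_seqs_Cons[OF 1 runs_seqs_Cons[OF 2 runs_seqs_Cons[OF 3 runs_seqs_Nil]]] time])
  then show ?thesis unfolding t_def cell_def append_assoc by blast
qed

section \<open>The order of the matrix indices\<close>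

lemma concat_blocks: "concat (map g [0..<N * k]) = concat (map (\<lambda>v. concat (map (\<lambda>a. g (v * k + a)) [0..<k])) [0..<N])"
proof (induction N)
  case (Suc N)
  have "[0..<Suc N * k] = [0..<N * k] @ map (\<lambda>a. N * k + a) [0..<k]"
    by (rule nth_equalityI) (auto simp: nth_append)
  then show ?case using Suc by (simp add: comp_def)
qed simp

lemma concat_index_blocks:
  "concat (map g [0..<Suc (Suc N * k)]) = g 0 @ concat (map (\<lambda>a. g (Suc a)) [0..<k]) @
     concat (map (\<lambda>v. concat (map (\<lambda>a. g (Suc (Suc v * k + a))) [0..<k])) [0..<N])"
proof -
  have "[0..<Suc (Suc N * k)] = 0 # map Suc [0..<Suc N * k]"
    by (simp only: map_Suc_upt upt_conv_Cons zero_less_Suc)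
  then have "concat (map g [0..<Suc (Suc N * k)]) = g 0 @ concat (map (\<lambda>i. g (Suc i)) [0..<Suc N * k])"
    by (simp add: comp_def)
  also have "concat (map (\<lambda>i. g (Suc i)) [0..<Suc N * k]) = concat (map (\<lambda>v. concat (map (\<lambda>a. g (Suc (v * k + a))) [0..<k])) [0..<Suc N])"
    by (rule concat_blocks)
  also have "[0..<Suc N] = 0 # map Suc [0..<N]" by (simp only: map_Suc_upt upt_conv_Cons zero_less_Suc)
  finally show ?thesis by (simp add: comp_def)
qed

text \<open>\<open>(a, b)\<close> stands for the entry \<open>2 ^ (2 * L) + a * 2 ^ L + b\<close>; compare \<^const>\<open>flag_gram\<close> with
  \<open>D = 2 ^ L\<close> and \<open>l = 2 ^ (2 * L) + 2 * 2 ^ L + k\<close>.\<close>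

definition gram_code :: "nat \<Rightarrow> (nat \<Rightarrow> nat \<Rightarrow> bool) \<Rightarrow> nat \<Rightarrow> nat \<Rightarrow> nat \<times> nat" where
  "gram_code k ok i j = (if i = 0 \<and> j = 0 then (2, 0) else if i = 0 \<or> j = 0 then (1, 1) else if i = j then (1, k)
     else (0, k + of_bool (ok i j)))"

text \<open>The program treats flag, palette and cells separately and sees only types and marks.
  Writing an index as \<open>Suc (v * k + a)\<close> with \<open>a < k\<close> turns the
  \<open>div\<close> and \<open>mod\<close> of \<open>index_ok\<close> into that case distinction,
  and mark 1 identifies equal cells.\<close>

lemma rows_word:
  fixes d c W :: nat and us :: "nat list" and H V ty :: "nat \<Rightarrow> nat \<Rightarrow> bool"
  defines "k \<equiv> 2 ^ Suc d" and "un \<equiv> \<lambda>u. unary_ok d (ty u)" and "nb \<equiv> mark_ok d H V"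
    and "ok \<equiv> index_ok d H V ty W us" and "n \<equiv> Suc (Suc (length us) * 2 ^ Suc d)"
  assumes W: "2 \<le> W"
  shows "flag_word c k W us @ concat (map (palette_word c k W us un) [0..<k]) @
       concat (map (\<lambda>v. concat (map (cell_word c k W us un nb v) [0..<k])) [0..<length us]) =
     concat (map (\<lambda>i. concat (map (\<lambda>j. entry_word c W (gram_code k ok i j)) [0..<n])) [0..<n])"
proof -
  define E where "E = entry_word c W"
  define row where "row i = concat (map (\<lambda>j. E (gram_code k ok i j)) [0..<n])" for i
  have n: "n = Suc (Suc (length us) * k)" by (simp only: n_def k_def)
  have ok: "ok (Suc (v * k + a)) (Suc (v' * k + a')) = var_ok d H V ty W us v a v' a'" if "a < k" "a' < k" for v v' a a'
    using that by (simp add: ok_def index_ok_def k_def[symmetric] del: power_Suc)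
  have eq: "Suc (v * k + a) = Suc (v' * k + a') \<longleftrightarrow> v = v' \<and> a = a'" if "a < k" "a' < k" for v v' a a'
  proof
    assume "Suc (v * k + a) = Suc (v' * k + a')"
    then have "(v * k + a) div k = (v' * k + a') div k" "(v * k + a) mod k = (v' * k + a') mod k" by simp_all
    then show "v = v' \<and> a = a'" using that by simp
  qed simp
  have mark1: "mark W (int v' - int v) = 1 \<longleftrightarrow> v = v'" for v v' using W by (auto simp: mark_def)
  have code: "gram_code k ok (Suc (v * k + a)) (Suc (v' * k + a')) =
      (if v = v' \<and> a = a' then (1, k) else (0, k + of_bool (var_ok d H V ty W us v a v' a')))"
    if "a < k" "a' < k" for v v' a a'
    unfolding gram_code_def eq[OF that] ok[OF that] by simp
  have row_blocks: "row i = E (gram_code k ok i 0) @ concat (map (\<lambda>a. E (gram_code k ok i (Suc (0 * k + a)))) [0..<k]) @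
      concat (map (\<lambda>v. concat (map (\<lambda>a. E (gram_code k ok i (Suc (Suc v * k + a)))) [0..<k])) [0..<length us])" for i
    unfolding row_def n concat_index_blocks by simp
  have map_cong': "concat (map f [0..<m]) = concat (map g [0..<m])" if "\<And>a. a < m \<Longrightarrow> f a = g a" for f g :: "nat \<Rightarrow> bool list" and m
    using that by (intro arg_cong[of _ _ concat] map_cong) auto
  have flag: "row 0 = flag_word c k W us"
    unfolding row_blocks flag_word_def row_word_def E_def by (simp add: gram_code_def)
  have palette: "row (Suc (0 * k + a)) = palette_word c k W us un a" if a: "a < k" for a
    unfolding row_blocks palette_word_def row_word_def E_def[symmetric]
  proof (intro arg_cong2[of _ _ _ _ append] map_cong')
    show "E (gram_code k ok (Suc (0 * k + a)) 0) = E (1, 1)" by (simp add: gram_code_def)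
    fix a' assume a': "a' < k"
    show "E (gram_code k ok (Suc (0 * k + a)) (Suc (0 * k + a'))) = E (if a = a' then (1, k) else (0, k))"
      unfolding code[OF a a'] by (simp add: var_ok_def)
    fix v
    show "E (gram_code k ok (Suc (0 * k + a)) (Suc (Suc v * k + a'))) = E (0, k + of_bool (un (us ! v) a a'))"
      unfolding code[OF a a'] by (simp add: var_ok_def un_def)
  qed
  have cell: "row (Suc (Suc v * k + a)) = cell_word c k W us un nb v a" if a: "a < k" for v a
    unfolding row_blocks cell_word_def row_word_def E_def[symmetric]
  proof (intro arg_cong2[of _ _ _ _ append] map_cong')
    show "E (gram_code k ok (Suc (Suc v * k + a)) 0) = E (1, 1)" by (simp add: gram_code_def)
    fix a' assume a': "a' < k"
    show "E (gram_code k ok (Suc (Suc v * k + a)) (Suc (0 * k + a'))) = E (0, k + of_bool (un (us ! v) a' a))"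
      unfolding code[OF a a'] by (simp add: var_ok_def un_def)
    fix v'
    show "E (gram_code k ok (Suc (Suc v * k + a)) (Suc (Suc v' * k + a'))) = E (if mark W (int v' - int v) = 1 \<and> a = a' then (1, k)
        else (0, k + of_bool (nb (mark W (int v' - int v)) a a')))"
      unfolding code[OF a a'] mark1 by (auto simp: var_ok_def nb_def mark_ok_def mark1 mark_def)
  qed
  have "concat (map row [0..<n]) = row 0 @ concat (map (\<lambda>a. row (Suc (0 * k + a))) [0..<k]) @
      concat (map (\<lambda>v. concat (map (\<lambda>a. row (Suc (Suc v * k + a))) [0..<k])) [0..<length us])"
    unfolding n concat_index_blocks by simp
  also have "\<dots> = flag_word c k W us @ concat (map (palette_word c k W us un) [0..<k]) @
       concat (map (\<lambda>v. concat (map (cell_word c k W us un nb v) [0..<k])) [0..<length us])"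
    unfolding flag by (intro arg_cong2[of _ _ _ _ append] refl map_cong' palette cell)
  finally show ?thesis unfolding row_def E_def by simp
qed

section \<open>The reduction\<close>

text \<open>The final \<open>True\<close> is the leading digit, so the list is the canonical
  one.\<close>

lemma nat_bits_horner: "nat_bits (horner_sum of_bool 2 (bs @ [True])) = bs @ [True]"
proof (induction bs)
  case Nil
  show ?case by (simp add: nat_bits.simps)
next
  case (Cons b bs)
  define m :: nat where "m = horner_sum of_bool 2 (bs @ [True])"
  have m: "m \<noteq> 0"
  proof
    assume "m = 0"
    then have "nat_bits m = []" by (simp add: nat_bits.simps)
    then show False using Cons by (simp add: m_def)
  qed
  have h: "horner_sum of_bool 2 ((b # bs) @ [True]) = of_bool b + 2 * m" by (simp add: m_def)
  have "nat_bits (of_bool b + 2 * m) = b # nat_bits m"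
    using m by (subst nat_bits.simps) auto
  then show ?case unfolding h using Cons by (simp add: m_def)
qed

lemma horner_low_bits: "m < 2 ^ c \<Longrightarrow> horner_sum of_bool 2 (low_bits c m) = m"
  unfolding low_bits_def horner_sum_bit_eq_take_bit by (rule take_bit_nat_eq_self)

definition code_value :: "nat \<Rightarrow> nat \<times> nat \<Rightarrow> nat" where
  "code_value L = (\<lambda>(a, b). 2 ^ (2 * L) + a * 2 ^ L + b)"

text \<open>The digit at position \<open>2 * (W + c)\<close> is always set. Hence the word has the
  same shape for all \<open>a\<close> and \<open>b\<close>, and no leading zeros have to be
  suppressed. The tail \<open>[False, True, True, False]\<close> is the denominator 1.\<close>

lemma entry_word_eq:
  assumes "a < 2 ^ c" "b < 2 ^ c"
  shows "entry_word c W (a, b) = enc_rat (of_nat (code_value (W + c) (a, b)))"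
proof -
  define bs where "bs = low_bits c b @ replicate W False @ low_bits c a @ replicate W False"
  have z: "horner_sum of_bool 2 (replicate W False) = (0 :: nat)"
    by (induction W) auto
  have len: "length (low_bits c m) = c" for m by (simp add: low_bits_def)
  have "horner_sum of_bool 2 (bs @ [True]) = b + 2 ^ c * (2 ^ W * (a + 2 ^ c * 2 ^ W))"
    unfolding bs_def append_assoc
    by (simp add: horner_sum_append z len horner_low_bits[OF assms(1)] horner_low_bits[OF assms(2)])
  also have "\<dots> = code_value (W + c) (a, b)"
    by (simp add: code_value_def power_add power_mult power2_eq_square algebra_simps)
  finally have "nat_bits (code_value (W + c) (a, b)) = bs @ [True]" using nat_bits_horner[of bs] by simp
  moreover have "quotient_of (of_nat m) = (int m, 1)" for m
    using quotient_of_int[of "int m"] by simp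
  moreover have "nat_bits 1 = [True]" by (simp add: nat_bits.simps)
  ultimately show ?thesis
    by (simp add: enc_rat_def enc_int_def enc_nat_def enc_bits_eq entry_word_def bs_def enc_body_append) (simp add: enc_body_def)
qed

definition gram_program :: "nat \<Rightarrow> nat \<Rightarrow> nat list \<Rightarrow> nat list \<Rightarrow> (nat \<Rightarrow> nat \<Rightarrow> nat \<Rightarrow> bool) \<Rightarrow> (nat \<Rightarrow> nat \<Rightarrow> nat \<Rightarrow> bool) \<Rightarrow> cmd" where
  "gram_program c k qs bs un nb = seqs [Seq (unary_poly 3 5 qs) (rewind 3), Seq (unary_poly 4 5 bs) (rewind 4), build_columns, build_cells, build_marks,
     counter k, header, entry c (\<lambda>_ _ _. (2, k)), rows c k un nb]"

definition gram_word :: "nat \<Rightarrow> nat \<Rightarrow> nat \<Rightarrow> nat list \<Rightarrow> (nat \<Rightarrow> nat \<Rightarrow> nat \<Rightarrow> bool) \<Rightarrow> (nat \<Rightarrow> nat \<Rightarrow> nat \<Rightarrow> bool) \<Rightarrow> bool list" where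
  "gram_word c k W us un nb = enc_nat (Suc (Suc (length us) * k)) @ entry_word c W (2, k) @
     flag_word c k W us @ concat (map (palette_word c k W us un) [0..<k]) @
       concat (map (\<lambda>v. concat (map (cell_word c k W us un nb v) [0..<k])) [0..<length us])"

lemma init_state_nth: "init_state x 0 = tp (map bit_symbol x) 0" "j \<noteq> 0 \<Longrightarrow> init_state x j = te []"
  by (auto simp: init_state_def input_tape_def tp_def te_def fun_eq_iff)

lemma runs_gram_program:
  "\<exists>f. poly_bounded f \<and> (\<forall>x. \<exists>s'. runs (gram_program c k qs bs un nb) (init_state x) (f (length x))
     (out s' (gram_word c k (length (columns (horner bs (length x)) (horner qs (length x)) x))
        (cells (horner bs (length x)) (horner qs (length x)) x) un nb)))"
proof -
  obtain f1 where f1: "poly_bounded f1" "\<And>s xs. s 0 = tp xs 0 \<Longrightarrow> s 3 = te [] \<Longrightarrow> s 5 = te [] \<Longrightarrow> 0 \<notin> set xs \<Longrightarrow>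
    runs (unary_poly 3 5 qs) s (f1 (length xs)) (s(3 := te (replicate (horner qs (length xs)) 1)))"
    using runs_unary_poly[of 3 5 qs] by auto
  obtain f2 where f2: "poly_bounded f2" "\<And>s xs. s 0 = tp xs 0 \<Longrightarrow> s 4 = te [] \<Longrightarrow> s 5 = te [] \<Longrightarrow> 0 \<notin> set xs \<Longrightarrow>
    runs (unary_poly 4 5 bs) s (f2 (length xs)) (s(4 := te (replicate (horner bs (length xs)) 1)))"
    using runs_unary_poly[of 4 5 bs] by auto
  define W where "W n = 2 * horner bs n + 2 * n + 2 * horner qs n + 5" for n
  define N where "N n = (horner bs n + 2) * W n" for n
  define F where "F n = Suc (Suc (N n) * k)" for n
  define e where "e n = entry_time c (W n)" for n
  define t where "t n = row_time c k (W n) (N n)" for n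
  \<comment> \<open>Nested like the sum of times that \<open>runs_seqs_Cons\<close> yields for the
    program.\<close>
  define f where "f n = f1 n + (2 * horner qs n + 4) + (f2 n + (2 * horner bs n + 4) + (50 * (horner bs n + horner qs n + n + 2) + (50 * (horner bs n + 1) * (W n + 1) + ((20 * W n + 50) +
      ((N n + 2) * (Suc k * (5 * F n + 10) + 10) + ((10 * F n + 10) + (e n + ((N n + 2) * (k * t n + t n + 20) + 1))))))))" for n
  have "poly_bounded f"
    unfolding f_def t_def row_time_def e_def entry_time_def F_def N_def W_def Suc_eq_plus1
    by (intro poly_bounded_intros f1(1) f2(1))
  moreover have "\<exists>s'. runs (gram_program c k qs bs un nb) (init_state x) (f (length x))
     (out s' (gram_word c k (length (columns (horner bs (length x)) (horner qs (length x)) x))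
        (cells (horner bs (length x)) (horner qs (length x)) x) un nb))" for x
  proof -
    define n where "n = length x"
    define B where "B = horner bs n"
    define q where "q = horner qs n"
    define R where "R = columns B q x"
    define us where "us = cells B q x"
    have lR: "length R = W n" by (simp add: R_def length_columns W_def B_def q_def n_def)
    have "length us = (B + 2) * length R" by (simp add: us_def R_def length_cells)
    then have lus: "length us = N n" unfolding lR by (simp add: N_def B_def)
    note nz = bit_symbols_nonzero[of x] columns_nonzero[of B q x, folded R_def] cells_nonzero[of B q x, folded us_def]
    note i = init_state_nth[where x = x]
    define s1 where "s1 = (init_state x)(3 := tp (replicate q 1) 0)"
    define s2 where "s2 = s1(4 := tp (replicate B 1) 0)"
    define s3 where "s3 = s2(2 := tp R 0)"
    define s4 where "s4 = s3(6 := tp us 0, 7 := tp us 0)"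
    define s5 where "s5 = s4(8 := (mark (length R), 0))"
    define s6 where "s6 = s5(5 := tp (map bit_symbol (nat_bits (F n))) 0)"
    have rw: "runs (rewind j) (s(j := te (replicate m 1))) (2 * m + 4) (s(j := tp (replicate m 1) 0))" if "j < 9" for j s m
      using runs_rewind[OF that, of "s(j := te (replicate m 1))" "replicate m 1" m] by (simp add: te_def)
    have "runs (unary_poly 3 5 qs) (init_state x) (f1 n) ((init_state x)(3 := te (replicate q 1)))"
      using f1(2)[of "init_state x" "map bit_symbol x"] i nz by (simp add: n_def q_def)
    then have 1: "runs (Seq (unary_poly 3 5 qs) (rewind 3)) (init_state x) (f1 n + (2 * q + 4)) s1"
      unfolding s1_def by (rule runs_Seq) (rule rw, simp)
    have "runs (unary_poly 4 5 bs) s1 (f2 n) (s1(4 := te (replicate B 1)))"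
      using f2(2)[of s1 "map bit_symbol x"] i nz by (simp add: n_def B_def s1_def)
    then have 2: "runs (Seq (unary_poly 4 5 bs) (rewind 4)) s1 (f2 n + (2 * B + 4)) s2"
      unfolding s2_def by (rule runs_Seq) (rule rw, simp)
    have 3: "runs build_columns s2 (50 * (B + q + n + 2)) s3"
      unfolding s3_def R_def n_def by (rule runs_build_columns) (simp_all add: blank_tape(2) s2_def s1_def i)
    have 4: "runs build_cells s3 (50 * (B + 1) * (W n + 1)) s4"
      unfolding s4_def us_def by (rule runs_build_cells) (simp_all add: s3_def s2_def s1_def i lR[symmetric] R_def)
    have W2: "2 \<le> length R" by (simp add: lR W_def)
    have "runs build_marks s4 (20 * length R + 50) s5"
      unfolding s5_def by (rule runs_build_marks) (simp_all add: blank_tape(2) s4_def s3_def s2_def s1_def i nz W2)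
    then have 5: "runs build_marks s4 (20 * W n + 50) s5" by (simp only: lR)
    have "runs (counter k) s5 ((length us + 2) * (Suc k * (5 * F n + 10) + 10)) s6"
      unfolding s6_def by (rule runs_counter) (simp_all add: blank_tape(2) s5_def s4_def s3_def s2_def s1_def i nz F_def lus)
    moreover have "s6 = out s6 []" by (simp add: out_def s6_def s5_def s4_def s3_def s2_def s1_def i fun_upd_idem)
    ultimately have 6: "runs (counter k) s5 ((N n + 2) * (Suc k * (5 * F n + 10) + 10)) (out s6 [])" by (simp only: lus)
    define w7 where "w7 = [] @ enc_bits (nat_bits (F n))"
    have "runs header (out s6 []) (10 * length (nat_bits (F n)) + 10) (out s6 w7)"
      unfolding w7_def by (rule runs_header) (simp add: s6_def)
    then have 7: "runs header (out s6 []) (10 * F n + 10) (out s6 w7)"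
      by (rule runs_mono) (use length_nat_bits[of "F n"] in simp)
    have s6: "s6 2 = tp R 0" "s6 6 = tp us 0" "s6 7 = tp us 0" "s6 8 = (mark (length R), 0)"
      by (simp_all add: s6_def s5_def s4_def s3_def)
    define w8 where "w8 = w7 @ entry_word c (length R) (2, k)"
    have 8: "runs (entry c (\<lambda>_ _ _. (2, k))) (out s6 w7) (e n) (out s6 w8)"
      using runs_entry[where s = s6 and R = R, OF s6(1) nz(2), of c "\<lambda>_ _ _. (2, k)" w7] by (simp add: w8_def e_def entry_time_def lR)
    obtain s' where 9: "runs (rows c k un nb) (out s6 w8) ((N n + 2) * (k * t n + t n + 20))
      (out s' (w8 @ flag_word c k (length R) us @ concat (map (palette_word c k (length R) us un) [0..<k]) @
       concat (map (\<lambda>v. concat (map (cell_word c k (length R) us un nb v) [0..<k])) [0..<length us])))"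
      using runs_rows[where s = s6 and R = R and us = us and W = "length R", OF s6(1) nz(2) s6(2,3) nz(3) s6(4) refl, of c k un nb w8]
      unfolding lus lR t_def by blast
    have word: "w8 @ flag_word c k (length R) us @ concat (map (palette_word c k (length R) us un) [0..<k]) @
       concat (map (\<lambda>v. concat (map (cell_word c k (length R) us un nb v) [0..<k])) [0..<length us]) =
       gram_word c k (length R) us un nb"
      by (simp add: gram_word_def w8_def w7_def enc_nat_def F_def lus)
    have "runs (gram_program c k qs bs un nb) (init_state x) (f n) (out s' (gram_word c k (length R) us un nb))"
      unfolding gram_program_def f_def B_def[symmetric] q_def[symmetric] word[symmetric]
      by (rule runs_seqs_Cons[OF 1 runs_seqs_Cons[OF 2 runs_seqs_Cons[OF 3 runs_seqs_Cons[OF 4 runs_seqs_Cons[OF 5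
        runs_seqs_Cons[OF 6 runs_seqs_Cons[OF 7 runs_seqs_Cons[OF 8 runs_seqs_Cons[OF 9 runs_seqs_Nil]]]]]]]]])
    then show ?thesis unfolding R_def us_def B_def q_def n_def by blast
  qed
  ultimately show ?thesis by blast
qed

lemma cmd_wf_seqs: "0 < G \<Longrightarrow> cmd_wf G (seqs cs) \<longleftrightarrow> (\<forall>c\<in>set cs. cmd_wf G c)"
  by (induction cs) (auto simp: seqs_simps skip_def)

lemma cmd_wf_basic: "cmd_wf G (move i d)" "cmd_wf G (app i g) \<longleftrightarrow> (\<forall>f. (\<forall>j. f j < G) \<longrightarrow> g f < G)"
  "0 < G \<Longrightarrow> cmd_wf G (rewind i)" "0 < G \<Longrightarrow> cmd_wf G (each i c) \<longleftrightarrow> cmd_wf G c" "0 < G \<Longrightarrow> cmd_wf G (drain i c) \<longleftrightarrow> cmd_wf G c"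
  by (auto simp: move_def app_def rewind_def each_def drain_def cmd_wf_seqs)

lemma cmd_wf_outs: "3 \<le> G \<Longrightarrow> cmd_wf G (outs gs)"
  by (auto simp: outs_def cmd_wf_seqs cmd_wf_basic bit_symbol_def)

lemma cmd_wf_entry: "3 \<le> G \<Longrightarrow> cmd_wf G (entry c code)"
  by (auto simp: entry_def out_bits_def cmd_wf_seqs cmd_wf_basic cmd_wf_outs)

lemma cmd_wf_row: "3 \<le> G \<Longrightarrow> cmd_wf G (row c k e0 e1 e2)"
  by (auto simp: row_def cmd_wf_seqs cmd_wf_basic cmd_wf_entry)

lemma cmd_wf_unary_poly: "2 \<le> G \<Longrightarrow> cmd_wf G (unary_poly A C as)"
  by (induction as) (auto simp: skip_def horner_step_def cmd_wf_seqs cmd_wf_basic)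

lemma cmd_wf_gram_program: "cmd_wf 9 (gram_program c k qs bs un nb)"
  by (auto simp: gram_program_def cmd_wf_seqs cmd_wf_basic cmd_wf_unary_poly cmd_wf_entry cmd_wf_row cmd_wf_outs build_columns_def build_cells_def
    build_marks_def counter_def increment_def header_def rows_def flag_row_def palette_row_def cell_row_def)

lemma poly_mono_nat: "a \<le> b \<Longrightarrow> poly p a \<le> poly (p :: nat poly) b"
  by (induction p) (auto intro!: mult_le_mono)

text \<open>Absorbs the number of cells, at most \<open>W * W\<close>, into \<open>2 ^ W\<close>;
  the factor 4 costs two binary digits.\<close>

lemma square_le_pow2: "W\<^sup>2 + 3 \<le> 4 * 2 ^ W" for W :: nat
proof (induction W)
  case (Suc W)
  have "2 * W + 1 \<le> 4 * 2 ^ W"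
  proof (induction W)
    case (Suc W)
    define m :: nat where "m = 2 ^ W"
    have "1 \<le> m" "2 * W + 1 \<le> 4 * m" using Suc by (simp_all add: m_def)
    then have "2 * Suc W + 1 \<le> 4 * (2 * m)" by presburger
    then show ?case by (simp add: m_def)
  qed simp
  then show ?case using Suc by (simp add: power2_eq_square algebra_simps)
qed simp

lemma polytime_gram_word:
  "polytime_computable (\<lambda>x. gram_word c k (length (columns (poly p (length x)) (poly q (length x)) x))
        (cells (poly p (length x)) (poly q (length x)) x) un nb)"
proof -
  obtain f where f: "poly_bounded f" "\<And>x. \<exists>s'. runs (gram_program c k (coeffs q) (coeffs p) un nb) (init_state x) (f (length x))
     (out s' (gram_word c k (length (columns (poly p (length x)) (poly q (length x)) x))
        (cells (poly p (length x)) (poly q (length x)) x) un nb))"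
    using runs_gram_program[of c k "coeffs q" "coeffs p" un nb] unfolding poly_eq_horner by blast
  then obtain T :: "nat poly" where T: "\<And>n. f n \<le> poly T n" unfolding poly_bounded_def by blast
  have out: "tape_output (out s w 1) w" for s w
    by (auto simp: out_def te_def tp_def tape_output_def)
  show ?thesis
  proof (rule polytime_computable_cmd[OF cmd_wf_gram_program, where K = 9 and T = T])
    fix x
    show "\<exists>t s. t \<le> poly T (length x) \<and> exec 9 (gram_program c k (coeffs q) (coeffs p) un nb) (init_state x) t s \<and>
      tape_output (s 1) (gram_word c k (length (columns (poly p (length x)) (poly q (length x)) x))
        (cells (poly p (length x)) (poly q (length x)) x) un nb)"
      using f(2)[of x] T[of "length x"] out unfolding runs_def by (meson le_trans)
  qed simp_all
qed

lemma gram_code_bound: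
  assumes "k < 2 ^ c" "Suc k < 2 ^ c" "2 < (2::nat) ^ c"
  shows "fst (gram_code k ok i j) < 2 ^ c" "snd (gram_code k ok i j) < 2 ^ c"
  using assms by (auto simp: gram_code_def)

lemma gram_code_sym: "(\<And>i j. ok i j = ok j i) \<Longrightarrow> gram_code k ok i j = gram_code k ok j i"
  by (auto simp: gram_code_def)

text \<open>With the digits 1, 2, \<open>k\<close> of \<open>l\<close> to the base
  \<open>2 ^ L\<close>, the subtractions in \<open>flag_gram\<close> need no borrows: each entry
  keeps the leading digit 1, followed by two small digits.\<close>

lemma flag_gram_eq_code:
  "flag_gram (real (code_value L (2, k))) (real k) (2 ^ L) ok i j = real (code_value L (gram_code k ok i j))"
  by (auto simp: flag_gram_def flag_moment_def gram_code_def code_value_def)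

section \<open>The written matrix as a promised instance\<close>

context tile_gram
begin

definition gram_mat :: "nat \<Rightarrow> rat mat" where
  "gram_mat L = mat n n (\<lambda>(i, j). of_nat (code_value L (gram_code (2 ^ Suc d) ok i j)))"

lemma map_gram_mat:
  assumes "D = 2 ^ L" "l = real (code_value L (2, 2 ^ Suc d))"
  shows "map_mat real_of_rat (gram_mat L) = mat n n (\<lambda>(i, j). flag_gram l (2 ^ Suc d) D ok i j)"
proof -
  have k: "real (2 ^ Suc d) = 2 ^ Suc d" by simp
  show ?thesis unfolding assms gram_mat_def k[symmetric] flag_gram_eq_code
    by (rule eq_matI) (simp_all del: power_Suc)
qed

lemma promised_gram_mat:
  assumes "D = 2 ^ L" "l = real (code_value L (2, 2 ^ Suc d))"
  shows "promised_instance n (of_nat (code_value L (2, 2 ^ Suc d))) (gram_mat L)"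
  unfolding promised_instance_def
proof (intro conjI)
  show "transpose_mat (gram_mat L) = gram_mat L"
    unfolding gram_mat_def using gram_code_sym[of ok, OF ok_sym] by (intro eq_matI) auto
  obtain t where "corr_rep n t (flag_gram l (2 ^ Suc d) D ok)" using corr_rep_ex by blast
  then obtain p where "p \<in> carrier_vec (2 ^ n)" "0\<^sub>v (2 ^ n) \<le> p"
    "Xcomb n p = mat n n (\<lambda>(i, j). flag_gram l (2 ^ Suc d) D ok i j)"
    unfolding Xcomb_iff_corr_rep[symmetric] by blast
  then show "map_mat real_of_rat (gram_mat L) \<in> correlation_cone n"
    unfolding map_gram_mat[OF assms] correlation_cone_def mem_Collect_eq by metis
  show "(0::rat) < of_nat (code_value L (2, 2 ^ Suc d))"
    by (simp only: of_nat_0_less_iff) (simp add: code_value_def)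
qed (simp_all add: gram_mat_def)

text \<open>The bound of the instance is the weight \<open>l\<close> of the complement, so the
  decompositions within the bound are those to which complementation applies.\<close>

lemma relaxed_rank_le_gram_mat:
  assumes "D = 2 ^ L" "l = real (code_value L (2, 2 ^ Suc d))"
  shows "relaxed_rank_le n (of_nat (code_value L (2, 2 ^ Suc d))) (gram_mat L) \<longleftrightarrow> (\<exists>\<tau>. tiling d H V ty W us \<tau>)"
proof -
  have "relaxed_rank_le n (of_nat (code_value L (2, 2 ^ Suc d))) (gram_mat L) \<longleftrightarrow>
      (\<exists>t\<le>l. corr_rep n t (flag_gram l (2 ^ Suc d) D ok))"
    unfolding relaxed_rank_le_def map_gram_mat[OF assms] Xcomb_iff_corr_rep[symmetric] assms(2) of_rat_of_nat_eq by blast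
  then show ?thesis using corr_rep_imp_tiling tiling_imp_corr_rep by blast
qed

lemma enc_gram_mat:
  assumes c: "Suc (2 ^ Suc d) < 2 ^ c"
  shows "gram_word c (2 ^ Suc d) W us (\<lambda>u. unary_ok d (ty u)) (mark_ok d H V) =
    enc_instance n (of_nat (code_value (W + c) (2, 2 ^ Suc d))) (gram_mat (W + c))"
proof -
  have c': "2 ^ Suc d < (2::nat) ^ c" "2 < (2::nat) ^ c"
    using c one_le_power[of "2::nat" d] unfolding power_Suc by linarith+
  have E: "entry_word c W ab = enc_rat (of_nat (code_value (W + c) ab))" if "fst ab < 2 ^ c" "snd ab < 2 ^ c" for ab
    using entry_word_eq[of "fst ab" c "snd ab" W] that by simp
  have "gram_word c (2 ^ Suc d) W us (\<lambda>u. unary_ok d (ty u)) (mark_ok d H V) = enc_nat n @ entry_word c W (2, 2 ^ Suc d) @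
      concat (map (\<lambda>i. concat (map (\<lambda>j. entry_word c W (gram_code (2 ^ Suc d) ok i j)) [0..<n])) [0..<n])"
    unfolding gram_word_def rows_word[OF W] ..
  also have "\<dots> = enc_nat n @ enc_rat (of_nat (code_value (W + c) (2, 2 ^ Suc d))) @
      concat (map (\<lambda>i. concat (map (\<lambda>j. enc_rat (of_nat (code_value (W + c) (gram_code (2 ^ Suc d) ok i j)))) [0..<n])) [0..<n])"
    using E[OF gram_code_bound[OF c'(1) c c'(2)]] E[of "(2, 2 ^ Suc d)"] c' by (simp del: power_Suc upt_Suc)
  also have "concat (map (\<lambda>i. concat (map (\<lambda>j. enc_rat (of_nat (code_value (W + c) (gram_code (2 ^ Suc d) ok i j)))) [0..<n])) [0..<n]) =
      concat (map (\<lambda>i. concat (map (\<lambda>j. enc_rat (gram_mat (W + c) $$ (i, j))) [0..<n])) [0..<n])"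
    by (intro arg_cong[of _ _ concat] map_cong refl) (simp add: gram_mat_def del: power_Suc upt_Suc)
  finally show ?thesis unfolding enc_instance_def .
qed

end

text \<open>With \<open>k = 2 ^ Suc d\<close> one has
  \<open>1 + n * k \<le> (N + 3) * (k * k)\<close>, where \<open>N + 3 \<le> 4 * 2 ^ W\<close>; the
  term \<open>2 * d + 4\<close> in \<open>L\<close> accounts for \<open>4 * (k * k)\<close>. Taking
  \<open>W\<close> into the exponent lets the machine write the zeros of an entry by passes over the
  first row.\<close>

lemma tile_gram_bounds:
  fixes d N W :: nat
  assumes "N \<le> W * W"
  defines "n \<equiv> Suc (Suc N * 2 ^ Suc d)" and "L \<equiv> W + (2 * d + 4)"
  shows "1 + real n * 2 ^ Suc d \<le> 2 ^ L" "real n * 2 ^ L + 2 ^ Suc d \<le> real (code_value L (2, 2 ^ Suc d))"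
proof -
  define k :: nat where "k = 2 ^ Suc d"
  have k: "1 \<le> k" by (simp add: k_def)
  have kk: "k \<le> k * k" using mult_le_mono2[OF k, of k] by simp
  have "1 + n * k = 1 + k + Suc N * (k * k)" by (simp add: n_def k_def[symmetric] algebra_simps del: power_Suc)
  also have "\<dots> \<le> k * k + k * k + Suc N * (k * k)" using k kk by linarith
  also have "\<dots> = (N + 3) * (k * k)" by (simp add: algebra_simps)
  also have "\<dots> \<le> (W\<^sup>2 + 3) * (k * k)" using assms(1) by (simp add: power2_eq_square)
  also have "\<dots> \<le> (4 * 2 ^ W) * (k * k)" by (intro mult_le_mono1 square_le_pow2)
  also have "\<dots> = 2 ^ (W + (Suc d + Suc d) + 2)" unfolding power_add k_def by simp
  also have "W + (Suc d + Suc d) + 2 = L" by (simp add: L_def)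
  finally have nk: "1 + n * k \<le> 2 ^ L" .
  then have "real (1 + n * k) \<le> real (2 ^ L)" unfolding of_nat_le_iff .
  then show "1 + real n * 2 ^ Suc d \<le> 2 ^ L" by (simp add: k_def)
  have "n * 1 \<le> n * k" using k by (rule mult_le_mono2)
  then have "n \<le> 2 ^ L" using nk by linarith
  then have "n * 2 ^ L \<le> 2 ^ L * 2 ^ L" by (rule mult_le_mono1)
  moreover have "code_value L (2, k) = 2 ^ L * 2 ^ L + 2 * 2 ^ L + k"
    unfolding code_value_def mult_2[of L] power_add by simp
  ultimately have "n * 2 ^ L + k \<le> code_value L (2, k)" by linarith
  then have "real (n * 2 ^ L + k) \<le> real (code_value L (2, k))" unfolding of_nat_le_iff .
  then show "real n * 2 ^ L + 2 ^ Suc d \<le> real (code_value L (2, 2 ^ Suc d))" by (simp add: k_def)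
qed

theorem theorem4p3:
  shows "promise_NP_hard relaxed_rank_promise relaxed_rank_yes"
  unfolding promise_NP_hard_def
proof
  fix L assume "L \<in> NP"
  then obtain V q where V: "polytime_computable V"
    and L: "\<And>x. x \<in> L \<longleftrightarrow> (\<exists>y. length y \<le> poly q (length x) \<and> V (enc_pair x y) = [True])"
    unfolding NP_def by blast
  from V obtain M T where M: "wf_tm M" and T: "\<And>x. tm_computes_within M (poly T (length x)) x (V x)"
    unfolding polytime_computable_def by blast
  \<comment> \<open>A time bound uniform in the certificate: \<open>1 + 2 * length x\<close> is the
    length of \<open>enc_bits x\<close>.\<close>
  define p where "p = pcompose T ([:1, 2:] + q)"
  \<comment> \<open>The number of tiles depends on \<open>M\<close> only, so the number of colours
    is constant and the tables on colours can be built into the reduction.\<close>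
  define d where "d = card {t. tile_ok M t}"
  obtain h where h: "bij_betw h {0..<d} {t. tile_ok M t}"
    unfolding d_def using ex_bij_betw_nat_finite[OF finite_tiles] by blast
  define H where "H a b = hrel M (h a) (h b)" for a b
  define Ve where "Ve a b = vrel M (h a) (h b)" for a b
  define ty where "ty u a = tile_type M u (h a)" for u a
  \<comment> \<open>Enough binary digits for \<open>Suc (2 ^ Suc d)\<close>, the largest digit of an
    entry, and the surplus over \<open>W\<close> used in \<open>tile_gram_bounds\<close>.\<close>
  define c where "c = 2 * d + 4"
  define W where "W x = length (columns (poly p (length x)) (poly q (length x)) x)" for x
  define us where "us x = cells (poly p (length x)) (poly q (length x)) x" for x
  define f where "f x = gram_word c (2 ^ Suc d) (W x) (us x) (\<lambda>u. unary_ok d (ty u)) (mark_ok d H Ve)" for x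
  have "polytime_computable f"
    unfolding f_def W_def us_def by (rule polytime_gram_word)
  moreover have "f x \<in> relaxed_rank_promise \<and> (x \<in> L \<longleftrightarrow> f x \<in> relaxed_rank_yes)" for x
  proof -
    define B where "B = poly p (length x)"
    define Q where "Q = poly q (length x)"
    define D :: real where "D = 2 ^ (W x + c)"
    define l where "l = real (code_value (W x + c) (2, 2 ^ Suc d))"
    interpret tableau M B Q x V
    proof
      fix y :: "bool list" assume y: "length y \<le> Q"
      have "length (enc_pair x y) \<le> poly ([:1, 2:] + q) (length x)"
        using y by (simp add: enc_pair_def length_enc_bits Q_def)
      then have "poly T (length (enc_pair x y)) \<le> B"
        unfolding B_def p_def poly_pcompose by (rule poly_mono_nat)
      then show "tm_computes_within M B (enc_pair x y) (V (enc_pair x y))"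
        using T[of "enc_pair x y"] tm_steps_halted_mono unfolding tm_computes_within_def by blast
    qed (rule M)
    have Wx: "W x = length (columns B Q x)" by (simp add: W_def B_def Q_def)
    have usx: "us x = cells B Q x" by (simp add: us_def B_def Q_def)
    \<comment> \<open>There are \<open>B + 2\<close> rows, and a row has more than
      \<open>B + 2\<close> cells.\<close>
    have "length (us x) \<le> W x * W x"
      unfolding usx length_cells Wx by (intro mult_le_mono1) (simp add: length_columns)
    note bounds = tile_gram_bounds[OF this, of d]
    interpret G: tile_gram d H Ve ty "W x" "us x" l D
    proof
      show "2 \<le> W x" by (simp add: Wx length_columns)
      show "1 + real (Suc (Suc (length (us x)) * 2 ^ Suc d)) * 2 ^ Suc d \<le> D"
        using bounds(1) unfolding D_def c_def .
      show "real (Suc (Suc (length (us x)) * 2 ^ Suc d)) * D + 2 ^ Suc d \<le> l"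
        using bounds(2) unfolding D_def l_def c_def .
    qed (simp_all only: H_def Ve_def hrel_irrefl vrel_irrefl not_False_eq_True)
    have c: "Suc (2 ^ Suc d) < 2 ^ c"
    proof -
      define m :: nat where "m = 2 ^ d"
      have "1 \<le> m" by (simp add: m_def)
      define s where "s = m * m"
      have "m \<le> s" using mult_le_mono2[OF \<open>1 \<le> m\<close>, of m] by (simp add: s_def)
      moreover have "2 ^ c = 16 * s"
      proof -
        have "c = 4 + (d + d)" by (simp add: c_def)
        then show ?thesis unfolding s_def m_def by (simp only: power_add) simp
      qed
      moreover have "Suc (2 * a) < 16 * b" if "1 \<le> a" "a \<le> b" for a b :: nat
        using that by linarith
      ultimately have "Suc (2 * m) < 2 ^ c" using \<open>1 \<le> m\<close> by metis
      then show ?thesis unfolding m_def power_Suc .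
    qed
    define n where "n = Suc (Suc (length (us x)) * 2 ^ Suc d)"
    define \<rho> :: rat where "\<rho> = of_nat (code_value (W x + c) (2, 2 ^ Suc d))"
    have fx: "f x = enc_instance n \<rho> (G.gram_mat (W x + c))"
      unfolding f_def n_def \<rho>_def by (rule G.enc_gram_mat[OF c])
    have promise: "promised_instance n \<rho> (G.gram_mat (W x + c))"
      unfolding n_def \<rho>_def by (rule G.promised_gram_mat[OF D_def l_def])
    have "(\<exists>\<tau>. tiling d H Ve ty (W x) (us x) \<tau>) \<longleftrightarrow> (\<exists>\<tau>. tiled \<tau>)"
    proof
      assume "\<exists>\<tau>. tiling d H Ve ty (W x) (us x) \<tau>"
      then obtain \<tau> where \<tau>: "tiling d H Ve ty (W x) (us x) \<tau>" by blast
      have "tile_ok M (h (\<tau> v))" if "v < length (us x)" for v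
      proof -
        have "\<tau> v \<in> {0..<d}" using \<tau> that by (simp add: tiling_def)
        then show ?thesis using h by (auto simp: bij_betw_def)
      qed
      then have "tiled (\<lambda>v. h (\<tau> v))"
        using \<tau> unfolding tiled_def tiling_def usx Wx H_def Ve_def ty_def by blast
      then show "\<exists>\<tau>. tiled \<tau>" by blast
    next
      assume "\<exists>\<tau>. tiled \<tau>"
      then obtain \<tau> where \<tau>: "tiled \<tau>" by blast
      have "\<exists>a. v < length (us x) \<longrightarrow> a < d \<and> h a = \<tau> v" for v
      proof (cases "v < length (us x)")
        case True
        then have "\<tau> v \<in> h ` {0..<d}" using \<tau> h by (simp add: tiled_def usx bij_betw_def)
        then show ?thesis by auto
      qed simp
      then obtain \<sigma> where \<sigma>: "\<And>v. v < length (us x) \<Longrightarrow> \<sigma> v < d \<and> h (\<sigma> v) = \<tau> v" by metis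
      have "tiling d H Ve ty (W x) (us x) \<sigma>"
        using \<tau> \<sigma> unfolding tiled_def tiling_def usx Wx H_def Ve_def ty_def by simp
      then show "\<exists>\<tau>. tiling d H Ve ty (W x) (us x) \<tau>" by blast
    qed
    also have "\<dots> \<longleftrightarrow> x \<in> L"
      unfolding L using tiled_tile_at tiled_imp unfolding Q_def by blast
    finally have "relaxed_rank_le n \<rho> (G.gram_mat (W x + c)) \<longleftrightarrow> x \<in> L"
      using G.relaxed_rank_le_gram_mat[OF D_def l_def] unfolding n_def \<rho>_def by blast
    moreover have "f x \<in> relaxed_rank_yes \<longleftrightarrow> relaxed_rank_le n \<rho> (G.gram_mat (W x + c))"
      unfolding fx by (rule enc_instance_yes_iff[OF promise])
    moreover have "f x \<in> relaxed_rank_promise"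
      unfolding fx relaxed_rank_promise_def using promise by blast
    ultimately show ?thesis by blast
  qed
  ultimately show "\<exists>f. polytime_computable f \<and> (\<forall>x. f x \<in> relaxed_rank_promise) \<and> (\<forall>x. (x \<in> L) = (f x \<in> relaxed_rank_yes))"
    by blast
qed

end
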